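(* Let $\rho_{\mathrm{ST}}$ denote the semitoric packing density of a semitoric polygon. Then: (1) If $[\Delta,((a,h)),(+1)]$ is minimal of type (1) with parameters $a>0$ and $h\in(0,a/2)$, i.e. $\Delta$ has vertices $(0,0),(a,a/2),(2a,0)$, then $\rho_{\mathrm{ST}}=\dfrac{a^2+2h^2-2ah}{a^2}$. (2) If $[\Delta,((a,h_1),(a+b,h_2)),(+1,+1)]$ is minimal of type (2) with parameters $a>0$, $b\ge0$, $h_1,h_2\in(0,a)$, i.e. $\Delta$ has vertices $(0,0),(a,a),(a+b,a),(2a+b,0)$, then $\rho_{\mathrm{ST}}=\dfrac{a}{a+b}$. (3a) If $[\Delta,((a,h)),(+1)]$ is minimal of type (3a) with parameters $a>0$, $b>0$, $h\in(0,a)$, $n\in\mathbb{Z}_{\ge1}$, i.e. $\Delta$ has vertices $(0,0),(a,a),(a+b,a),(na+b,0)$, then $$\rho_{\mathrm{ST}}=\begin{cases}\dfrac{2a}{na+2b} & \text{if } n>1,\\[2mm] \dfrac{2a}{a+2b} & \text{if } n=1 \text{ and } a\le b,\\[2mm] \dfrac{a^2+b^2+(a-b)^2}{(a+2b)a} & \text{if } n=1 \text{ and } b<a<2b,\\[2mm] \dfrac{a^2+2b^2}{(a+2b)a} & \text{if } n=1\text{ and } a\ge 2b.\end{cases}$$ (3b) If $[\Delta,((a,h)),(+1)]$ is minimal of type (3b) with parameters $a>0$, $h\in(0,a)$, $n\in\mathbb{Z}_{\ge2}$, i.e. $\Delta$ has vertices $(0,0),(a,a),(na,0)$, then $\rho_{\mathrm{ST}}=\dfrac2n$.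 (3c) If $[\Delta,((a,h)),(+1)]$ is minimal of type (3c) with parameters $a>0$, $b\in(-a,0)$, $n\in\mathbb{Z}_{\ge2}$, $h\in\big(0,a+\frac{b}{n-1}\big)$, i.e. $\Delta$ has vertices $(0,0),(a+b,a+b),\big(a,a+\frac{b}{n-1}\big),(na+b,0)$, then $$\rho_{\mathrm{ST}}=\frac{(a+b)^2+\min\big\{((n-1)a+b-(n-2)h)^2,\,a^2\big\}}{(na+2b)a}.$$
   Context: Semitoric polygons. Let $T=\begin{pmatrix}1&0\\1&1\end{pmatrix}$. A (compact) polygon is rational if each edge is directed along an integer vector. Let $v$ be a vertex of a rational convex polygon and $u_1,u_2\in\mathbb{Z}^2$ the primitive integer vectors directing the edges emanating from $v$, ordered so that $\det(u_1,u_2)>0$. Then $v$ satisfies the Delzant condition if $\det(u_1,u_2)=1$; for $k\in\mathbb{Z}_{>0}$ it satisfies the fake corner condition for $k$ cuts if $\det(u_1,T^ku_2)=0$ and the hidden corner condition for $k$ cuts if $\det(u_1,T^ku_2)=1$. A semitoric polygon representative is a triple $(\Delta,\vec c,\vec\epsilon\,)$ where $\Delta\subset\mathbb{R}^2$ is a convex rational polygon, $\vec c=(c_1,\dots,c_m)$ are points of $\operatorname{int}(\Delta)$ (marked points, ordered lexicographically), and $\vec\epsilon\in\{\pm1\}^m$. The $i$-th cut is the intersection of $\Delta$ with the ray starting at $c_i$ in direction $(0,\epsilon_i)$. It is required that each point of $\partial\Delta$ met by exactly $k\ge1$ cuts is a vertex of $\Delta$ satisfying the fake or the hidden corner condition for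 $k$ cuts (then called a fake corner or hidden corner respectively), and that every other vertex satisfies the Delzant condition (these are called Delzant corners). Group action. For $j\in\mathbb{R}$ let $\mathfrak t_j(x,y)=(x,y+x-j)$ if $x\ge j$ and $\mathfrak t_j(x,y)=(x,y)$ otherwise. Let $\mathcal T$ be the group of transformations of $\mathbb{R}^2$ generated by powers of $T$ and vertical translations, and $G_m=\{1,-1\}^m$. An element $(\tau,\vec\epsilon\,')\in\mathcal T\times G_m$ acts by $(\tau,\vec\epsilon\,')\cdot(\Delta,\vec c,\vec\epsilon\,)=(\sigma(\Delta),\sigma(\vec c),(\epsilon_1'\epsilon_1,\dots,\epsilon_m'\epsilon_m))$, where $\sigma=\tau\circ\mathfrak t_{x_1}^{u_1}\circ\cdots\circ\mathfrak t_{x_m}^{u_m}$, $x_k$ is the first coordinate of $c_k$, and $u_k=\epsilon_k(1-\epsilon_k')/2$; we also write $\sigma$ for the group element. The result is again a representative. A semitoric polygon $[\Delta,\vec c,\vec\epsilon\,]$ is the orbit of a representative under $\mathcal T\times G_m$. The maps $\sigma$ preserve area. Packings. For $\lambda>0$ let $B(\lambda)=\{(x,y): x\ge0,\,y\ge0,\,x+y<\lambda\}$. For a representative $(\Delta,\vec c,\vec\epsilon\,)$ and a vertex $p$ of $\Delta$, a set $B\subset\Delta$ is an admissibly packed triangle at $p$ if there are $\sigma\in\mathcal T\times G_m$ and $\lambda>0$ such that: (1) $\sigma(p)$ is a Delzant corner of $\sigma\cdot(\Delta,\vec c,\vec\epsilon\,)$; (2) $\sigma(c_i)\notin\sigma(B)$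 for all $i$; (3) $\sigma(B)=M(B(\lambda))+\sigma(p)$ for some $M\in\mathrm{SL}_2(\mathbb{Z})$; (4) $\sigma(B)$ and $\sigma(\Delta)$ coincide in a small neighborhood of $\sigma(p)$. A packing of $(\Delta,\vec c,\vec\epsilon\,)$ is a union $P=\bigcup_i B_i$ of pairwise disjoint admissibly packed triangles. The semitoric packing density is $\rho_{\mathrm{ST}}([\Delta,\vec c,\vec\epsilon\,])=\sup_P\operatorname{area}(P)/\operatorname{area}(\Delta)$, the supremum over all packings $P$ of the representative $(\Delta,\vec c,\vec\epsilon\,)$; it does not depend on the chosen representative. *)

theory Defs
  imports "HOL-Analysis.Analysis"
begin

definition pt :: "real \<Rightarrow> real \<Rightarrow> real^2" where
  "pt x y = vector [x, y]"

definition T_mat :: "'a::comm_ring_1^2^2" where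
  "T_mat = vector [vector [1, 0], vector [1, 1]]"

definition real_vec :: "int^2 \<Rightarrow> real^2" where
  "real_vec u = (\<chi> i. real_of_int (u $ i))"

definition real_mat :: "int^2^2 \<Rightarrow> real^2^2" where
  "real_mat M = (\<chi> i j. real_of_int (M $ i $ j))"

definition primitive :: "int^2 \<Rightarrow> bool" where
  "primitive u \<longleftrightarrow> coprime (u $ 1) (u $ 2)"

text \<open>The determinant of the matrix with columns \<open>u\<close>, \<open>v\<close>.\<close>

definition det2 :: "int^2 \<Rightarrow> int^2 \<Rightarrow> int" where
  "det2 u v = det (transpose (vector [u, v] :: int^2^2))"

definition rational_polygon :: "(real^2) set \<Rightarrow> bool" where
  "rational_polygon \<Delta> \<longleftrightarrow> polytope \<Delta> \<and> interior \<Delta> \<noteq> {} \<and>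
     (\<forall>e. e edge_of \<Delta> \<longrightarrow>
        (\<exists>p u t. u \<noteq> 0 \<and> e = closed_segment p (p + t *\<^sub>R real_vec u)))"

definition directs_edge_at :: "(real^2) set \<Rightarrow> real^2 \<Rightarrow> int^2 \<Rightarrow> bool" where
  "directs_edge_at \<Delta> v u \<longleftrightarrow> primitive u \<and>
     (\<exists>t>0. closed_segment v (v + t *\<^sub>R real_vec u) edge_of \<Delta>)"

definition corner_directions :: "(real^2) set \<Rightarrow> real^2 \<Rightarrow> int^2 \<Rightarrow> int^2 \<Rightarrow> bool" where
  "corner_directions \<Delta> v u1 u2 \<longleftrightarrow> v extreme_point_of \<Delta> \<and>
     directs_edge_at \<Delta> v u1 \<and> directs_edge_at \<Delta> v u2 \<and> det2 u1 u2 > 0"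

definition delzant_condition :: "(real^2) set \<Rightarrow> real^2 \<Rightarrow> bool" where
  "delzant_condition \<Delta> v \<longleftrightarrow>
     (\<exists>u1 u2. corner_directions \<Delta> v u1 u2 \<and> det2 u1 u2 = 1)"

definition fake_condition :: "(real^2) set \<Rightarrow> real^2 \<Rightarrow> nat \<Rightarrow> bool" where
  "fake_condition \<Delta> v k \<longleftrightarrow>
     (\<exists>u1 u2. corner_directions \<Delta> v u1 u2 \<and> det2 u1 ((((*v) T_mat) ^^ k) u2) = 0)"

definition hidden_condition :: "(real^2) set \<Rightarrow> real^2 \<Rightarrow> nat \<Rightarrow> bool" where
  "hidden_condition \<Delta> v k \<longleftrightarrow>
     (\<exists>u1 u2. corner_directions \<Delta> v u1 u2 \<and> det2 u1 ((((*v) T_mat) ^^ k) u2) = 1)"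

text \<open>
  A triple \<open>(\<Delta>, c, \<epsilon>)\<close>: polygon, list of marked points, list of signs.
  Marked points may share their first coordinate, and may even coincide.
\<close>

type_synonym triple = "(real^2) set \<times> (real^2) list \<times> int list"

definition lex_le :: "real^2 \<Rightarrow> real^2 \<Rightarrow> bool" where
  "lex_le p q \<longleftrightarrow> p $ 1 < q $ 1 \<or> (p $ 1 = q $ 1 \<and> p $ 2 \<le> q $ 2)"

definition vertical_cut :: "triple \<Rightarrow> nat \<Rightarrow> (real^2) set" where
  "vertical_cut = (\<lambda>(\<Delta>, c, \<epsilon>) i. \<Delta> \<inter> {c ! i + t *\<^sub>R pt 0 (real_of_int (\<epsilon> ! i)) | t. t \<ge> 0})"

definition num_cuts :: "triple \<Rightarrow> real^2 \<Rightarrow> nat" where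
  "num_cuts = (\<lambda>(\<Delta>, c, \<epsilon>) q. card {i. i < length c \<and> q \<in> vertical_cut (\<Delta>, c, \<epsilon>) i})"

definition sign_lists :: "nat \<Rightarrow> int list set" where
  "sign_lists m = {\<epsilon>. length \<epsilon> = m \<and> set \<epsilon> \<subseteq> {1, -1}}"

definition semitoric_representative :: "triple \<Rightarrow> bool" where
  "semitoric_representative = (\<lambda>(\<Delta>, c, \<epsilon>).
     rational_polygon \<Delta> \<and> set c \<subseteq> interior \<Delta> \<and> sorted_wrt lex_le c \<and>
     \<epsilon> \<in> sign_lists (length c) \<and>
     (\<forall>q \<in> frontier \<Delta>. num_cuts (\<Delta>, c, \<epsilon>) q \<ge> 1 \<longrightarrow>
        q extreme_point_of \<Delta> \<and>
        (fake_condition \<Delta> q (num_cuts (\<Delta>, c, \<epsilon>) q) \<or>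
         hidden_condition \<Delta> q (num_cuts (\<Delta>, c, \<epsilon>) q))) \<and>
     (\<forall>v. v extreme_point_of \<Delta> \<and> num_cuts (\<Delta>, c, \<epsilon>) v = 0 \<longrightarrow> delzant_condition \<Delta> v))"

definition delzant_corner :: "triple \<Rightarrow> real^2 \<Rightarrow> bool" where
  "delzant_corner = (\<lambda>(\<Delta>, c, \<epsilon>) v.
     v extreme_point_of \<Delta> \<and> num_cuts (\<Delta>, c, \<epsilon>) v = 0 \<and> delzant_condition \<Delta> v)"

inductive_set T_group :: "(real^2 \<Rightarrow> real^2) set" where
  ident: "id \<in> T_group"
| shear: "((*v) T_mat) \<in> T_group"
| translation: "(\<lambda>p. p + pt 0 s) \<in> T_group"
| comp: "f \<in> T_group \<Longrightarrow> g \<in> T_group \<Longrightarrow> f \<circ> g \<in> T_group"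
| inverse: "f \<in> T_group \<Longrightarrow> inv f \<in> T_group"

definition half_shear :: "real \<Rightarrow> real^2 \<Rightarrow> real^2" where
  "half_shear j p = (if p $ 1 \<ge> j then pt (p $ 1) (p $ 2 + p $ 1 - j) else p)"

definition int_iterate :: "('a \<Rightarrow> 'a) \<Rightarrow> int \<Rightarrow> 'a \<Rightarrow> 'a" where
  "int_iterate f u = (if u \<ge> 0 then f ^^ nat u else inv f ^^ nat (- u))"

text \<open>
  The exponent of the \<open>k\<close>-th half shear is \<open>\<epsilon>\<^sub>k (1 - \<epsilon>'\<^sub>k) / 2\<close>; the integer division by 2
  is exact because \<open>\<epsilon>'\<^sub>k\<close> is 1 or -1.
\<close>

definition action_map :: "(real^2 \<Rightarrow> real^2) \<Rightarrow> int list \<Rightarrow> triple \<Rightarrow> real^2 \<Rightarrow> real^2" where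
  "action_map \<tau> \<epsilon>' = (\<lambda>(\<Delta>, c, \<epsilon>).
     \<tau> \<circ> foldr (\<circ>)
       (map (\<lambda>k. int_iterate (half_shear ((c ! k) $ 1)) (\<epsilon> ! k * (1 - \<epsilon>' ! k) div 2)) [0..<length c])
       id)"

definition act :: "(real^2 \<Rightarrow> real^2) \<Rightarrow> int list \<Rightarrow> triple \<Rightarrow> triple" where
  "act \<tau> \<epsilon>' = (\<lambda>(\<Delta>, c, \<epsilon>).
     (action_map \<tau> \<epsilon>' (\<Delta>, c, \<epsilon>) ` \<Delta>, map (action_map \<tau> \<epsilon>' (\<Delta>, c, \<epsilon>)) c, map2 (*) \<epsilon>' \<epsilon>))"

definition semitoric_orbit :: "triple \<Rightarrow> triple set" where
  "semitoric_orbit = (\<lambda>(\<Delta>, c, \<epsilon>).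
     {act \<tau> \<epsilon>' (\<Delta>, c, \<epsilon>) | \<tau> \<epsilon>'. \<tau> \<in> T_group \<and> \<epsilon>' \<in> sign_lists (length c)})"

definition std_triangle :: "real \<Rightarrow> (real^2) set" where
  "std_triangle l = {p. p $ 1 \<ge> 0 \<and> p $ 2 \<ge> 0 \<and> p $ 1 + p $ 2 < l}"

definition admissibly_packed :: "triple \<Rightarrow> real^2 \<Rightarrow> (real^2) set \<Rightarrow> bool" where
  "admissibly_packed = (\<lambda>(\<Delta>, c, \<epsilon>) p B.
     p extreme_point_of \<Delta> \<and> B \<subseteq> \<Delta> \<and>
     (\<exists>\<tau> \<epsilon>' \<sigma> l. \<tau> \<in> T_group \<and> \<epsilon>' \<in> sign_lists (length c) \<and>
        \<sigma> = action_map \<tau> \<epsilon>' (\<Delta>, c, \<epsilon>) \<and> l > 0 \<and>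
        delzant_corner (act \<tau> \<epsilon>' (\<Delta>, c, \<epsilon>)) (\<sigma> p) \<and>
        (\<forall>x \<in> set c. \<sigma> x \<notin> \<sigma> ` B) \<and>
        (\<exists>M. det M = 1 \<and> \<sigma> ` B = (\<lambda>x. real_mat M *v x + \<sigma> p) ` std_triangle l) \<and>
        (\<exists>U. open U \<and> \<sigma> p \<in> U \<and> \<sigma> ` B \<inter> U = \<sigma> ` \<Delta> \<inter> U)))"

definition packing :: "triple \<Rightarrow> (real^2) set \<Rightarrow> bool" where
  "packing X P \<longleftrightarrow>
     (\<exists>\<B>. (\<forall>B \<in> \<B>. \<exists>p. admissibly_packed X p B) \<and> disjoint \<B> \<and> P = \<Union>\<B>)"

definition packing_density :: "triple \<Rightarrow> real" where
  "packing_density X =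
     Sup {measure lebesgue P / measure lebesgue (fst X) | P. packing X P}"

text \<open>
  \<open>packing_density\<close> does not depend on the chosen representative of a semitoric polygon, so the
  density of the orbit is defined as the common value.
\<close>

definition rho_ST :: "triple set \<Rightarrow> real" where
  "rho_ST S = (THE r. \<forall>X \<in> S. packing_density X = r)"

text \<open>
  In each of the following definitions \<open>S\<close> is the orbit of the displayed representative.
\<close>

definition minimal_1 :: "real \<Rightarrow> real \<Rightarrow> triple set \<Rightarrow> bool" where
  "minimal_1 a h S \<longleftrightarrow> a > 0 \<and> h \<in> {0<..<a/2} \<and>
     (\<exists>X. X = (convex hull {pt 0 0, pt a (a/2), pt (2*a) 0}, [pt a h], [1]) \<and>
          semitoric_representative X \<and> S = semitoric_orbit X)"

text \<open>
  For \<open>b = 0\<close> the two marked points lie on the same vertical line, so that the lexicographic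
  order of a representative forces \<open>h1 \<le> h2\<close>; the vertices \<open>(a, a)\<close>, \<open>(a + b, a)\<close> then coincide.
\<close>

definition minimal_2 :: "real \<Rightarrow> real \<Rightarrow> real \<Rightarrow> real \<Rightarrow> triple set \<Rightarrow> bool" where
  "minimal_2 a b h1 h2 S \<longleftrightarrow> a > 0 \<and> b \<ge> 0 \<and> h1 \<in> {0<..<a} \<and> h2 \<in> {0<..<a} \<and>
     (\<exists>X. X = (convex hull {pt 0 0, pt a a, pt (a + b) a, pt (2*a + b) 0},
               [pt a h1, pt (a + b) h2], [1, 1]) \<and>
          semitoric_representative X \<and> S = semitoric_orbit X)"

definition minimal_3a :: "real \<Rightarrow> real \<Rightarrow> real \<Rightarrow> nat \<Rightarrow> triple set \<Rightarrow> bool" where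
  "minimal_3a a b h n S \<longleftrightarrow> a > 0 \<and> b > 0 \<and> h \<in> {0<..<a} \<and> n \<ge> 1 \<and>
     (\<exists>X. X = (convex hull {pt 0 0, pt a a, pt (a + b) a, pt (real n * a + b) 0}, [pt a h], [1]) \<and>
          semitoric_representative X \<and> S = semitoric_orbit X)"

definition minimal_3b :: "real \<Rightarrow> real \<Rightarrow> nat \<Rightarrow> triple set \<Rightarrow> bool" where
  "minimal_3b a h n S \<longleftrightarrow> a > 0 \<and> h \<in> {0<..<a} \<and> n \<ge> 2 \<and>
     (\<exists>X. X = (convex hull {pt 0 0, pt a a, pt (real n * a) 0}, [pt a h], [1]) \<and>
          semitoric_representative X \<and> S = semitoric_orbit X)"

definition minimal_3c :: "real \<Rightarrow> real \<Rightarrow> real \<Rightarrow> nat \<Rightarrow> triple set \<Rightarrow> bool" where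
  "minimal_3c a b h n S \<longleftrightarrow> a > 0 \<and> b \<in> {-a<..<0} \<and> n \<ge> 2 \<and>
     h \<in> {0<..<a + b / (real n - 1)} \<and>
     (\<exists>X. X = (convex hull {pt 0 0, pt (a + b) (a + b), pt a (a + b / (real n - 1)),
                            pt (real n * a + b) 0}, [pt a h], [1]) \<and>
          semitoric_representative X \<and> S = semitoric_orbit X)"

end

theory Submission
  imports Defs
begin

text \<open>
  All maps involved are vertical shifts \<open>(x, y) \<mapsto> (x, y + f x)\<close> with \<open>f\<close> piecewise linear. They commute and
  preserve area, so the density can be computed in one conveniently chosen base representative, whose
  other representatives are given by charts.

  An integral unimodular cone determines its pair of primitive generators. Hence an admissibly packed
  triangle at a given corner is determined by its chart and its size \<open>l\<close>: it is the triangle of size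
  \<open>l\<close> spanned by the two edges, bent along the vertical lines through the marked points beyond the
  corner, and has area \<open>l^2 / 2\<close>. Points above or below a marked point are corners without a cut only
  in charts in which the cut goes the other way, which leaves at most three corners that can be packed.
  The sizes are bounded since disjoint triangles cannot overlap along a common edge, since a triangle must
  avoid the marked points, and since it must stay inside the polygon on both sides of the bend. It
  remains to maximise a sum of squares subject to these linear constraints.
\<close>

text \<open>The obstacle is that a packed triangle must sit at a vertex of the representative at
  hand, and which points are vertices changes with the chart, whereas \<open>rho_ST\<close> asks for
  one value on the whole orbit. The upper bound is therefore proved for
  \<open>corner_packed\<close>, which asks for a vertex only in the chart where the triangle is
  straight, while the optimal packing uses only points that are vertices in every chart. The two
  bounds then meet in every representative. The base chart is chosen so that the corners that can be
  packed carry no cut in it: for one mark the cut points down, for two marks both cuts point up. All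
  optimal triangles are then straight in the base chart and given by linear inequalities. Competing
  triangles may be bent, but this does not help them: bending would push an edge that runs along the
  upper boundary out of the polygon, so a triangle contained in the polygon still follows the
  polygon edges at its corner, and two triangles on one edge meet once their sizes add up to more
  than its lattice length.\<close>

section \<open>Vertical shifts and the group action\<close>

lemma pt_nth [simp]: "pt x y $ 1 = x" "pt x y $ 2 = y"
  by (simp_all add: pt_def)

lemma vec2_eq_iff: "p = q \<longleftrightarrow> p $ 1 = q $ 1 \<and> p $ 2 = q $ 2" for p q :: "'a^2"
  by (simp add: vec_eq_iff forall_2)

lemma pt_eq_iff [simp]: "pt x y = pt x' y' \<longleftrightarrow> x = x' \<and> y = y'"
  by (simp add: vec2_eq_iff)

definition vsh :: "(real \<Rightarrow> real) \<Rightarrow> real^2 \<Rightarrow> real^2" where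
  "vsh f p = pt (p $ 1) (p $ 2 + f (p $ 1))"

lemma vsh_nth [simp]: "vsh f p $ 1 = p $ 1" "vsh f p $ 2 = p $ 2 + f (p $ 1)"
  by (simp_all add: vsh_def)

lemma vsh_vsh [simp]: "vsh f (vsh g p) = vsh (\<lambda>x. g x + f x) p"
  by (simp add: vec2_eq_iff)

lemma vsh_comp: "vsh f \<circ> vsh g = vsh (\<lambda>x. g x + f x)"
  by (simp add: fun_eq_iff)

lemma vsh_zero: "vsh (\<lambda>x. 0) = id"
  by (simp add: fun_eq_iff vec2_eq_iff)

lemma vsh_zero_apply [simp]: "vsh (\<lambda>x. 0) p = p"
  by (simp add: vec2_eq_iff)

lemma vsh_eq_iff [simp]: "vsh f p = vsh f q \<longleftrightarrow> p = q"
  by (auto simp: vec2_eq_iff)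

lemma inj_vsh: "inj (vsh f)"
  by (simp add: inj_def)

lemma vsh_uminus [simp]: "vsh f (vsh (\<lambda>x. - f x) p) = p" "vsh (\<lambda>x. - f x) (vsh f p) = p"
  by (simp_all add: vec2_eq_iff)

lemma inv_vsh: "inv (vsh f) = vsh (\<lambda>x. - f x)"
  by (rule inv_equality) auto

lemma vsh_image: "vsh f ` S = {z. vsh (\<lambda>x. - f x) z \<in> S}"
  by (auto simp: image_iff) (metis vsh_uminus(1))

lemma vsh_cong: "(\<And>x. f x = g x) \<Longrightarrow> vsh f = vsh g"
  by (simp add: fun_eq_iff vec2_eq_iff)

lemma T_mat_mult: "T_mat *v p = pt (p $ 1) (p $ 1 + p $ 2)" for p :: "real^2"
  by (simp add: vec2_eq_iff T_mat_def matrix_vector_mult_def sum_2)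

lemma vsh_funpow: "vsh f ^^ n = vsh (\<lambda>x. real n * f x)"
  by (induction n) (simp_all add: vsh_zero vsh_comp algebra_simps id_def)

text \<open>The generators add affine functions of slope 0 or 1; slopes and offsets add under
  composition and change sign under inversion. With \<open>vsh_T_group\<close> this identifies the
  group with the shifts by affine functions of integer slope.\<close>

lemma T_group_vsh:
  assumes "f \<in> T_group" shows "\<exists>k::int. \<exists>r. f = vsh (\<lambda>x. of_int k * x + r)"
  using assms
proof induction
  case ident
  show ?case by (rule exI[of _ 0], rule exI[of _ 0]) (simp add: vsh_zero)
next
  case shear
  show ?case
    by (rule exI[of _ 1], rule exI[of _ 0]) (simp add: fun_eq_iff T_mat_mult vec2_eq_iff)
next
  case (translation s)
  show ?case by (rule exI[of _ 0], rule exI[of _ s]) (simp add: fun_eq_iff vec2_eq_iff)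
next
  case (comp f g)
  then obtain k r k' r' where "f = vsh (\<lambda>x. of_int k * x + r)" "g = vsh (\<lambda>x. of_int k' * x + r')"
    by blast
  then show ?case
    by (intro exI[of _ "k + k'"] exI[of _ "r + r'"]) (simp add: fun_eq_iff vec2_eq_iff algebra_simps)
next
  case (inverse f)
  then obtain k r where "f = vsh (\<lambda>x. of_int k * x + r)" by blast
  then show ?case
    by (intro exI[of _ "- k"] exI[of _ "- r"]) (simp only: inv_vsh, simp add: fun_eq_iff vec2_eq_iff)
qed

lemma vsh_T_group: "vsh (\<lambda>x. of_int k * x + r) \<in> T_group"
proof -
  have pow: "vsh (\<lambda>x. real n * x) \<in> T_group" for n
  proof (induction n)
    case 0
    then show ?case using T_group.ident by (simp add: vsh_zero[unfolded id_def] id_def)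
  next
    case (Suc n)
    have "vsh (\<lambda>x. real (Suc n) * x) = ((*v) T_mat) \<circ> vsh (\<lambda>x. real n * x)"
      by (simp add: fun_eq_iff T_mat_mult vec2_eq_iff algebra_simps)
    then show ?case using T_group.comp[OF T_group.shear Suc] by metis
  qed
  have "vsh (\<lambda>x. of_int k * x) \<in> T_group"
  proof (cases "k \<ge> 0")
    case True
    then show ?thesis using pow[of "nat k"] by simp
  next
    case False
    then show ?thesis using T_group.inverse[OF pow[of "nat (- k)"]] by (simp add: inv_vsh)
  qed
  from T_group.comp[OF T_group.translation[of r] this] show ?thesis
    by (rule back_subst[of "\<lambda>f. f \<in> T_group"]) (simp add: fun_eq_iff vec2_eq_iff)
qed

lemma half_shear_vsh: "half_shear j = vsh (\<lambda>x. max 0 (x - j))"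
  by (auto simp: fun_eq_iff half_shear_def vec2_eq_iff)

lemma int_iterate_half_shear:
  "int_iterate (half_shear j) u = vsh (\<lambda>x. of_int u * max 0 (x - j))"
  by (auto simp: int_iterate_def half_shear_vsh inv_vsh vsh_funpow)

text \<open>The height added by the composed half shears with exponents \<open>v\<close>. Being a
  sum, it is insensitive to the order of the marks, and marks on a common vertical line simply
  accumulate.\<close>

definition bend :: "(real^2) list \<Rightarrow> (nat \<Rightarrow> int) \<Rightarrow> real \<Rightarrow> real" where
  "bend c v x = (\<Sum>i<length c. of_int (v i) * max 0 (x - c ! i $ 1))"

lemma foldr_vsh: "foldr (\<circ>) (map (\<lambda>k. vsh (g k)) xs) id = vsh (\<lambda>x. \<Sum>k\<leftarrow>xs. g k x)"
  by (induction xs) (simp_all add: vsh_zero vsh_comp add.commute)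

lemma action_map_bend:
  "action_map \<tau> \<epsilon>' (\<Delta>, c, \<epsilon>) = \<tau> \<circ> vsh (bend c (\<lambda>i. \<epsilon> ! i * (1 - \<epsilon>' ! i) div 2))"
  by (simp add: action_map_def int_iterate_half_shear foldr_vsh bend_def[abs_def]
      interv_sum_list_conv_sum_set_nat atLeast0LessThan)

text \<open>
  The map to the representative with signs \<open>s\<close> of the orbit of one with signs \<open>\<epsilon>\<close>; the division by 2 is exact.
\<close>

definition chart :: "(real^2) list \<Rightarrow> int list \<Rightarrow> int list \<Rightarrow> int \<Rightarrow> real \<Rightarrow> real^2 \<Rightarrow> real^2" where
  "chart c \<epsilon> s k r = vsh (\<lambda>x. of_int k * x + r + bend c (\<lambda>i. (\<epsilon> ! i - s ! i) div 2) x)"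

lemma sign_lists_nth: "s \<in> sign_lists m \<Longrightarrow> i < m \<Longrightarrow> s ! i = 1 \<or> s ! i = - 1"
  unfolding sign_lists_def using nth_mem by fastforce

lemma sign_lists_length: "s \<in> sign_lists m \<Longrightarrow> length s = m"
  by (simp add: sign_lists_def)

lemma sign_lists_map2:
  assumes "s \<in> sign_lists m" "t \<in> sign_lists m"
  shows "map2 (*) s t \<in> sign_lists m"
proof -
  have len: "length s = m" "length t = m"
    using assms by (simp_all add: sign_lists_length)
  have "x \<in> {1, -1}" if "x \<in> set (map2 (*) s t)" for x
  proof -
    obtain i where "i < length (map2 (*) s t)" "x = map2 (*) s t ! i"
      using \<open>x \<in> set (map2 (*) s t)\<close> by (metis in_set_conv_nth)
    then have "i < m" "x = s ! i * t ! i"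
      using len by auto
    then show ?thesis
      using assms[THEN sign_lists_nth, of i] by auto
  qed
  moreover have "length (map2 (*) s t) = m"
    using len by simp
  ultimately show ?thesis
    unfolding sign_lists_def by blast
qed

lemma bend_cong: "(\<And>i. i < length c \<Longrightarrow> v i = w i) \<Longrightarrow> bend c v = bend c w"
  by (auto simp: bend_def fun_eq_iff intro!: sum.cong)

lemma bend_add: "bend c v x + bend c w x = bend c (\<lambda>i. v i + w i) x"
  by (simp add: bend_def sum.distrib[symmetric] algebra_simps)

lemma bend_eq_marks:
  assumes "length c' = length c" "\<And>i. i < length c \<Longrightarrow> c' ! i $ 1 = c ! i $ 1"
  shows "bend c' v = bend c v"
  using assms by (auto simp: bend_def fun_eq_iff intro!: sum.cong)

text \<open>The exponent \<epsilon>(1 - \<epsilon>')/2 equals (\<epsilon> -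
  \<epsilon>'\<epsilon>)/2, so a group element can be indexed by the signs it produces instead of
  the signs it multiplies by.\<close>

lemma action_map_chart:
  assumes "\<epsilon> \<in> sign_lists (length c)" "\<epsilon>' \<in> sign_lists (length c)"
  shows "action_map (vsh (\<lambda>x. of_int k * x + r)) \<epsilon>' (\<Delta>, c, \<epsilon>) = chart c \<epsilon> (map2 (*) \<epsilon>' \<epsilon>) k r"
proof -
  have "bend c (\<lambda>i. \<epsilon> ! i * (1 - \<epsilon>' ! i) div 2) = bend c (\<lambda>i. (\<epsilon> ! i - map2 (*) \<epsilon>' \<epsilon> ! i) div 2)"
  proof (rule bend_cong)
    fix i assume "i < length c"
    then show "\<epsilon> ! i * (1 - \<epsilon>' ! i) div 2 = (\<epsilon> ! i - map2 (*) \<epsilon>' \<epsilon> ! i) div 2"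
      using assms[THEN sign_lists_length] by (simp add: algebra_simps)
  qed
  then show ?thesis
    by (simp add: action_map_bend chart_def vsh_comp algebra_simps)
qed

text \<open>The exponents telescope: (\<epsilon> - s)/2 + (s - s')/2 = (\<epsilon> - s')/2, all
  divisions being exact for signs. Charts move marks only vertically, so the walls along which the
  second chart bends are the original ones.\<close>

lemma chart_chart:
  assumes "\<epsilon> \<in> sign_lists (length c)" "s \<in> sign_lists (length c)" "s' \<in> sign_lists (length c)"
  shows "chart (map (chart c \<epsilon> s k r) c) s s' k' r' \<circ> chart c \<epsilon> s k r
         = chart c \<epsilon> s' (k + k') (r + r')"
proof -
  have 1: "bend (map (chart c \<epsilon> s k r) c) v = bend c v" for v
    by (rule bend_eq_marks) (simp_all add: chart_def)
  have 2: "bend c (\<lambda>i. (\<epsilon> ! i - s ! i) div 2 + (s ! i - s' ! i) div 2)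
      = bend c (\<lambda>i. (\<epsilon> ! i - s' ! i) div 2)"
  proof (rule bend_cong)
    fix i assume "i < length c"
    then show "(\<epsilon> ! i - s ! i) div 2 + (s ! i - s' ! i) div 2 = (\<epsilon> ! i - s' ! i) div 2"
      using assms[THEN sign_lists_nth, of i] by auto
  qed
  show ?thesis
    unfolding chart_def[of "map _ _"] 1
    by (simp add: fun_eq_iff chart_def vec2_eq_iff algebra_simps bend_add 2)
qed

section \<open>Area\<close>

lemma measure_vsh_affine:
  assumes "S \<in> lmeasurable"
  shows "vsh (\<lambda>x. k * x + r) ` S \<in> lmeasurable \<and>
    measure lebesgue (vsh (\<lambda>x. k * x + r) ` S) = measure lebesgue S"
proof -
  have lin: "linear (vsh (\<lambda>x. k * x))"
    by (rule linearI) (simp_all add: vec2_eq_iff algebra_simps)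
  have det: "det (matrix (vsh (\<lambda>x. k * x))) = 1"
    by (simp add: det_2 matrix_def axis_def)
  have *: "vsh (\<lambda>x. k * x + r) ` S = (+) (pt 0 r) ` vsh (\<lambda>x. k * x) ` S"
    by (auto simp: image_image vec2_eq_iff intro!: image_cong)
  show ?thesis
    unfolding * using measurable_linear_image[OF lin assms] measure_linear_image[OF lin assms] det
    by (simp add: measurable_translation measure_translation)
qed

text \<open>Cut along the vertical line at \<open>c\<close>: the left part is fixed, the right part
  undergoes an affine shear of determinant 1, and the two images stay on their sides of the
  line.\<close>

lemma measure_vsh_hinge:
  assumes "S \<in> lmeasurable"
  shows "vsh (\<lambda>x. k * max 0 (x - c)) ` S \<in> lmeasurable \<and>
    measure lebesgue (vsh (\<lambda>x. k * max 0 (x - c)) ` S) = measure lebesgue S"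
proof -
  define L where "L = S \<inter> {p. p $ 1 \<le> c}"
  define R where "R = S - {p. p $ 1 \<le> c}"
  have half: "{p::real^2. p $ 1 \<le> c} \<in> sets lebesgue"
    by (simp add: borel_closed closed_halfspace_component_le_cart)
  have LR: "L \<in> lmeasurable" "R \<in> lmeasurable"
    unfolding L_def R_def using assms half by (auto intro: fmeasurable_Int_fmeasurable fmeasurable_Diff)
  have iL: "vsh (\<lambda>x. k * max 0 (x - c)) ` L = L"
    by (rule trans[OF image_cong[of L L _ id]]) (auto simp: L_def vec2_eq_iff)
  have iR: "vsh (\<lambda>x. k * max 0 (x - c)) ` R = vsh (\<lambda>x. k * x + (- k * c)) ` R"
    by (rule image_cong) (auto simp: R_def vec2_eq_iff algebra_simps max_def)
  note mR = measure_vsh_affine[OF LR(2), of k "- k * c", folded iR]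
  have S: "S = L \<union> R" "L \<inter> R = {}"
    by (auto simp: L_def R_def)
  have im: "vsh (\<lambda>x. k * max 0 (x - c)) ` S = L \<union> vsh (\<lambda>x. k * max 0 (x - c)) ` R"
    by (simp add: S(1) image_Un iL)
  have dis: "L \<inter> vsh (\<lambda>x. k * max 0 (x - c)) ` R = {}"
    by (auto simp: L_def R_def)
  have "measure lebesgue (vsh (\<lambda>x. k * max 0 (x - c)) ` S) = measure lebesgue L + measure lebesgue R"
    unfolding im using measure_Un3[OF LR(1) conjunct1[OF mR]] mR by (simp add: dis)
  also have "\<dots> = measure lebesgue S"
    using measure_Un3[OF LR] S by simp
  finally show ?thesis
    using fmeasurable.Un[OF LR(1) conjunct1[OF mR]] im by metis
qed

lemma measure_vsh:
  fixes n :: nat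
  assumes "S \<in> lmeasurable"
  shows "vsh (\<lambda>x. k * x + r + (\<Sum>i<n. v i * max 0 (x - b i))) ` S \<in> lmeasurable \<and>
    measure lebesgue (vsh (\<lambda>x. k * x + r + (\<Sum>i<n. v i * max 0 (x - b i))) ` S) = measure lebesgue S"
proof (induction n)
  case 0
  then show ?case using measure_vsh_affine[OF assms] by simp
next
  case (Suc n)
  have "vsh (\<lambda>x. k * x + r + (\<Sum>i<Suc n. v i * max 0 (x - b i))) ` S
      = vsh (\<lambda>x. v n * max 0 (x - b n)) ` vsh (\<lambda>x. k * x + r + (\<Sum>i<n. v i * max 0 (x - b i))) ` S"
    by (simp add: image_image vec2_eq_iff add.assoc)
  then show ?case
    using measure_vsh_hinge[OF conjunct1[OF Suc], of "v n" "b n"] Suc by (simp only: simp_thms)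
qed

definition cross2 :: "real^2 \<Rightarrow> real^2 \<Rightarrow> real" where
  "cross2 u v = u $ 1 * v $ 2 - u $ 2 * v $ 1"

text \<open>The image of \<open>std_triangle l\<close> under the affine map with columns
  \<open>u\<close>, \<open>v\<close> and offset \<open>p\<close>; the side opposite to
  \<open>p\<close> is missing.\<close>

definition tri :: "real^2 \<Rightarrow> real^2 \<Rightarrow> real^2 \<Rightarrow> real \<Rightarrow> (real^2) set" where
  "tri p u v l = {p + s *\<^sub>R u + t *\<^sub>R v | s t. 0 \<le> s \<and> 0 \<le> t \<and> s + t < l}"

text \<open>Cramer's rule: since the determinant is 1, the coefficients of \<open>z - p\<close> in
  the basis \<open>u\<close>, \<open>v\<close> are the two cross products. Membership becomes three
  linear inequalities.\<close>

lemma mem_tri_iff: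
  assumes "cross2 u v = 1"
  shows "z \<in> tri p u v l \<longleftrightarrow>
    0 \<le> cross2 (z - p) v \<and> 0 \<le> cross2 u (z - p) \<and> cross2 (z - p) v + cross2 u (z - p) < l"
proof -
  have sol: "z = p + s *\<^sub>R u + t *\<^sub>R v \<longleftrightarrow> s = cross2 (z - p) v \<and> t = cross2 u (z - p)" for s t
  proof
    assume z: "z = p + s *\<^sub>R u + t *\<^sub>R v"
    have "cross2 (z - p) v = s * cross2 u v" "cross2 u (z - p) = t * cross2 u v"
      by (simp_all add: z cross2_def algebra_simps)
    then show "s = cross2 (z - p) v \<and> t = cross2 u (z - p)" using assms by simp
  next
    assume st: "s = cross2 (z - p) v \<and> t = cross2 u (z - p)"
    have "s * u $ 1 + t * v $ 1 = cross2 u v * (z $ 1 - p $ 1)"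
      "s * u $ 2 + t * v $ 2 = cross2 u v * (z $ 2 - p $ 2)"
      by (simp_all add: st cross2_def algebra_simps)
    then show "z = p + s *\<^sub>R u + t *\<^sub>R v"
      using assms by (simp add: vec2_eq_iff)
  qed
  then show ?thesis
    by (auto simp: tri_def)
qed

lemma tri_memI: "0 \<le> s \<Longrightarrow> 0 \<le> t \<Longrightarrow> s + t < l \<Longrightarrow> z = p + s *\<^sub>R u + t *\<^sub>R v \<Longrightarrow> z \<in> tri p u v l"
  unfolding tri_def by blast

lemma measure_tri:
  assumes "cross2 u v = 1" "0 < l"
  shows "tri p u v l \<in> lmeasurable \<and> measure lebesgue (tri p u v l) = l^2 / 2"
proof -
  define H where "H = convex hull {p, p + l *\<^sub>R u, p + l *\<^sub>R v}"
  \<comment> \<open>A normal vector of the missing side, scaled so that its inner product with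
    \<open>p + s u + t v\<close> is \<open>s + t\<close> up to a constant.\<close>
  define a where "a = pt (v $ 2 - u $ 2) (u $ 1 - v $ 1)"
  define N where "N = H \<inter> {z. a \<bullet> z = a \<bullet> p + l}"
  have "a \<noteq> 0"
  proof
    assume "a = 0"
    then have "u = v" by (auto simp: a_def vec2_eq_iff)
    then show False using assms by (simp add: cross2_def)
  qed
  then have "negligible N"
    unfolding N_def by (intro negligible_subset[OF negligible_hyperplane[of a "a \<bullet> p + l"]]) auto
  have "compact H"
    unfolding H_def by (intro finite_imp_compact_convex_hull) simp
  have H: "H = {p + s *\<^sub>R u + t *\<^sub>R v | s t. 0 \<le> s \<and> 0 \<le> t \<and> s + t \<le> l}"
  proof (intro equalityI subsetI)
    fix z assume "z \<in> H"
    then obtain x y w where w: "0 \<le> x" "0 \<le> y" "0 \<le> w" "x + y + w = 1"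
      "z = x *\<^sub>R p + y *\<^sub>R (p + l *\<^sub>R u) + w *\<^sub>R (p + l *\<^sub>R v)"
      unfolding H_def convex_hull_3 by blast
    have "z = (x + y + w) *\<^sub>R p + (y * l) *\<^sub>R u + (w * l) *\<^sub>R v"
      by (simp add: w(5) algebra_simps)
    then have "z = p + (y * l) *\<^sub>R u + (w * l) *\<^sub>R v"
      using w(4) by simp
    moreover have "(y + w) * l \<le> 1 * l"
      using w assms by (intro mult_right_mono) auto
    ultimately show "z \<in> {p + s *\<^sub>R u + t *\<^sub>R v | s t. 0 \<le> s \<and> 0 \<le> t \<and> s + t \<le> l}"
      using w(1-3) assms(2)
      by (intro CollectI exI[of _ "y * l"] exI[of _ "w * l"]) (simp add: distrib_right)
  next
    fix z assume "z \<in> {p + s *\<^sub>R u + t *\<^sub>R v | s t. 0 \<le> s \<and> 0 \<le> t \<and> s + t \<le> l}"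
    then obtain s t where st: "0 \<le> s" "0 \<le> t" "s + t \<le> l" "z = p + s *\<^sub>R u + t *\<^sub>R v" by blast
    have z: "z = (1 - s / l - t / l) *\<^sub>R p + (s / l) *\<^sub>R (p + l *\<^sub>R u) + (t / l) *\<^sub>R (p + l *\<^sub>R v)"
      using assms(2) by (simp add: st(4) algebra_simps)
    have w: "0 \<le> 1 - s / l - t / l"
      using st(3) assms(2) by (simp add: diff_diff_eq add_divide_distrib[symmetric])
    have "0 \<le> s / l" "0 \<le> t / l" "1 - s / l - t / l + s / l + t / l = 1"
      using st assms(2) by simp_all
    with w z show "z \<in> H"
      unfolding H_def convex_hull_3 by blast
  qed
  have inner: "a \<bullet> (p + s *\<^sub>R u + t *\<^sub>R v) = a \<bullet> p + (s + t)" for s t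
  proof -
    have "a \<bullet> (p + s *\<^sub>R u + t *\<^sub>R v) = a \<bullet> p + (s + t) * cross2 u v"
      by (simp add: inner_vec_def sum_2 a_def cross2_def algebra_simps)
    then show ?thesis using assms by simp
  qed
  have tri: "tri p u v l = H - N"
  proof (intro equalityI subsetI)
    fix z assume "z \<in> tri p u v l"
    then obtain s t where "0 \<le> s" "0 \<le> t" "s + t < l" "z = p + s *\<^sub>R u + t *\<^sub>R v"
      unfolding tri_def by blast
    then show "z \<in> H - N"
      unfolding N_def H by (auto simp only: inner mem_Collect_eq Diff_iff Int_iff) (metis less_eq_real_def)
  next
    fix z assume "z \<in> H - N"
    then obtain s t where st: "0 \<le> s" "0 \<le> t" "s + t \<le> l" "z = p + s *\<^sub>R u + t *\<^sub>R v" "z \<notin> N"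
      unfolding H by blast
    then have "s + t \<noteq> l"
      using inner[of s t] \<open>z \<in> H - N\<close> unfolding N_def by auto
    with st show "z \<in> tri p u v l"
      by (intro tri_memI[of s t]) auto
  qed
  have "H \<in> lmeasurable"
    using \<open>compact H\<close> by (rule lmeasurable_compact)
  moreover have nul: "N \<in> null_sets lebesgue"
    using \<open>negligible N\<close> by (simp add: negligible_iff_null_sets)
  moreover have "measure lebesgue H = l^2 / 2"
  proof -
    have "measure lebesgue H = measure lborel H"
      using \<open>compact H\<close> by (simp add: compact_imp_closed)
    also have "\<dots> = \<bar>- (l * l * cross2 u v)\<bar> / 2"
      unfolding H_def content_triangle by (simp add: cross2_def algebra_simps)
    finally show ?thesis using assms by (simp add: power2_eq_square)
  qed
  ultimately show ?thesis
    unfolding tri using fmeasurable_Diff measure_Diff_null_set[OF fmeasurableD nul] by (metis null_setsD2)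
qed

section \<open>Packings in the charts of a base representative\<close>

definition chart_triple :: "triple \<Rightarrow> int list \<Rightarrow> int \<Rightarrow> real \<Rightarrow> triple" where
  "chart_triple = (\<lambda>(\<Delta>, c, \<epsilon>) s k r. (chart c \<epsilon> s k r ` \<Delta>, map (chart c \<epsilon> s k r) c, s))"

text \<open>The condition on the marks says that no cut of the chart with signs \<open>s\<close>
  meets the corner. It is stated in base coordinates because charts preserve vertical distances on a
  vertical line.\<close>

definition packed_in_chart ::
  "(real^2) set \<Rightarrow> (real^2) list \<Rightarrow> real^2 \<Rightarrow> (real^2) set \<Rightarrow> int list \<Rightarrow> (real^2 \<Rightarrow> real^2) \<Rightarrow> bool" where
  "packed_in_chart \<Delta> c p B s \<sigma> \<longleftrightarrow> (\<exists>l M U. l > 0 \<and> det M = 1 \<and>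
     \<sigma> p extreme_point_of \<sigma> ` \<Delta> \<and> delzant_condition (\<sigma> ` \<Delta>) (\<sigma> p) \<and>
     (\<forall>i<length c. c ! i $ 1 = p $ 1 \<longrightarrow> of_int (s ! i) * (p $ 2 - c ! i $ 2) < 0) \<and>
     \<sigma> ` B = (\<lambda>x. real_mat M *v x + \<sigma> p) ` std_triangle l \<and>
     open U \<and> \<sigma> p \<in> U \<and> \<sigma> ` B \<inter> U = \<sigma> ` \<Delta> \<inter> U)"

text \<open>
  Unlike in \<^const>\<open>admissibly_packed\<close>, the point \<open>p\<close> need not be a vertex in the base chart itself:
  this makes the notion invariant under a change of the base chart.
\<close>

definition corner_packed :: "triple \<Rightarrow> real^2 \<Rightarrow> (real^2) set \<Rightarrow> bool" where
  "corner_packed = (\<lambda>(\<Delta>, c, \<epsilon>) p B. B \<subseteq> \<Delta> \<and> set c \<inter> B = {} \<and>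
     (\<exists>s\<in>sign_lists (length c). \<exists>k r. packed_in_chart \<Delta> c p B s (chart c \<epsilon> s k r)))"

abbreviation chart_vertex ::
  "(real^2) list \<Rightarrow> int list \<Rightarrow> int list \<Rightarrow> int \<Rightarrow> real \<Rightarrow> (real^2) set \<Rightarrow> real^2 \<Rightarrow> bool" where
  "chart_vertex c \<epsilon> s k r \<Delta> p \<equiv> chart c \<epsilon> s k r p extreme_point_of chart c \<epsilon> s k r ` \<Delta>"

lemma chart_nth [simp]: "chart c \<epsilon> s k r p $ 1 = p $ 1"
  by (simp add: chart_def)

lemma chart_diff: "chart c \<epsilon> s k r p $ 2 - chart c \<epsilon> s k r q $ 2 = p $ 2 - q $ 2" if "p $ 1 = q $ 1"
  using that by (simp add: chart_def)

lemma inj_chart: "inj (chart c \<epsilon> s k r)"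
  by (simp add: chart_def inj_vsh)

lemma chart_eq_iff [simp]: "chart c \<epsilon> s k r p = chart c \<epsilon> s k r q \<longleftrightarrow> p = q"
  by (simp add: chart_def)

lemma num_cuts_eq_0:
  assumes "s \<in> sign_lists (length c)" "q \<in> \<Delta>"
  shows "num_cuts (\<Delta>, c, s) q = 0 \<longleftrightarrow>
    (\<forall>i<length c. c ! i $ 1 = q $ 1 \<longrightarrow> of_int (s ! i) * (q $ 2 - c ! i $ 2) < 0)"
proof -
  have *: "q \<in> vertical_cut (\<Delta>, c, s) i \<longleftrightarrow> c ! i $ 1 = q $ 1 \<and> of_int (s ! i) * (q $ 2 - c ! i $ 2) \<ge> 0"
    if "i < length c" for i
  proof -
    have s: "s ! i = 1 \<or> s ! i = - 1" using sign_lists_nth[OF assms(1) that] .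
    show ?thesis
    proof
      assume "q \<in> vertical_cut (\<Delta>, c, s) i"
      then obtain t where "t \<ge> 0" "q = c ! i + t *\<^sub>R pt 0 (of_int (s ! i))"
        by (auto simp: vertical_cut_def)
      then show "c ! i $ 1 = q $ 1 \<and> of_int (s ! i) * (q $ 2 - c ! i $ 2) \<ge> 0"
        using s by auto
    next
      assume "c ! i $ 1 = q $ 1 \<and> of_int (s ! i) * (q $ 2 - c ! i $ 2) \<ge> 0"
      then show "q \<in> vertical_cut (\<Delta>, c, s) i"
        unfolding vertical_cut_def using s assms(2)
        by (auto simp: vec2_eq_iff intro!: exI[of _ "of_int (s ! i) * (q $ 2 - c ! i $ 2)"])
    qed
  qed
  have "num_cuts (\<Delta>, c, s) q = 0 \<longleftrightarrow> (\<forall>i<length c. q \<notin> vertical_cut (\<Delta>, c, s) i)"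
    unfolding num_cuts_def by auto
  then show ?thesis
    using * by (auto simp: not_le)
qed

text \<open>Isolates the one condition that depends on the representative, namely that
  \<open>p\<close> is a vertex of \<Delta> itself. The rest is a statement about the chart belonging
  to the group element.\<close>

lemma admissibly_packed_iff:
  assumes \<epsilon>: "\<epsilon> \<in> sign_lists (length c)"
  shows "admissibly_packed (\<Delta>, c, \<epsilon>) p B \<longleftrightarrow> p extreme_point_of \<Delta> \<and> corner_packed (\<Delta>, c, \<epsilon>) p B"
    (is "?L \<longleftrightarrow> ?R")
proof
  assume ?L
  then obtain \<tau> \<epsilon>' \<sigma> l M U where H: "\<tau> \<in> T_group" "\<epsilon>' \<in> sign_lists (length c)"
    "\<sigma> = action_map \<tau> \<epsilon>' (\<Delta>, c, \<epsilon>)" "l > 0" "delzant_corner (act \<tau> \<epsilon>' (\<Delta>, c, \<epsilon>)) (\<sigma> p)"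
    "\<forall>x \<in> set c. \<sigma> x \<notin> \<sigma> ` B" "det M = 1"
    "\<sigma> ` B = (\<lambda>x. real_mat M *v x + \<sigma> p) ` std_triangle l"
    "open U" "\<sigma> p \<in> U" "\<sigma> ` B \<inter> U = \<sigma> ` \<Delta> \<inter> U"
    and e: "p extreme_point_of \<Delta>" "B \<subseteq> \<Delta>"
    unfolding admissibly_packed_def by auto
  obtain k r where \<tau>: "\<tau> = vsh (\<lambda>x. of_int k * x + r)"
    using T_group_vsh[OF H(1)] by blast
  define s where "s = map2 (*) \<epsilon>' \<epsilon>"
  have s: "s \<in> sign_lists (length c)"
    unfolding s_def using sign_lists_map2[OF H(2) \<epsilon>] .
  have \<sigma>: "\<sigma> = chart c \<epsilon> s k r"
    unfolding H(3) \<tau> s_def by (rule action_map_chart[OF \<epsilon> H(2)])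
  have act: "act \<tau> \<epsilon>' (\<Delta>, c, \<epsilon>) = (\<sigma> ` \<Delta>, map \<sigma> c, s)"
    unfolding act_def s_def H(3) by simp
  have D: "\<sigma> p extreme_point_of \<sigma> ` \<Delta>" "num_cuts (\<sigma> ` \<Delta>, map \<sigma> c, s) (\<sigma> p) = 0"
    "delzant_condition (\<sigma> ` \<Delta>) (\<sigma> p)"
    using H(5) unfolding act delzant_corner_def by auto
  have "\<sigma> p \<in> \<sigma> ` \<Delta>"
    using D(1) by (simp add: extreme_point_of_def)
  then have cuts: "\<forall>i<length c. c ! i $ 1 = p $ 1 \<longrightarrow> of_int (s ! i) * (p $ 2 - c ! i $ 2) < 0"
    using D(2) num_cuts_eq_0[of s "map \<sigma> c" "\<sigma> p" "\<sigma> ` \<Delta>"] s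
    by (simp add: \<sigma> chart_diff)
  moreover have "set c \<inter> B = {}"
    using H(6) by auto
  moreover have "packed_in_chart \<Delta> c p B s \<sigma>"
    unfolding packed_in_chart_def using H(4,7-11) D cuts
    by (intro exI[of _ l] exI[of _ M] exI[of _ U] conjI)
  ultimately have "corner_packed (\<Delta>, c, \<epsilon>) p B"
    unfolding corner_packed_def \<sigma> using e s by auto
  with e show ?R by simp
next
  assume R: ?R
  then obtain s k r \<sigma> l M U where H: "s \<in> sign_lists (length c)" "\<sigma> = chart c \<epsilon> s k r" "l > 0"
    "det M = 1" "\<sigma> p extreme_point_of \<sigma> ` \<Delta>" "delzant_condition (\<sigma> ` \<Delta>) (\<sigma> p)"
    "\<forall>i<length c. c ! i $ 1 = p $ 1 \<longrightarrow> of_int (s ! i) * (p $ 2 - c ! i $ 2) < 0"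
    "\<sigma> ` B = (\<lambda>x. real_mat M *v x + \<sigma> p) ` std_triangle l"
    "open U" "\<sigma> p \<in> U" "\<sigma> ` B \<inter> U = \<sigma> ` \<Delta> \<inter> U" and e: "B \<subseteq> \<Delta>" "set c \<inter> B = {}"
    unfolding corner_packed_def packed_in_chart_def by auto
  \<comment> \<open>Multiplication by \<epsilon> is an involution on sign lists, so this recovers
    the group element from the target signs.\<close>
  define \<epsilon>' where "\<epsilon>' = map2 (*) s \<epsilon>"
  have \<epsilon>': "\<epsilon>' \<in> sign_lists (length c)"
    unfolding \<epsilon>'_def by (rule sign_lists_map2[OF H(1) \<epsilon>])
  have s: "s = map2 (*) \<epsilon>' \<epsilon>"
  proof (rule nth_equalityI)
    show "length s = length (map2 (*) \<epsilon>' \<epsilon>)"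
      using \<epsilon> \<epsilon>' H(1) by (simp add: sign_lists_length)
    show "s ! i = map2 (*) \<epsilon>' \<epsilon> ! i" if "i < length s" for i
      using that sign_lists_nth[OF \<epsilon>, of i] \<epsilon> H(1) by (auto simp: sign_lists_length \<epsilon>'_def)
  qed
  define \<tau> where "\<tau> = vsh (\<lambda>x. of_int k * x + r)"
  have \<sigma>: "\<sigma> = action_map \<tau> \<epsilon>' (\<Delta>, c, \<epsilon>)"
    unfolding H(2) \<tau>_def by (subst s) (rule action_map_chart[OF \<epsilon> \<epsilon>', symmetric])
  have act: "act \<tau> \<epsilon>' (\<Delta>, c, \<epsilon>) = (\<sigma> ` \<Delta>, map \<sigma> c, s)"
    unfolding act_def \<sigma> by (simp add: s[symmetric])
  have "\<sigma> p \<in> \<sigma> ` \<Delta>"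
    using H(5) by (simp add: extreme_point_of_def)
  then have "num_cuts (\<sigma> ` \<Delta>, map \<sigma> c, s) (\<sigma> p) = 0"
    using H(7) num_cuts_eq_0[of s "map \<sigma> c" "\<sigma> p" "\<sigma> ` \<Delta>"] H(1)
    by (simp add: H(2) chart_diff)
  then have "delzant_corner (act \<tau> \<epsilon>' (\<Delta>, c, \<epsilon>)) (\<sigma> p)"
    unfolding act delzant_corner_def using H by simp
  moreover have "\<forall>x \<in> set c. \<sigma> x \<notin> \<sigma> ` B"
    using e(2) by (auto simp: H(2))
  moreover have "\<tau> \<in> T_group"
    unfolding \<tau>_def by (rule vsh_T_group)
  ultimately show ?L
    unfolding admissibly_packed_def prod.case using conjunct1[OF R] e(1) \<epsilon>' \<sigma> H(3,4,8-11)
    by (intro conjI exI[of _ \<tau>] exI[of _ \<epsilon>'] exI[of _ \<sigma>] exI[of _ l] exI[of _ M] exI[of _ U])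
qed

text \<open>Following a chart of the image by \<sigma> gives a chart of the base, by
  \<open>chart_chart\<close>. Both sides thus quantify over the same charts, up to a translation of
  \<open>k\<close> and \<open>r\<close>.\<close>

lemma corner_packed_chart_triple:
  assumes "\<epsilon> \<in> sign_lists (length c)" "s \<in> sign_lists (length c)" "\<sigma> = chart c \<epsilon> s k r"
  shows "corner_packed (chart_triple (\<Delta>, c, \<epsilon>) s k r) (\<sigma> p) (\<sigma> ` B) \<longleftrightarrow> corner_packed (\<Delta>, c, \<epsilon>) p B"
proof -
  have comp: "chart (map \<sigma> c) s s' k' r' \<circ> \<sigma> = chart c \<epsilon> s' (k + k') (r + r')"
    if "s' \<in> sign_lists (length c)" for s' k' r'
    unfolding assms(3) by (rule chart_chart[OF assms(1,2) that])
  have marks: "(\<forall>i<length (map \<sigma> c). map \<sigma> c ! i $ 1 = \<sigma> p $ 1 \<longrightarrow> of_int (s' ! i) * (\<sigma> p $ 2 - map \<sigma> c ! i $ 2) < 0)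
    \<longleftrightarrow> (\<forall>i<length c. c ! i $ 1 = p $ 1 \<longrightarrow> of_int (s' ! i) * (p $ 2 - c ! i $ 2) < 0)" for s' :: "int list"
    by (auto simp: assms(3) chart_diff)
  have sub: "\<sigma> ` B \<subseteq> \<sigma> ` \<Delta> \<longleftrightarrow> B \<subseteq> \<Delta>" "set (map \<sigma> c) \<inter> \<sigma> ` B = {} \<longleftrightarrow> set c \<inter> B = {}"
    by (auto simp: assms(3))
  have packed: "packed_in_chart (\<sigma> ` \<Delta>) (map \<sigma> c) (\<sigma> p) (\<sigma> ` B) s' \<sigma>'
      \<longleftrightarrow> packed_in_chart \<Delta> c p B s' (\<sigma>' \<circ> \<sigma>)" for s' \<sigma>'
    unfolding packed_in_chart_def marks by (simp add: image_comp)
  have *: "(\<exists>k' r'. packed_in_chart \<Delta> c p B s' (chart c \<epsilon> s' (k + k') (r + r')))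
      \<longleftrightarrow> (\<exists>k' r'. packed_in_chart \<Delta> c p B s' (chart c \<epsilon> s' k' r'))" for s'
    by (metis add.commute diff_add_cancel)
  show ?thesis
    unfolding corner_packed_def chart_triple_def prod.case assms(3)[symmetric] sub length_map packed
    by (simp add: comp * cong: bex_cong)
qed

lemma act_chart_triple:
  assumes "\<epsilon> \<in> sign_lists (length c)" "\<tau> \<in> T_group" "\<epsilon>' \<in> sign_lists (length c)"
  obtains s k r where "s \<in> sign_lists (length c)" "act \<tau> \<epsilon>' (\<Delta>, c, \<epsilon>) = chart_triple (\<Delta>, c, \<epsilon>) s k r"
proof -
  obtain k r where \<tau>: "\<tau> = vsh (\<lambda>x. of_int k * x + r)"
    using T_group_vsh[OF assms(2)] by blast
  show thesis
    by (rule that[OF sign_lists_map2[OF assms(3,1)], of k r])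
      (simp add: act_def chart_triple_def \<tau> action_map_chart[OF assms(1,3)])
qed

lemma measure_chart:
  assumes "S \<in> lmeasurable"
  shows "chart c \<epsilon> s k r ` S \<in> lmeasurable \<and> measure lebesgue (chart c \<epsilon> s k r ` S) = measure lebesgue S"
  unfolding chart_def bend_def using measure_vsh[OF assms] .

section \<open>The density of an orbit from matching bounds in its base representative\<close>

context
  fixes \<Delta> c \<epsilon> m \<B>0
  assumes \<epsilon>: "\<epsilon> \<in> sign_lists (length c)" and \<Delta>: "\<Delta> \<in> lmeasurable"
    and upper: "\<And>\<B>. disjoint \<B> \<Longrightarrow> (\<And>B. B \<in> \<B> \<Longrightarrow> \<exists>p. corner_packed (\<Delta>, c, \<epsilon>) p B) \<Longrightarrow>
      \<Union>\<B> \<in> lmeasurable \<and> measure lebesgue (\<Union>\<B>) \<le> m"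
    and lower: "disjoint \<B>0" "measure lebesgue (\<Union>\<B>0) = m"
      "\<And>B. B \<in> \<B>0 \<Longrightarrow> \<exists>p. corner_packed (\<Delta>, c, \<epsilon>) p B \<and>
        (\<forall>s\<in>sign_lists (length c). \<forall>k r. chart_vertex c \<epsilon> s k r \<Delta> p)"
begin

text \<open>A packing of the representative pulls back along \<sigma> to disjoint
  \<open>corner_packed\<close> sets, forgetting the vertex condition, so \<open>upper\<close>
  applies. Conversely the family \<B>0 pushes forward to a packing because its corners are vertices
  in every chart. Hence the supremum is attained.\<close>

lemma packing_density_chart_triple:
  assumes s: "s \<in> sign_lists (length c)"
  shows "packing_density (chart_triple (\<Delta>, c, \<epsilon>) s k r) = m / measure lebesgue \<Delta>"
proof -
  define \<sigma> where "\<sigma> = chart c \<epsilon> s k r"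
  define X where "X = chart_triple (\<Delta>, c, \<epsilon>) s k r"
  have X: "X = (\<sigma> ` \<Delta>, map \<sigma> c, s)"
    by (simp add: X_def chart_triple_def \<sigma>_def)
  have adm: "admissibly_packed X (\<sigma> p) (\<sigma> ` B) \<longleftrightarrow> \<sigma> p extreme_point_of \<sigma> ` \<Delta> \<and> corner_packed (\<Delta>, c, \<epsilon>) p B" for p B
    using admissibly_packed_iff[of s "map \<sigma> c" "\<sigma> ` \<Delta>" "\<sigma> p" "\<sigma> ` B"] s
      corner_packed_chart_triple[OF \<epsilon> s \<sigma>_def, of \<Delta> p B]
    unfolding X_def[symmetric] X by simp
  have inj: "inj \<sigma>"
    unfolding \<sigma>_def by (rule inj_chart)
  have surj: "surj \<sigma>"
    unfolding \<sigma>_def chart_def by (metis surjI vsh_uminus(1))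
  have ms: "S \<in> lmeasurable \<Longrightarrow> \<sigma> ` S \<in> lmeasurable \<and> measure lebesgue (\<sigma> ` S) = measure lebesgue S" for S
    unfolding \<sigma>_def by (rule measure_chart)
  have disj: "disjoint ((`) \<sigma> ` \<B>) \<longleftrightarrow> disjoint \<B>" for \<B>
    using inj by (auto simp: disjoint_def inj_image_eq_iff image_Int[symmetric])
  have le: "measure lebesgue P \<le> m" if P: "packing X P" for P
  proof -
    obtain \<C> where C: "\<forall>B\<in>\<C>. \<exists>p. admissibly_packed X p B" "disjoint \<C>" "P = \<Union>\<C>"
      using P unfolding packing_def by blast
    define \<B> where "\<B> = (\<lambda>B. \<sigma> -` B) ` \<C>"
    have CB: "\<C> = (`) \<sigma> ` \<B>"
      unfolding \<B>_def using surj by (auto simp: image_image surj_image_vimage_eq)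
    have "\<exists>p. corner_packed (\<Delta>, c, \<epsilon>) p B" if "B \<in> \<B>" for B
    proof -
      have "\<sigma> ` B \<in> \<C>" using that CB by blast
      then obtain q where "admissibly_packed X q (\<sigma> ` B)" using C(1) by blast
      then show ?thesis using adm surj by (metis surjD)
    qed
    moreover have "disjoint \<B>"
      using C(2) disj unfolding CB by blast
    ultimately have "\<Union>\<B> \<in> lmeasurable \<and> measure lebesgue (\<Union>\<B>) \<le> m"
      using upper by blast
    moreover have "P = \<sigma> ` \<Union>\<B>"
      unfolding C(3) CB by blast
    ultimately show ?thesis
      using ms by metis
  qed
  have "packing X (\<sigma> ` \<Union>\<B>0)"
    unfolding packing_def
  proof (rule exI[of _ "(`) \<sigma> ` \<B>0"], intro conjI ballI)
    show "disjoint ((`) \<sigma> ` \<B>0)"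
      using lower(1) disj by blast
    show "\<sigma> ` \<Union>\<B>0 = \<Union>((`) \<sigma> ` \<B>0)" by blast
    fix B assume "B \<in> (`) \<sigma> ` \<B>0"
    then obtain B' where B': "B' \<in> \<B>0" "B = \<sigma> ` B'" by blast
    from lower(3)[OF B'(1)] s show "\<exists>p. admissibly_packed X p B"
      unfolding B'(2) using adm \<sigma>_def by blast
  qed
  moreover have "measure lebesgue (\<sigma> ` \<Union>\<B>0) = m"
    using upper[OF lower(1)] lower(2,3) ms by metis
  moreover have "measure lebesgue (fst X) = measure lebesgue \<Delta>"
    unfolding X using ms[OF \<Delta>] by simp
  ultimately show ?thesis
    unfolding packing_density_def X_def[symmetric]
    using le by (intro cSup_eq_maximum) (auto simp: divide_right_mono intro!: exI[of _ "\<sigma> ` \<Union>\<B>0"])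
qed

text \<open>Every member of the orbit is again a \<open>chart_triple\<close> of the base, so one
  value serves the whole orbit.\<close>

theorem rho_ST_eq:
  assumes s: "s \<in> sign_lists (length c)"
  shows "rho_ST (semitoric_orbit (chart_triple (\<Delta>, c, \<epsilon>) s k r)) = m / measure lebesgue \<Delta>"
proof -
  define \<sigma> where "\<sigma> = chart c \<epsilon> s k r"
  define S where "S = semitoric_orbit (chart_triple (\<Delta>, c, \<epsilon>) s k r)"
  have X: "chart_triple (\<Delta>, c, \<epsilon>) s k r = (\<sigma> ` \<Delta>, map \<sigma> c, s)"
    by (simp add: chart_triple_def \<sigma>_def)
  have "packing_density Y = m / measure lebesgue \<Delta>" if "Y \<in> S" for Y
  proof -
    obtain \<tau> \<epsilon>' where Y: "Y = act \<tau> \<epsilon>' (\<sigma> ` \<Delta>, map \<sigma> c, s)" "\<tau> \<in> T_group" "\<epsilon>' \<in> sign_lists (length (map \<sigma> c))"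
      using \<open>Y \<in> S\<close> unfolding S_def X semitoric_orbit_def by auto
    obtain s' k' r' where s': "s' \<in> sign_lists (length c)"
      and Y': "Y = chart_triple (\<sigma> ` \<Delta>, map \<sigma> c, s) s' k' r'"
      using act_chart_triple[of s "map \<sigma> c" \<tau> \<epsilon>' "\<sigma> ` \<Delta>"] Y s by auto
    have "Y = chart_triple (\<Delta>, c, \<epsilon>) s' (k + k') (r + r')"
      unfolding Y' chart_triple_def using chart_chart[OF \<epsilon> s s', of k r k' r', folded \<sigma>_def]
      by (auto simp: image_comp fun_eq_iff)
    then show ?thesis
      using packing_density_chart_triple[OF s'] by simp
  qed
  \<comment> \<open>Nonemptiness of the orbit makes the value under \<open>THE\<close>
    unique.\<close>
  moreover have "\<exists>Y. Y \<in> S"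
  proof -
    have "replicate (length c) 1 \<in> sign_lists (length (map \<sigma> c))"
      by (auto simp: sign_lists_def)
    then show ?thesis
      unfolding S_def X semitoric_orbit_def using T_group.ident by blast
  qed
  ultimately show ?thesis
    unfolding rho_ST_def S_def[symmetric] by (intro the_equality) auto
qed

end

section \<open>The shape of an admissibly packed triangle\<close>

text \<open>
  The bending of a chart, normalised by an affine map so that it vanishes on the side of each
  marked point on which \<open>x0\<close> lies.
\<close>

definition cbend :: "(real^2) list \<Rightarrow> real \<Rightarrow> (nat \<Rightarrow> int) \<Rightarrow> real \<Rightarrow> real" where
  "cbend c x0 w x = (\<Sum>i<length c. of_int (w i) *
     (if c ! i $ 1 < x0 then max 0 (c ! i $ 1 - x) else max 0 (x - c ! i $ 1)))"

text \<open>For a wall \<open>c\<close> to the left of \<open>x0\<close> use max 0 (x - c) = (x - c)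
  + max 0 (c - x). The split-off affine part has integer slope, so it preserves integrality of
  directions and can be merged with the affine part of a chart.\<close>

lemma bend_eq_cbend:
  "\<exists>k r. \<forall>x. bend c w x = of_int k * x + r + cbend c x0 w x"
proof -
  define k where "k = (\<Sum>i<length c. if c ! i $ 1 < x0 then w i else 0)"
  define r where "r = (\<Sum>i<length c. if c ! i $ 1 < x0 then - of_int (w i) * c ! i $ 1 else 0)"
  have "bend c w x = of_int k * x + r + cbend c x0 w x" for x
    unfolding bend_def k_def r_def cbend_def of_int_sum sum_distrib_right sum.distrib[symmetric]
    by (rule sum.cong) (auto simp: max_def algebra_simps)
  then show ?thesis by blast
qed

lemma cbend_eq_0_near:
  assumes "\<And>i. i < length c \<Longrightarrow> c ! i $ 1 = x0 \<Longrightarrow> w i = 0"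
  shows "\<exists>d>0. \<forall>x. \<bar>x - x0\<bar> < d \<longrightarrow> cbend c x0 w x = 0"
proof -
  have "\<exists>d>0. \<forall>i<n. c ! i $ 1 = x0 \<or> d \<le> \<bar>c ! i $ 1 - x0\<bar>" for n
  proof (induction n)
    case 0
    show ?case by (auto intro: exI[of _ 1])
  next
    case (Suc n)
    then obtain d where d: "d > 0" "\<forall>i<n. c ! i $ 1 = x0 \<or> d \<le> \<bar>c ! i $ 1 - x0\<bar>" by blast
    show ?case
    proof (cases "c ! n $ 1 = x0")
      case True
      then show ?thesis using d by (auto simp: less_Suc_eq)
    next
      case False
      then show ?thesis
        using d by (intro exI[of _ "min d \<bar>c ! n $ 1 - x0\<bar>"]) (auto simp: less_Suc_eq min.coboundedI1)
    qed
  qed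
  then obtain d where d: "d > 0" "\<forall>i<length c. c ! i $ 1 = x0 \<or> d \<le> \<bar>c ! i $ 1 - x0\<bar>" by blast
  have "cbend c x0 w x = 0" if "\<bar>x - x0\<bar> < d" for x
    unfolding cbend_def
  proof (intro sum.neutral ballI)
    fix i assume "i \<in> {..<length c}"
    then show "of_int (w i) * (if c ! i $ 1 < x0 then max 0 (c ! i $ 1 - x) else max 0 (x - c ! i $ 1)) = 0"
      using d that assms[of i] by (cases "c ! i $ 1 = x0") (auto simp: max_def)
  qed
  then show ?thesis using d by blast
qed

lemma open_ray:
  fixes q w :: "real^2"
  assumes "open U" "q \<in> U"
  shows "\<exists>d>0. \<forall>t. 0 \<le> t \<and> t < d \<longrightarrow> q + t *\<^sub>R w \<in> U"
proof -
  obtain e where e: "e > 0" "ball q e \<subseteq> U"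
    using assms openE by blast
  have "q + t *\<^sub>R w \<in> U" if "0 \<le> t" "t < e / (norm w + 1)" for t
  proof -
    have "t * norm w \<le> t * (norm w + 1)"
      using that by (simp add: mult_left_mono)
    also have "\<dots> < e"
      using that(2) by (simp add: pos_less_divide_eq add_nonneg_pos)
    finally show ?thesis
      using e(2) that by (auto simp: dist_norm)
  qed
  then show ?thesis
    using e(1) by (intro exI[of _ "e / (norm w + 1)"]) (auto simp: add_nonneg_pos)
qed

lemma cross2_scale [simp]: "cross2 (t *\<^sub>R u) v = t * cross2 u v" "cross2 u (t *\<^sub>R v) = t * cross2 u v"
  by (simp_all add: cross2_def algebra_simps)

lemma cross2_self [simp]: "cross2 u u = 0"
  by (simp add: cross2_def)

lemma cross2_swap: "cross2 u v = - cross2 v u"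
  by (simp add: cross2_def)

lemma cross2_Ints: "(\<And>i. u $ i \<in> \<int>) \<Longrightarrow> (\<And>i. v $ i \<in> \<int>) \<Longrightarrow> cross2 u v \<in> \<int>"
  by (simp add: cross2_def)

lemma cross2_expand:
  assumes "cross2 u v = 1" shows "m = cross2 m v *\<^sub>R u + cross2 u m *\<^sub>R v"
proof -
  have "cross2 m v * u $ i + cross2 u m * v $ i = cross2 u v * m $ i" if "i = 1 \<or> i = 2" for i
    using that by (auto simp: cross2_def algebra_simps)
  then show ?thesis
    using assms by (simp add: vec2_eq_iff)
qed

text \<open>The sign conditions force cross2 u m = 0 and cross2 n v = 0, so m = a u and n = b v. The
  factors are integers with a b = 1 because all vectors are integral and both determinants are 1,
  and a is nonnegative.\<close>

lemma unimodular_cone_unique: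
  assumes uv: "cross2 u v = 1" "\<And>i. u $ i \<in> \<int>" "\<And>i. v $ i \<in> \<int>"
    and mn: "cross2 m n = 1" "\<And>i. m $ i \<in> \<int>" "\<And>i. n $ i \<in> \<int>"
    and "cross2 m v \<ge> 0" "cross2 u m \<ge> 0" "cross2 n v \<ge> 0" "cross2 m u \<ge> 0" "cross2 v n \<ge> 0"
  shows "m = u" "n = v"
proof -
  have 0: "cross2 u m = 0" "cross2 n v = 0"
    using assms(8-11) cross2_swap[of u m] cross2_swap[of n v] by simp_all
  have m: "m = cross2 m v *\<^sub>R u" and n: "n = cross2 u n *\<^sub>R v"
    using cross2_expand[OF uv(1), of m] cross2_expand[OF uv(1), of n] 0 by simp_all
  obtain a b where ab: "cross2 m v = of_int a" "cross2 u n = of_int b"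
    using cross2_Ints[of m v] cross2_Ints[of u n] uv mn by (auto elim!: Ints_cases)
  have "cross2 m n = cross2 m v * (cross2 u n * cross2 u v)"
    using arg_cong2[of _ _ _ _ cross2, OF m n] by simp
  then have "of_int (a * b) = (1::real)"
    using uv(1) mn(1) ab by simp
  then have "a * b = 1"
    by linarith
  moreover have "a \<ge> 0"
    using ab(1) assms(7) by simp
  ultimately have "a = 1" "b = 1"
    by (auto simp: zmult_eq_1_iff)
  then show "m = u" "n = v"
    using m n ab by simp_all
qed

text \<open>After an integral affine normalisation the chart is the identity near \<open>p\<close>,
  provided that it does not bend along the vertical line through \<open>p\<close>. There the packed
  set and the polygon have the same germ, one being the cone of the columns of an integral matrix
  and the other the cone of \<open>u\<close>, \<open>v\<close>;
  \<open>unimodular_cone_unique\<close> identifies the generators. Away from \<open>p\<close> the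
  set is determined by undoing the bending.\<close>

lemma packed_in_chart_tri:
  assumes packed: "packed_in_chart \<Delta> c p B s (chart c \<epsilon> s k r)"
    and wall: "\<And>i. i < length c \<Longrightarrow> c ! i $ 1 = p $ 1 \<Longrightarrow> s ! i = \<epsilon> ! i"
    and uv: "cross2 u v = 1" "\<And>i. u $ i \<in> \<int>" "\<And>i. v $ i \<in> \<int>"
    and V: "open V" "p \<in> V" "\<And>z. z \<in> V \<Longrightarrow> z \<in> \<Delta> \<longleftrightarrow> cross2 (z - p) v \<ge> 0 \<and> cross2 u (z - p) \<ge> 0"
  obtains l where "l > 0" "B = {z. vsh (cbend c (p $ 1) (\<lambda>i. (\<epsilon> ! i - s ! i) div 2)) z \<in> tri p u v l}"
proof -
  define \<sigma> where "\<sigma> = chart c \<epsilon> s k r"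
  define \<beta> where "\<beta> = cbend c (p $ 1) (\<lambda>i. (\<epsilon> ! i - s ! i) div 2)"
  obtain l M U where l: "l > 0" and M: "det M = 1"
    and B: "\<sigma> ` B = (\<lambda>x. real_mat M *v x + \<sigma> p) ` std_triangle l"
    and U: "open U" "\<sigma> p \<in> U" "\<sigma> ` B \<inter> U = \<sigma> ` \<Delta> \<inter> U"
    using packed unfolding packed_in_chart_def \<sigma>_def[symmetric]
    by (elim exE conjE) (rule that)
  obtain k0 r0 where "\<forall>x. bend c (\<lambda>i. (\<epsilon> ! i - s ! i) div 2) x = of_int k0 * x + r0 + \<beta> x"
    unfolding \<beta>_def using bend_eq_cbend by blast
  then have "\<sigma> = vsh (\<lambda>x. of_int (k + k0) * x + (r + r0) + \<beta> x)"
    unfolding \<sigma>_def chart_def by (intro vsh_cong) (simp add: algebra_simps)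
  then obtain k' r' where \<sigma>: "\<sigma> = vsh (\<lambda>x. of_int k' * x + r' + \<beta> x)"
    by (rule that)
  obtain d where d: "d > 0" "\<And>x. \<bar>x - p $ 1\<bar> < d \<Longrightarrow> \<beta> x = 0"
    using cbend_eq_0_near[of c "p $ 1" "\<lambda>i. (\<epsilon> ! i - s ! i) div 2"] wall unfolding \<beta>_def by auto
  have \<beta>p: "\<beta> (p $ 1) = 0"
    using d by simp
  \<comment> \<open>The columns of \<open>M\<close> with the shear of slope \<open>k'\<close>
    undone: the directions of the triangle in base coordinates near \<open>p\<close>.\<close>
  define m where "m = pt (of_int (M $ 1 $ 1)) (of_int (M $ 2 $ 1 - k' * M $ 1 $ 1))"
  define n where "n = pt (of_int (M $ 1 $ 2)) (of_int (M $ 2 $ 2 - k' * M $ 1 $ 2))"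
  have det: "M $ 1 $ 1 * M $ 2 $ 2 - M $ 1 $ 2 * M $ 2 $ 1 = 1"
    using M by (simp add: det_2)
  have "cross2 m n = of_int (M $ 1 $ 1 * M $ 2 $ 2 - M $ 1 $ 2 * M $ 2 $ 1)"
    by (simp add: cross2_def m_def n_def algebra_simps)
  then have mn: "cross2 m n = 1"
    using det by simp
  have mnI: "m $ i \<in> \<int>" "n $ i \<in> \<int>" for i
    using exhaust_2[of i] by (auto simp: m_def n_def)
  have key: "real_mat M *v x + \<sigma> p = vsh (\<lambda>x. of_int k' * x + r') (p + x $ 1 *\<^sub>R m + x $ 2 *\<^sub>R n)" for x
    by (simp add: vec2_eq_iff \<sigma> \<beta>p m_def n_def real_mat_def matrix_vector_mult_def sum_2 algebra_simps)
  have std: "(\<lambda>x. p + x $ 1 *\<^sub>R m + x $ 2 *\<^sub>R n) ` std_triangle l = tri p m n l"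
  proof (intro equalityI subsetI)
    fix z assume "z \<in> tri p m n l"
    then obtain a b where "0 \<le> a" "0 \<le> b" "a + b < l" "z = p + a *\<^sub>R m + b *\<^sub>R n"
      unfolding tri_def by blast
    then show "z \<in> (\<lambda>x. p + x $ 1 *\<^sub>R m + x $ 2 *\<^sub>R n) ` std_triangle l"
      by (intro image_eqI[of _ _ "pt a b"]) (simp_all add: std_triangle_def)
  qed (auto simp: std_triangle_def tri_def)
  have \<sigma>2: "\<sigma> z = vsh (\<lambda>x. of_int k' * x + r') (vsh \<beta> z)" for z
    by (simp add: \<sigma> vec2_eq_iff)
  have memB: "z \<in> B \<longleftrightarrow> vsh \<beta> z \<in> tri p m n l" for z
  proof -
    have "z \<in> B \<longleftrightarrow> \<sigma> z \<in> \<sigma> ` B"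
      using inj_vsh \<sigma> by (simp add: inj_image_mem_iff)
    also have "\<sigma> ` B = vsh (\<lambda>x. of_int k' * x + r') ` tri p m n l"
      unfolding B std[symmetric] key by (simp add: image_image)
    also have "\<sigma> z \<in> \<dots> \<longleftrightarrow> vsh \<beta> z \<in> tri p m n l"
      unfolding \<sigma>2 by (rule inj_image_mem_iff[OF inj_vsh])
    finally show ?thesis .
  qed
  have ray: "\<exists>t>0. p + t *\<^sub>R w \<in> V \<and> t < l \<and>
      (p + t *\<^sub>R w \<in> tri p m n l \<longleftrightarrow> cross2 w v \<ge> 0 \<and> cross2 u w \<ge> 0)" for w
  proof -
    obtain d1 where d1: "d1 > 0" "\<forall>t. 0 \<le> t \<and> t < d1 \<longrightarrow> p + t *\<^sub>R w \<in> V"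
      using open_ray[OF V(1,2)] by blast
    obtain d2 where d2: "d2 > 0" "\<forall>t. 0 \<le> t \<and> t < d2 \<longrightarrow> \<sigma> p + t *\<^sub>R pt (w $ 1) (w $ 2 + of_int k' * w $ 1) \<in> U"
      using open_ray[OF U(1,2)] by blast
    \<comment> \<open>Up to this parameter the ray stays in \<open>V\<close>, its image stays in
      \<open>U\<close>, and its first coordinate stays where the bending vanishes.\<close>
    define e where "e = min (min d1 d2) (min l (d / (\<bar>w $ 1\<bar> + 1)))"
    have e: "0 < e" "e \<le> d1" "e \<le> d2" "e \<le> l" "e \<le> d / (\<bar>w $ 1\<bar> + 1)"
      using d1(1) d2(1) l d(1) by (auto simp: e_def add_nonneg_pos)
    obtain t where "0 < t" "t < e"
      using e(1) dense by blast
    then have t: "0 < t" "t < d1" "t < d2" "t < l" "t < d / (\<bar>w $ 1\<bar> + 1)"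
      using e order.strict_trans2 by blast+
    have "\<bar>t * w $ 1\<bar> \<le> t * (\<bar>w $ 1\<bar> + 1)"
      unfolding abs_mult abs_of_pos[OF t(1)] by (rule mult_left_mono) (use t(1) in auto)
    also have "\<dots> < d"
      using t(5) by (simp add: pos_less_divide_eq add_nonneg_pos)
    finally have \<beta>0: "\<beta> ((p + t *\<^sub>R w) $ 1) = 0"
      by (intro d(2)) simp
    have "\<sigma> (p + t *\<^sub>R w) = \<sigma> p + t *\<^sub>R pt (w $ 1) (w $ 2 + of_int k' * w $ 1)"
      using \<beta>0 \<beta>p by (simp add: \<sigma> vec2_eq_iff algebra_simps)
    then have "\<sigma> (p + t *\<^sub>R w) \<in> U"
      using d2(2) t by simp
    then have "p + t *\<^sub>R w \<in> B \<longleftrightarrow> p + t *\<^sub>R w \<in> \<Delta>"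
      using U(3) inj_image_mem_iff[OF inj_vsh, of _ "p + t *\<^sub>R w"] \<sigma> by blast
    moreover have "vsh \<beta> (p + t *\<^sub>R w) = p + t *\<^sub>R w"
      using \<beta>0 by (simp add: vec2_eq_iff)
    moreover have V': "p + t *\<^sub>R w \<in> V"
      using d1(2) t by simp
    moreover have "p + t *\<^sub>R w \<in> \<Delta> \<longleftrightarrow> cross2 w v \<ge> 0 \<and> cross2 u w \<ge> 0"
      using V(3)[OF V'] t(1) by (simp add: zero_le_mult_iff)
    ultimately show ?thesis
      using t memB by auto
  qed
  have cone: "cross2 w v \<ge> 0 \<and> cross2 u w \<ge> 0 \<longleftrightarrow> cross2 w n \<ge> 0 \<and> cross2 m w \<ge> 0" for w
  proof -
    \<comment> \<open>Shrinking \<open>w\<close> by this factor keeps the point at parameter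
      \<open>t < l\<close> below the missing side, so that only the two cone conditions
      remain.\<close>
    define N where "N = \<bar>cross2 w n\<bar> + \<bar>cross2 m w\<bar> + 1"
    have "N > 0" by (simp add: N_def add_nonneg_pos)
    obtain t where t: "t > 0" "t < l"
      "p + t *\<^sub>R ((1 / N) *\<^sub>R w) \<in> tri p m n l \<longleftrightarrow> cross2 ((1 / N) *\<^sub>R w) v \<ge> 0 \<and> cross2 u ((1 / N) *\<^sub>R w) \<ge> 0"
      using ray by blast
    have "p + t *\<^sub>R ((1 / N) *\<^sub>R w) \<in> tri p m n l
        \<longleftrightarrow> cross2 w n \<ge> 0 \<and> cross2 m w \<ge> 0 \<and> t / N * (cross2 w n + cross2 m w) < l"
      using t(1) \<open>N > 0\<close> unfolding mem_tri_iff[OF mn] by (auto simp: zero_le_mult_iff zero_le_divide_iff field_simps)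
    moreover have "t / N * (cross2 w n + cross2 m w) < l"
    proof -
      have "t / N * (cross2 w n + cross2 m w) \<le> t / N * N"
        using t(1) \<open>N > 0\<close> by (intro mult_left_mono) (auto simp: N_def)
      then show ?thesis using t(2) \<open>N > 0\<close> by simp
    qed
    ultimately show ?thesis
      using t(3) \<open>N > 0\<close> by (simp add: zero_le_divide_iff)
  qed
  have "m = u" "n = v"
    using unimodular_cone_unique[OF uv mn mnI] cone[of m] cone[of n] cone[of u] cone[of v] mn uv(1)
    by auto
  with l memB that[of l] show ?thesis
    unfolding \<beta>_def by blast
qed

text \<open>The affine part of a chart respects midpoints, so for the image of \<open>p\<close> to
  be the midpoint of two images only the bending has to be checked.\<close>

lemma chart_not_extreme:
  assumes "q1 \<in> \<Delta>" "q2 \<in> \<Delta>" "q1 \<noteq> q2" "q1 $ 1 + q2 $ 1 = 2 * p $ 1"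
    and "q1 $ 2 + bend c w (q1 $ 1) + (q2 $ 2 + bend c w (q2 $ 1)) = 2 * (p $ 2 + bend c w (p $ 1))"
    and "w = (\<lambda>i. (\<epsilon> ! i - s ! i) div 2)"
  shows "\<not> chart_vertex c \<epsilon> s k r \<Delta> p"
proof -
  define \<sigma> where "\<sigma> = chart c \<epsilon> s k r"
  have "of_int k * q1 $ 1 + of_int k * q2 $ 1 = of_int k * (2 * p $ 1)"
    by (simp only: distrib_left[symmetric] assms(4))
  then have "2 *\<^sub>R \<sigma> p = \<sigma> q1 + \<sigma> q2"
    using assms(4,5) unfolding \<sigma>_def chart_def assms(6) by (simp add: vec2_eq_iff)
  then have "\<sigma> p = midpoint (\<sigma> q1) (\<sigma> q2)"
    by (metis midpoint_eq_iff scaleR_2)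
  moreover have "\<sigma> q1 \<noteq> \<sigma> q2"
    using assms(3) unfolding \<sigma>_def by simp
  ultimately have "\<sigma> p \<in> open_segment (\<sigma> q1) (\<sigma> q2)"
    by (simp add: midpoint_in_open_segment)
  then show ?thesis
    unfolding extreme_point_of_def \<sigma>_def[symmetric] using assms(1,2) by blast
qed

text \<open>Along a vertical direction every chart is a translation. In any other direction a short
  enough piece of the segment avoids the bending, so it stays a segment in the chart.\<close>

lemma chart_not_extreme_off_wall:
  assumes "convex \<Delta>" "p + w \<in> \<Delta>" "p - w \<in> \<Delta>" "w \<noteq> 0"
    and wall: "\<And>i. i < length c \<Longrightarrow> c ! i $ 1 = p $ 1 \<Longrightarrow> w $ 1 = 0 \<or> s ! i = \<epsilon> ! i"
  shows "\<not> chart_vertex c \<epsilon> s k r \<Delta> p"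
proof (cases "w $ 1 = 0")
  case True
  show ?thesis
    by (rule chart_not_extreme[OF assms(2,3) _ _ _ refl]) (use assms(4) True in \<open>auto simp: vec2_eq_iff\<close>)
next
  case False
  define \<beta> where "\<beta> = cbend c (p $ 1) (\<lambda>i. (\<epsilon> ! i - s ! i) div 2)"
  obtain k0 r0 where bend: "\<And>x. bend c (\<lambda>i. (\<epsilon> ! i - s ! i) div 2) x = of_int k0 * x + r0 + \<beta> x"
    unfolding \<beta>_def using bend_eq_cbend by blast
  obtain d where d: "d > 0" "\<And>x. \<bar>x - p $ 1\<bar> < d \<Longrightarrow> \<beta> x = 0"
    using cbend_eq_0_near[of c "p $ 1" "\<lambda>i. (\<epsilon> ! i - s ! i) div 2"] wall False unfolding \<beta>_def by auto
  define t where "t = min 1 (d / (2 * \<bar>w $ 1\<bar>))"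
  have t: "0 < t" "t \<le> 1" "t * \<bar>w $ 1\<bar> < d"
    using d False by (auto simp: t_def min_def field_simps)
  have in\<Delta>: "p + t *\<^sub>R w \<in> \<Delta>" "p - t *\<^sub>R w \<in> \<Delta>"
  proof -
    have p: "p \<in> \<Delta>"
      using convexD[OF assms(1-3), of "1/2" "1/2"] by (simp add: algebra_simps flip: scaleR_add_left)
    show "p + t *\<^sub>R w \<in> \<Delta>"
      using convexD[OF assms(1,2) p, of t "1 - t"] t by (simp add: algebra_simps)
    show "p - t *\<^sub>R w \<in> \<Delta>"
      using convexD[OF assms(1,3) p, of t "1 - t"] t by (simp add: algebra_simps)
  qed
  have "\<beta> (p $ 1 + t * w $ 1) = 0" "\<beta> (p $ 1 - t * w $ 1) = 0" "\<beta> (p $ 1) = 0"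
    using t d by (auto simp: abs_mult intro!: d(2))
  then show ?thesis
    using t(1) assms(4)
    by (intro chart_not_extreme[OF in\<Delta> _ _ _ refl]) (auto simp: bend algebra_simps vec2_eq_iff)
qed

section \<open>Corners, extreme points and packings\<close>

lemma linear_cross2_left: "linear (\<lambda>z. cross2 z v)" and linear_cross2_right: "linear (cross2 u)"
  by (auto intro!: linearI simp: cross2_def algebra_simps)

lemma continuous_on_cross2: "continuous_on S (\<lambda>z. cross2 (z - p) v)" "continuous_on S (\<lambda>z. cross2 u (z - p))"
  unfolding cross2_def by (intro continuous_intros)+

lemma extreme_point_of_exposed:
  fixes p :: "real^2" and f :: "real^2 \<Rightarrow> real"
  assumes "p \<in> S" "linear f" "\<And>z. z \<in> S \<Longrightarrow> z \<noteq> p \<Longrightarrow> f p < f z"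
  shows "p extreme_point_of S"
  unfolding extreme_point_of_def
proof (intro conjI ballI notI)
  fix a b assume ab: "a \<in> S" "b \<in> S" "p \<in> open_segment a b"
  obtain t where t: "a \<noteq> b" "0 < t" "t < 1" "p = (1 - t) *\<^sub>R a + t *\<^sub>R b"
    using ab(3) unfolding in_segment by blast
  have "f p = (1 - t) * f a + t * f b"
    using assms(2) by (simp add: t(4) linear_add linear_scale)
  have "p \<noteq> a" "p \<noteq> b"
    using ab(3) by (auto simp: open_segment_def)
  then have "(1 - t) * f p < (1 - t) * f a" "t * f p < t * f b"
    using assms(3)[OF ab(1)] assms(3)[OF ab(2)] t(2,3) by (simp_all add: mult_strict_left_mono)
  with \<open>f p = _\<close> show False
    by (simp add: algebra_simps)
qed (fact assms(1))

text \<open>Charts preserve first coordinates, so a unique leftmost or rightmost point is a vertex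
  in all charts at once.\<close>

lemma chart_extreme_sideways:
  assumes "p \<in> \<Delta>" "\<And>z. z \<in> \<Delta> \<Longrightarrow> z \<noteq> p \<Longrightarrow> m * p $ 1 < m * z $ 1"
  shows "chart_vertex c \<epsilon> s k r \<Delta> p"
  by (rule extreme_point_of_exposed[where f = "\<lambda>z. m * z $ 1"])
    (use assms in \<open>auto intro!: linearI simp: algebra_simps\<close>)

text \<open>Tilting the exposing functional by \<open>k\<close> compensates the shear of the chart,
  which leaves a condition on the bending alone.\<close>

lemma chart_extreme_slope:
  assumes "p \<in> \<Delta>"
    and "\<And>z. z \<in> \<Delta> \<Longrightarrow> z \<noteq> p \<Longrightarrow>
      \<mu> * (p $ 2 + bend c (\<lambda>i. (\<epsilon> ! i - s ! i) div 2) (p $ 1) - m * p $ 1)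
      < \<mu> * (z $ 2 + bend c (\<lambda>i. (\<epsilon> ! i - s ! i) div 2) (z $ 1) - m * z $ 1)"
  shows "chart_vertex c \<epsilon> s k r \<Delta> p"
  by (rule extreme_point_of_exposed[where f = "\<lambda>z. \<mu> * (z $ 2 - (of_int k + m) * z $ 1)"])
    (use assms in \<open>auto intro!: linearI simp: algebra_simps chart_def\<close>)

text \<open>In the coordinates with respect to \<open>u\<close>, \<open>v\<close> the polygon lies
  in the first quadrant, and each edge at \<open>p\<close> is the face on which one coordinate
  vanishes. \<open>t1\<close> and \<open>t2\<close> are the lattice lengths of these edges.\<close>

lemma delzant_corner_at:
  fixes a b :: "int^2"
  assumes "convex \<Delta>" "u = real_vec a" "v = real_vec b" "cross2 u v = 1" "t1 > 0" "t2 > 0"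
    and "p \<in> \<Delta>" "p + t1 *\<^sub>R u \<in> \<Delta>" "p + t2 *\<^sub>R v \<in> \<Delta>"
    and cone: "\<And>z. z \<in> \<Delta> \<Longrightarrow> 0 \<le> cross2 (z - p) v \<and> 0 \<le> cross2 u (z - p)"
    and E1: "\<And>z. z \<in> \<Delta> \<Longrightarrow> cross2 u (z - p) = 0 \<Longrightarrow> cross2 (z - p) v \<le> t1"
    and E2: "\<And>z. z \<in> \<Delta> \<Longrightarrow> cross2 (z - p) v = 0 \<Longrightarrow> cross2 u (z - p) \<le> t2"
  shows "p extreme_point_of \<Delta>" "delzant_condition \<Delta> p"
proof -
  have expand: "z = p + cross2 (z - p) v *\<^sub>R u + cross2 u (z - p) *\<^sub>R v" for z
    using cross2_expand[OF assms(4), of "z - p"] by (simp add: algebra_simps)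
  show ext: "p extreme_point_of \<Delta>"
  proof (rule extreme_point_of_exposed[where f = "\<lambda>z. cross2 z v + cross2 u z"])
    show "linear (\<lambda>z. cross2 z v + cross2 u z)"
      by (intro linear_compose_add linear_cross2_left linear_cross2_right)
    fix z assume z: "z \<in> \<Delta>" "z \<noteq> p"
    have "cross2 (z - p) v = cross2 z v - cross2 p v" "cross2 u (z - p) = cross2 u z - cross2 u p"
      by (simp_all add: cross2_def algebra_simps)
    moreover have "cross2 (z - p) v \<noteq> 0 \<or> cross2 u (z - p) \<noteq> 0"
      using expand[of z] z(2) by auto
    ultimately show "cross2 p v + cross2 u p < cross2 z v + cross2 u z"
      using cone[OF z(1)] by auto
  qed (fact assms(7))
  have edge: "closed_segment p (p + t *\<^sub>R w) edge_of \<Delta>"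
    if f: "linear f" "\<And>z. z \<in> \<Delta> \<Longrightarrow> f p \<le> f z" and t: "t > 0" "w \<noteq> 0" "f w = 0" "p + t *\<^sub>R w \<in> \<Delta>"
      and seg: "\<And>z. z \<in> \<Delta> \<Longrightarrow> f z = f p \<Longrightarrow> \<exists>s\<ge>0. s \<le> t \<and> z = p + s *\<^sub>R w" for f :: "real^2 \<Rightarrow> real" and t w
  proof -
    \<comment> \<open>\<open>adjoint f 1\<close> is the vector representing the functional
      \<open>f\<close>.\<close>
    have "\<Delta> \<inter> {z. adjoint f 1 \<bullet> z = f p} face_of \<Delta>"
      by (rule face_of_Int_supporting_hyperplane_ge[OF assms(1)])
        (use f adjoint_works[OF f(1), of _ 1] in \<open>simp add: inner_commute\<close>)
    also have "\<Delta> \<inter> {z. adjoint f 1 \<bullet> z = f p} = {z \<in> \<Delta>. f z = f p}"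
      using adjoint_works[OF f(1), of _ 1] by (auto simp: inner_commute)
    also have "\<dots> = closed_segment p (p + t *\<^sub>R w)"
    proof (intro equalityI subsetI)
      fix z assume "z \<in> {z \<in> \<Delta>. f z = f p}"
      then obtain s where s: "0 \<le> s" "s \<le> t" "z = p + s *\<^sub>R w"
        using seg by blast
      then show "z \<in> closed_segment p (p + t *\<^sub>R w)"
        using t(1) unfolding in_segment by (intro exI[of _ "s / t"]) (simp add: algebra_simps)
    next
      fix z assume z: "z \<in> closed_segment p (p + t *\<^sub>R w)"
      then obtain s where "z = (1 - s) *\<^sub>R p + s *\<^sub>R (p + t *\<^sub>R w)"
        unfolding in_segment by blast
      then have "z = p + (s * t) *\<^sub>R w"
        by (simp add: algebra_simps)
      then have "f z = f p"
        using f(1) t(3) by (simp add: linear_add linear_scale)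
      moreover have "closed_segment p (p + t *\<^sub>R w) \<subseteq> \<Delta>"
        using assms(1,7) t(4) by (simp add: closed_segment_subset)
      ultimately show "z \<in> {z \<in> \<Delta>. f z = f p}"
        using z by blast
    qed
    finally have "closed_segment p (p + t *\<^sub>R w) face_of \<Delta>" .
    moreover have "aff_dim (closed_segment p (p + t *\<^sub>R w)) = 1"
      using t(1,2) by (simp add: segment_convex_hull aff_dim_convex_hull)
    ultimately show ?thesis
      by (simp add: edge_of_def)
  qed
  have uv: "u \<noteq> 0" "v \<noteq> 0"
    using assms(4) by (auto simp: cross2_def)
  have e1: "closed_segment p (p + t1 *\<^sub>R u) edge_of \<Delta>"
  proof (rule edge[OF linear_cross2_right[of u]])
    fix z assume z: "z \<in> \<Delta>"
    have d: "cross2 u (z - p) = cross2 u z - cross2 u p"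
      by (simp add: cross2_def algebra_simps)
    show "cross2 u p \<le> cross2 u z"
      using cone[OF z] d by simp
    assume "cross2 u z = cross2 u p"
    then show "\<exists>s\<ge>0. s \<le> t1 \<and> z = p + s *\<^sub>R u"
      using cone[OF z] E1[OF z] expand[of z] d by (intro exI[of _ "cross2 (z - p) v"]) auto
  qed (use assms uv in auto)
  have e2: "closed_segment p (p + t2 *\<^sub>R v) edge_of \<Delta>"
  proof (rule edge[OF linear_cross2_left[of v]])
    fix z assume z: "z \<in> \<Delta>"
    have d: "cross2 (z - p) v = cross2 z v - cross2 p v"
      by (simp add: cross2_def algebra_simps)
    show "cross2 p v \<le> cross2 z v"
      using cone[OF z] d by simp
    assume "cross2 z v = cross2 p v"
    then show "\<exists>s\<ge>0. s \<le> t2 \<and> z = p + s *\<^sub>R v"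
      using cone[OF z] E2[OF z] expand[of z] d by (intro exI[of _ "cross2 u (z - p)"]) auto
  qed (use assms uv in auto)
  have det: "det2 a b = 1"
  proof -
    have "of_int (det2 a b) = cross2 u v"
      by (simp add: det2_def det_2 transpose_def cross2_def assms(2,3) real_vec_def)
    then show ?thesis using assms(4) by simp
  qed
  then have bez: "a $ 1 * b $ 2 - b $ 1 * a $ 2 = 1"
    by (simp add: det2_def det_2 transpose_def algebra_simps)
  have "coprime (a $ 1) (a $ 2)"
    using bez by (intro coprimeI) (metis dvd_diff dvd_mult dvd_mult2)
  moreover have "coprime (b $ 1) (b $ 2)"
    using bez by (intro coprimeI) (metis dvd_diff dvd_mult dvd_mult2)
  ultimately have "corner_directions \<Delta> p a b"
    unfolding corner_directions_def directs_edge_at_def primitive_def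
    using ext e1 e2 assms(2,3,5,6) det by auto
  then show "delzant_condition \<Delta> p"
    unfolding delzant_condition_def using det by blast
qed

lemma chart_self: "chart c \<epsilon> \<epsilon> 0 0 = id"
  by (simp add: chart_def bend_def vsh_zero)

lemma corner_packed_tri:
  fixes a b :: "int^2"
  assumes "\<epsilon> \<in> sign_lists (length c)" "p extreme_point_of \<Delta>" "delzant_condition \<Delta> p"
    and uv: "u = real_vec a" "v = real_vec b" "cross2 u v = 1"
    and cuts: "\<And>i. i < length c \<Longrightarrow> c ! i $ 1 = p $ 1 \<Longrightarrow> of_int (\<epsilon> ! i) * (p $ 2 - c ! i $ 2) < 0"
    and "l > 0" "tri p u v l \<subseteq> \<Delta>" "set c \<inter> tri p u v l = {}"
    and cone: "\<And>z. z \<in> \<Delta> \<Longrightarrow> 0 \<le> cross2 (z - p) v \<and> 0 \<le> cross2 u (z - p)"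
  shows "corner_packed (\<Delta>, c, \<epsilon>) p (tri p u v l)"
proof -
  define M :: "int^2^2" where "M = vector [vector [a $ 1, b $ 1], vector [a $ 2, b $ 2]]"
  \<comment> \<open>The open half plane bounded by the missing side: inside it the triangle is the
    whole cone, and the polygon lies between the two.\<close>
  define U where "U = {z. cross2 (z - p) v + cross2 u (z - p) < l}"
  have "of_int (det M) = cross2 u v"
    by (simp add: det_2 M_def cross2_def uv(1,2) real_vec_def)
  then have det: "det M = 1"
    using uv(3) by simp
  have M: "real_mat M *v x + p = p + x $ 1 *\<^sub>R u + x $ 2 *\<^sub>R v" for x
    by (simp add: vec2_eq_iff real_mat_def matrix_vector_mult_def sum_2 M_def uv(1,2) real_vec_def)
  have "(\<lambda>x. real_mat M *v x + p) ` std_triangle l = tri p u v l"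
  proof (intro equalityI subsetI)
    fix z assume "z \<in> tri p u v l"
    then obtain s t where "0 \<le> s" "0 \<le> t" "s + t < l" "z = p + s *\<^sub>R u + t *\<^sub>R v"
      unfolding tri_def by blast
    then show "z \<in> (\<lambda>x. real_mat M *v x + p) ` std_triangle l"
      unfolding M by (intro image_eqI[of _ _ "pt s t"]) (simp_all add: std_triangle_def)
  qed (auto simp: M std_triangle_def tri_def)
  moreover have "open U"
    unfolding U_def by (intro open_Collect_less continuous_on_add continuous_on_cross2 continuous_on_const)
  moreover have "p \<in> U"
    using assms(8) by (simp add: U_def cross2_def)
  moreover have "tri p u v l \<inter> U = \<Delta> \<inter> U"
    using assms(9) cone by (auto simp: U_def mem_tri_iff[OF uv(3)])
  ultimately have "packed_in_chart \<Delta> c p (tri p u v l) \<epsilon> (chart c \<epsilon> \<epsilon> 0 0)"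
    unfolding packed_in_chart_def chart_self using assms(2,3,8) det cuts
    by (intro exI[of _ l] exI[of _ M] exI[of _ U]) auto
  then show ?thesis
    unfolding corner_packed_def prod.case using assms(1,9,10) by blast
qed

text \<open>Every set contains its own corner, so disjointness allows at most one set per corner.
  The family is therefore finite and its area additive. \<open>P\<close> carries whatever is known
  about a set of size \<open>l\<close> at \<open>p\<close>.\<close>

lemma disjoint_packing_measure:
  assumes "finite V" "disjoint \<B>"
    and "\<And>B. B \<in> \<B> \<Longrightarrow> \<exists>p\<in>V. p \<in> B \<and> (\<exists>l>0. B \<in> lmeasurable \<and> measure lebesgue B = l^2 / 2 \<and> P p l B)"
  obtains L F where "\<Union>\<B> \<in> lmeasurable" "measure lebesgue (\<Union>\<B>) = (\<Sum>p\<in>V. (L p)^2 / 2)"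
    "\<And>p. p \<in> V \<Longrightarrow> 0 \<le> L p" "\<And>p. p \<in> V \<Longrightarrow> 0 < L p \<Longrightarrow> P p (L p) (F p)"
    "\<And>p q. p \<in> V \<Longrightarrow> q \<in> V \<Longrightarrow> p \<noteq> q \<Longrightarrow> 0 < L p \<Longrightarrow> 0 < L q \<Longrightarrow> F p \<inter> F q = {}"
proof -
  obtain g l where g: "\<And>B. B \<in> \<B> \<Longrightarrow> g B \<in> V \<and> g B \<in> B \<and> l B > 0 \<and> B \<in> lmeasurable \<and>
      measure lebesgue B = (l B)^2 / 2 \<and> P (g B) (l B) B"
    using assms(3) by metis
  have inj: "inj_on g \<B>"
  proof (rule inj_onI)
    fix B B' assume "B \<in> \<B>" "B' \<in> \<B>" "g B = g B'"
    then show "B = B'"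
      using g assms(2) unfolding disjoint_def by (metis disjoint_iff)
  qed
  have fin: "finite \<B>"
    using inj_on_finite[OF inj _ assms(1)] g by blast
  define F where "F = inv_into \<B> g"
  \<comment> \<open>Size 0 marks a corner without a triangle, so that the sum can run over all of
    \<open>V\<close>.\<close>
  define L where "L p = (if p \<in> g ` \<B> then l (F p) else 0)" for p
  have F: "F p \<in> \<B>" "g (F p) = p" if "p \<in> g ` \<B>" for p
    unfolding F_def using that by (auto intro: inv_into_into f_inv_into_f)
  have FgB: "F (g B) = B" if "B \<in> \<B>" for B
    unfolding F_def using inj that by simp
  have "measure lebesgue (\<Union>\<B>) = (\<Sum>B\<in>\<B>. measure lebesgue B)"
  proof (rule measure_negligible_finite_Union[OF fin])
    show "pairwise (\<lambda>S T. negligible (S \<inter> T)) \<B>"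
      using assms(2) by (simp add: pairwise_def disjnt_def)
  qed (use g in blast)
  also have "\<dots> = (\<Sum>p\<in>g ` \<B>. (L p)^2 / 2)"
    unfolding sum.reindex[OF inj] using g FgB by (auto simp: L_def intro!: sum.cong)
  also have "\<dots> = (\<Sum>p\<in>V. (L p)^2 / 2)"
    using g by (intro sum.mono_neutral_left assms(1)) (auto simp: L_def)
  finally have "measure lebesgue (\<Union>\<B>) = (\<Sum>p\<in>V. (L p)^2 / 2)" .
  moreover have "\<Union>\<B> \<in> lmeasurable"
    using fin g by (intro fmeasurable.finite_Union) auto
  moreover have "0 \<le> L p" for p
    using g F by (auto simp: L_def less_imp_le)
  moreover have pos: "p \<in> g ` \<B>" if "0 < L p" for p
    using that by (auto simp: L_def split: if_splits)
  moreover have "P p (L p) (F p)" if "0 < L p" for p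
    using g[OF F(1)[OF pos[OF that]]] F(2)[OF pos[OF that]] pos[OF that] by (simp add: L_def)
  moreover have "F p \<inter> F q = {}" if "p \<noteq> q" "0 < L p" "0 < L q" for p q
    using F[OF pos[OF that(2)]] F[OF pos[OF that(3)]] that(1) assms(2) unfolding disjoint_def by metis
  ultimately show thesis
    by (intro that[of L F]) auto
qed

lemma measure_bent_tri:
  assumes "cross2 u v = 1" "0 < l"
  shows "{z. vsh (cbend c x0 w) z \<in> tri p u v l} \<in> lmeasurable \<and>
    measure lebesgue {z. vsh (cbend c x0 w) z \<in> tri p u v l} = l^2 / 2"
proof -
  obtain k r where k: "\<And>x. bend c w x = of_int k * x + r + cbend c x0 w x"
    using bend_eq_cbend by blast
  \<comment> \<open>The negative of \<open>cbend\<close>, written as an affine function plus hinges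
    so that \<open>measure_vsh\<close> applies.\<close>
  define g where "g = (\<lambda>x. of_int k * x + r + (\<Sum>i<length c. - of_int (w i) * max 0 (x - c ! i $ 1)))"
  have "cbend c x0 w = (\<lambda>x. - g x)"
    using k by (simp add: fun_eq_iff g_def bend_def sum_negf)
  then have *: "{z. vsh (cbend c x0 w) z \<in> tri p u v l} = vsh g ` tri p u v l"
    by (simp add: vsh_image)
  show ?thesis
    unfolding * g_def
    using measure_vsh[OF conjunct1[OF measure_tri[OF assms, where p = p]], where k = "of_int k" and r = r
        and v = "\<lambda>i. - of_int (w i)" and b = "\<lambda>i. c ! i $ 1" and n = "length c"]
      measure_tri[OF assms, where p = p]
    by (simp only: simp_thms)
qed

section \<open>Convex quadrilaterals\<close>

text \<open>Twice the signed area of the triangle with vertices \<open>P\<close>, \<open>Q\<close>,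
  \<open>z\<close>; it is nonnegative to the left of the line from \<open>P\<close> to
  \<open>Q\<close>.\<close>

definition orient :: "real^2 \<Rightarrow> real^2 \<Rightarrow> real^2 \<Rightarrow> real" where
  "orient P Q z = cross2 (Q - P) (z - P)"

lemma orient_simps:
  "orient P Q z = (Q $ 1 - P $ 1) * (z $ 2 - P $ 2) - (Q $ 2 - P $ 2) * (z $ 1 - P $ 1)"
  by (simp add: orient_def cross2_def)

lemma convex_orient: "convex {z. 0 \<le> orient P Q z}"
proof -
  have "{z. 0 \<le> orient P Q z} = {z. - pt (P $ 2 - Q $ 2) (Q $ 1 - P $ 1) \<bullet> z \<le> - (pt (P $ 2 - Q $ 2) (Q $ 1 - P $ 1) \<bullet> P)}"
    by (auto simp: orient_simps inner_vec_def sum_2 algebra_simps)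
  then show ?thesis by (simp only: convex_halfspace_le)
qed

text \<open>The three signed areas add up to that of the whole triangle, and their quotients by it
  are the barycentric coordinates of \<open>z\<close>.\<close>

lemma mem_triangle_iff:
  assumes "orient A B C > 0"
  shows "z \<in> convex hull {A, B, C} \<longleftrightarrow> 0 \<le> orient A B z \<and> 0 \<le> orient B C z \<and> 0 \<le> orient C A z"
proof
  assume "z \<in> convex hull {A, B, C}"
  moreover have "convex hull {A, B, C} \<subseteq> {z. 0 \<le> orient A B z} \<inter> {z. 0 \<le> orient B C z} \<inter> {z. 0 \<le> orient C A z}"
    (is "_ \<subseteq> ?H")
  proof (rule hull_minimal)
    show "convex (?H)" by (intro convex_Int convex_orient)
  qed (use assms in \<open>auto simp: orient_simps algebra_simps\<close>)
  ultimately show "0 \<le> orient A B z \<and> 0 \<le> orient B C z \<and> 0 \<le> orient C A z"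
    by blast
next
  assume z: "0 \<le> orient A B z \<and> 0 \<le> orient B C z \<and> 0 \<le> orient C A z"
  define D where "D = orient A B C"
  have D: "D > 0" using assms D_def by simp
  have sum: "orient B C z + orient C A z + orient A B z = D"
    by (simp add: D_def orient_simps algebra_simps)
  have "D * z $ i = orient B C z * A $ i + orient C A z * B $ i + orient A B z * C $ i" if "i = 1 \<or> i = 2" for i
    using that by (auto simp: D_def orient_simps algebra_simps)
  then have "D * z $ 1 = orient B C z * A $ 1 + orient C A z * B $ 1 + orient A B z * C $ 1"
    "D * z $ 2 = orient B C z * A $ 2 + orient C A z * B $ 2 + orient A B z * C $ 2"
    by blast+
  then have "z = (orient B C z / D) *\<^sub>R A + (orient C A z / D) *\<^sub>R B + (orient A B z / D) *\<^sub>R C"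
    using D by (simp add: vec2_eq_iff add_divide_distrib[symmetric] nonzero_eq_divide_eq mult.commute)
  moreover have "orient B C z / D + orient C A z / D + orient A B z / D = 1"
    using sum D by (simp add: add_divide_distrib[symmetric])
  moreover have "0 \<le> orient B C z / D" "0 \<le> orient C A z / D" "0 \<le> orient A B z / D"
    using z D by simp_all
  ultimately show "z \<in> convex hull {A, B, C}"
    unfolding convex_hull_3 by blast
qed

text \<open>The case \<open>C = D\<close> covers triangles.\<close>

lemma
  assumes ABC: "orient A B C > 0" and ACD: "orient A C D > 0 \<or> C = D"
    and "0 \<le> orient A B D" "0 \<le> orient B C D"
  shows mem_quadrilateral_iff: "z \<in> convex hull {A, B, C, D} \<longleftrightarrow>
      0 \<le> orient A B z \<and> 0 \<le> orient B C z \<and> 0 \<le> orient C D z \<and> 0 \<le> orient D A z" (is ?mem)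
    and lmeasurable_quadrilateral: "convex hull {A, B, C, D} \<in> lmeasurable"
    and measure_quadrilateral:
      "measure lebesgue (convex hull {A, B, C, D}) = (orient A B C + orient A C D) / 2"
proof -
  have sub: "convex hull {A, B, C, D} \<subseteq>
      {z. 0 \<le> orient A B z} \<inter> {z. 0 \<le> orient B C z} \<inter> {z. 0 \<le> orient C D z} \<inter> {z. 0 \<le> orient D A z}" (is "_ \<subseteq> ?H")
  proof (rule hull_minimal)
    show "convex (?H)" by (intro convex_Int convex_orient)
  qed (use assms in \<open>auto simp: orient_simps algebra_simps\<close>)
  \<comment> \<open>The diagonal through \<open>A\<close> and \<open>C\<close> decides which of the
    two triangles contains the point.\<close>
  have cover: "z \<in> convex hull {A, B, C} \<or> z \<in> convex hull {A, C, D}"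
    if z: "0 \<le> orient A B z" "0 \<le> orient B C z" "0 \<le> orient C D z" "0 \<le> orient D A z" for z
  proof (cases "0 \<le> orient C A z")
    case True
    then show ?thesis using z mem_triangle_iff[OF ABC] by blast
  next
    case False
    then have "C \<noteq> D" using z by auto
    moreover have "orient A C z = - orient C A z"
      by (simp add: orient_simps algebra_simps)
    ultimately show ?thesis
      using z False ACD mem_triangle_iff[of A C D z] by auto
  qed
  have mono: "convex hull {A, B, C} \<subseteq> convex hull {A, B, C, D}" "convex hull {A, C, D} \<subseteq> convex hull {A, B, C, D}"
    by (intro hull_mono; blast)+
  show mem: ?mem for z
    using sub cover mono by blast
  have Un: "convex hull {A, B, C, D} = convex hull {A, B, C} \<union> convex hull {A, C, D}"
    using sub cover mono by blast
  have lm: "convex hull S \<in> lmeasurable" if "finite S" for S :: "(real^2) set"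
    using that by (intro lmeasurable_compact finite_imp_compact_convex_hull)
  show "convex hull {A, B, C, D} \<in> lmeasurable"
    by (rule lm) simp
  have tri: "measure lebesgue (convex hull {P, Q, R}) = orient P Q R / 2" if "0 \<le> orient P Q R" for P Q R
  proof -
    have "compact (convex hull {P, Q, R})"
      by (intro finite_imp_compact_convex_hull) simp
    then have "measure lebesgue (convex hull {P, Q, R}) = measure lborel (convex hull {P, Q, R})"
      by (simp add: compact_imp_closed)
    also have "\<dots> = \<bar>- orient P Q R\<bar> / 2"
      unfolding content_triangle by (simp add: orient_simps algebra_simps)
    finally show ?thesis using that by simp
  qed
  define n where "n = pt (A $ 2 - C $ 2) (C $ 1 - A $ 1)"
  have n: "n \<bullet> z - n \<bullet> A = orient A C z" for z
    by (simp add: n_def inner_vec_def sum_2 orient_simps algebra_simps)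
  have "n \<noteq> 0"
    using ABC n[of B] by (auto simp: orient_simps algebra_simps)
  moreover have "convex hull {A, B, C} \<inter> convex hull {A, C, D} \<subseteq> {z. n \<bullet> z = n \<bullet> A}"
  proof
    fix z assume z: "z \<in> convex hull {A, B, C} \<inter> convex hull {A, C, D}"
    have "0 \<le> orient C A z"
      using z mem_triangle_iff[OF ABC] by blast
    moreover have "orient A C z = - orient C A z"
      by (simp add: orient_simps algebra_simps)
    moreover have "0 \<le> orient A C z"
    proof -
      have "convex hull {A, C, D} \<subseteq> {z. 0 \<le> orient A C z}"
        by (rule hull_minimal, use ACD in \<open>force simp: orient_simps\<close>) (rule convex_orient)
      then show ?thesis using z by blast
    qed
    ultimately show "z \<in> {z. n \<bullet> z = n \<bullet> A}"
      using n[of z] by simp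
  qed
  ultimately have "negligible (convex hull {A, B, C} \<inter> convex hull {A, C, D})"
    using negligible_subset[OF negligible_hyperplane[of n "n \<bullet> A"]] by blast
  then have "measure lebesgue (convex hull {A, B, C} \<inter> convex hull {A, C, D}) = 0"
    by (rule negligible_imp_measure0)
  moreover have "0 \<le> orient A C D"
    using ACD by (auto simp: orient_simps)
  ultimately show "measure lebesgue (convex hull {A, B, C, D}) = (orient A B C + orient A C D) / 2"
    unfolding Un using measure_Un3[OF lm lm, of "{A, B, C}" "{A, C, D}"] tri[of A B C] tri[of A C D] ABC
    by simp
qed

lemma orient_nonneg_iff: "k > 0 \<Longrightarrow> orient P Q z = k * e \<Longrightarrow> 0 \<le> orient P Q z \<longleftrightarrow> 0 \<le> e"
  by (simp add: zero_le_mult_iff)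

lemma
  fixes a b N :: real
  assumes a: "0 < a" and b: "0 \<le> b" and N: "1 \<le> N"
  defines "H \<equiv> convex hull {pt 0 0, pt a a, pt (a + b) a, pt (N * a + b) 0}"
  shows mem_trapezoid_iff: "z \<in> H \<longleftrightarrow> 0 \<le> z $ 2 \<and> z $ 2 \<le> a \<and> z $ 2 \<le> z $ 1 \<and> z $ 1 + (N - 1) * z $ 2 \<le> N * a + b" (is ?mem)
    and lmeasurable_trapezoid: "H \<in> lmeasurable"
    and measure_trapezoid: "measure lebesgue H = (N * a + 2 * b) * a / 2"
proof -
  let ?A = "pt 0 0" and ?B = "pt (N * a + b) 0" and ?C = "pt (a + b) a" and ?D = "pt a a"
  have H: "H = convex hull {?A, ?B, ?C, ?D}"
    unfolding H_def by (rule arg_cong[of _ _ "\<lambda>S. convex hull S"]) auto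
  have pos: "0 < N * a + b" using a b N by (simp add: add_pos_nonneg)
  have ABC: "orient ?A ?B ?C = (N * a + b) * a" and ACD: "orient ?A ?C ?D = b * a"
    and ABD: "orient ?A ?B ?D = (N * a + b) * a" and BCD: "orient ?B ?C ?D = b * a"
    by (simp_all add: orient_simps algebra_simps)
  have 1: "orient ?A ?B ?C > 0" using ABC pos a by simp
  have 2: "orient ?A ?C ?D > 0 \<or> ?C = ?D" using ACD a b by (cases "b = 0") auto
  have 3: "0 \<le> orient ?A ?B ?D" "0 \<le> orient ?B ?C ?D" unfolding ABD BCD using pos a b by simp_all
  show "H \<in> lmeasurable"
    unfolding H by (rule lmeasurable_quadrilateral[OF 1 2 3])
  show "measure lebesgue H = (N * a + 2 * b) * a / 2"
    unfolding H measure_quadrilateral[OF 1 2 3] ABC ACD by (simp add: algebra_simps)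
  have AB: "0 \<le> orient ?A ?B z \<longleftrightarrow> 0 \<le> z $ 2"
    by (rule orient_nonneg_iff[OF pos]) (simp add: orient_simps)
  have BC: "0 \<le> orient ?B ?C z \<longleftrightarrow> 0 \<le> N * a + b - z $ 1 - (N - 1) * z $ 2"
    by (rule orient_nonneg_iff[OF a]) (simp add: orient_simps algebra_simps)
  have DA: "0 \<le> orient ?D ?A z \<longleftrightarrow> 0 \<le> z $ 1 - z $ 2"
    by (rule orient_nonneg_iff[OF a]) (simp add: orient_simps algebra_simps)
  have CD: "0 \<le> orient ?C ?D z \<longleftrightarrow> b = 0 \<or> 0 \<le> a - z $ 2"
  proof (cases "b = 0")
    case False
    then have "0 \<le> orient ?C ?D z \<longleftrightarrow> 0 \<le> a - z $ 2"
      using b by (intro orient_nonneg_iff[of b]) (auto simp: orient_simps algebra_simps)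
    then show ?thesis using False by simp
  qed (simp add: orient_simps)
  \<comment> \<open>For \<open>b = 0\<close> the top edge shrinks to a point and its inequality
    becomes empty; the bound on the height then comes from the two slanted sides.\<close>
  have top: "z $ 2 \<le> a" if "b = 0" "z $ 2 \<le> z $ 1" "z $ 1 + (N - 1) * z $ 2 \<le> N * a + b"
  proof -
    have "N * z $ 2 \<le> N * a" using that by (simp add: algebra_simps)
    then show ?thesis using N by simp
  qed
  show ?mem
    unfolding H mem_quadrilateral_iff[OF 1 2 3] AB BC CD DA using top by auto
qed

section \<open>One marked point\<close>

text \<open>The set of \<open>packed_in_chart_tri\<close> for the single wall x = a, bent on the
  side of the wall away from \<open>p\<close>. For \<delta> = 1 the exponent of the half shear is
  (-1 - 1)/2 = -1, hence the minus sign.\<close>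

definition bent_tri :: "real \<Rightarrow> real \<Rightarrow> real^2 \<Rightarrow> real^2 \<Rightarrow> real^2 \<Rightarrow> real \<Rightarrow> (real^2) set" where
  "bent_tri a \<delta> p u v l =
     {z. vsh (\<lambda>x. - \<delta> * (if a < p $ 1 then max 0 (a - x) else max 0 (x - a))) z \<in> tri p u v l}"

text \<open>
  The base chart has sign \<open>-1\<close>; the other chart is \<open>\<delta> = 1\<close>.
\<close>

lemma corner_packed_one_mark:
  assumes "corner_packed (\<Delta>, [pt a h], [- 1]) p B"
  obtains \<delta> where "\<delta> = 0 \<or> \<delta> = 1" "B \<subseteq> \<Delta>" "pt a h \<notin> B" "p \<in> \<Delta>"
    "p $ 1 = a \<Longrightarrow> \<delta> = 0 \<and> h < p $ 2 \<or> \<delta> = 1 \<and> p $ 2 < h"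
    "\<And>q1 q2. q1 \<in> \<Delta> \<Longrightarrow> q2 \<in> \<Delta> \<Longrightarrow> q1 \<noteq> q2 \<Longrightarrow> q1 $ 1 + q2 $ 1 = 2 * p $ 1 \<Longrightarrow>
      q1 $ 2 - \<delta> * max 0 (q1 $ 1 - a) + (q2 $ 2 - \<delta> * max 0 (q2 $ 1 - a)) \<noteq> 2 * (p $ 2 - \<delta> * max 0 (p $ 1 - a))"
    "\<And>w. convex \<Delta> \<Longrightarrow> p + w \<in> \<Delta> \<Longrightarrow> p - w \<in> \<Delta> \<Longrightarrow> w \<noteq> 0 \<Longrightarrow> p $ 1 = a \<and> w $ 1 \<noteq> 0 \<and> \<delta> \<noteq> 0"
    "\<And>u v V. cross2 u v = 1 \<Longrightarrow> (\<And>i. u $ i \<in> \<int>) \<Longrightarrow> (\<And>i. v $ i \<in> \<int>) \<Longrightarrow> open V \<Longrightarrow> p \<in> V \<Longrightarrow>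
      (\<And>z. z \<in> V \<Longrightarrow> z \<in> \<Delta> \<longleftrightarrow> cross2 (z - p) v \<ge> 0 \<and> cross2 u (z - p) \<ge> 0) \<Longrightarrow>
      (p $ 1 = a \<Longrightarrow> \<delta> = 0) \<Longrightarrow> \<exists>l>0. B = bent_tri a \<delta> p u v l"
proof -
  obtain s k r where s: "s \<in> sign_lists 1" and B: "B \<subseteq> \<Delta>" "pt a h \<notin> B"
    and P: "packed_in_chart \<Delta> [pt a h] p B s (chart [pt a h] [- 1] s k r)"
    using assms unfolding corner_packed_def by auto
  define \<delta> :: real where "\<delta> = (if s ! 0 = 1 then 1 else 0)"
  have s0: "s ! 0 = 1 \<or> s ! 0 = - 1"
    using sign_lists_nth[OF s] by simp
  have E: "chart_vertex [pt a h] [- 1] s k r \<Delta> p"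
    and cut: "a = p $ 1 \<Longrightarrow> of_int (s ! 0) * (p $ 2 - h) < 0"
    using P unfolding packed_in_chart_def by auto
  have w: "of_int ((- 1 - s ! 0) div 2) = - \<delta>"
    using s0 by (auto simp: \<delta>_def)
  have bend: "bend [pt a h] (\<lambda>i. ([- 1] ! i - s ! i) div 2) x = - \<delta> * max 0 (x - a)" for x
    by (simp add: bend_def w)
  have cbend: "cbend [pt a h] (p $ 1) (\<lambda>i. ([- 1] ! i - s ! i) div 2) =
      (\<lambda>x. - \<delta> * (if a < p $ 1 then max 0 (a - x) else max 0 (x - a)))"
    by (simp add: cbend_def fun_eq_iff w)
  show thesis
  proof (rule that)
    show "\<delta> = 0 \<or> \<delta> = 1" by (simp add: \<delta>_def)
    show "p \<in> \<Delta>" using E by (auto simp: extreme_point_of_def)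
    show "\<delta> = 0 \<and> h < p $ 2 \<or> \<delta> = 1 \<and> p $ 2 < h" if "p $ 1 = a"
      using cut that s0 by (auto simp: \<delta>_def)
    show "q1 $ 2 - \<delta> * max 0 (q1 $ 1 - a) + (q2 $ 2 - \<delta> * max 0 (q2 $ 1 - a)) \<noteq> 2 * (p $ 2 - \<delta> * max 0 (p $ 1 - a))"
      if "q1 \<in> \<Delta>" "q2 \<in> \<Delta>" "q1 \<noteq> q2" "q1 $ 1 + q2 $ 1 = 2 * p $ 1" for q1 q2
      using chart_not_extreme[OF that _ refl, of "[pt a h]" "[- 1]" s k r] E unfolding bend by auto
    show "p $ 1 = a \<and> w $ 1 \<noteq> 0 \<and> \<delta> \<noteq> 0" if "convex \<Delta>" "p + w \<in> \<Delta>" "p - w \<in> \<Delta>" "w \<noteq> 0" for w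
    proof (rule ccontr)
      assume "\<not> (p $ 1 = a \<and> w $ 1 \<noteq> 0 \<and> \<delta> \<noteq> 0)"
      then have "w $ 1 = 0 \<or> s ! i = [- 1] ! i" if "i < length [pt a h]" "[pt a h] ! i $ 1 = p $ 1" for i
        using that s0 by (auto simp: \<delta>_def split: if_splits)
      then show False
        using chart_not_extreme_off_wall[OF that, of "[pt a h]" s "[- 1]" k r] E by blast
    qed
    show "\<exists>l>0. B = bent_tri a \<delta> p u v l"
      if "cross2 u v = 1" "\<And>i. u $ i \<in> \<int>" "\<And>i. v $ i \<in> \<int>" "open V" "p \<in> V"
        "\<And>z. z \<in> V \<Longrightarrow> z \<in> \<Delta> \<longleftrightarrow> cross2 (z - p) v \<ge> 0 \<and> cross2 u (z - p) \<ge> 0"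
        "p $ 1 = a \<Longrightarrow> \<delta> = 0" for u v V
    proof -
      have wall: "s ! i = [- 1] ! i" if "i < length [pt a h]" "[pt a h] ! i $ 1 = p $ 1" for i
        using that \<open>p $ 1 = a \<Longrightarrow> \<delta> = 0\<close> s0 by (auto simp: \<delta>_def split: if_splits)
      show ?thesis
        using packed_in_chart_tri[OF P wall that(1-6)] unfolding cbend bent_tri_def by blast
    qed
  qed (fact B)+
qed

lemma measure_bent_tri_one_mark:
  assumes "cross2 u v = 1" "0 < l" "\<delta> = 0 \<or> \<delta> = 1"
  shows "bent_tri a \<delta> p u v l \<in> lmeasurable \<and> measure lebesgue (bent_tri a \<delta> p u v l) = l^2 / 2"
proof -
  obtain w :: int where w: "of_int w = - \<delta>"
    using assms(3) by (metis of_int_0 of_int_1 of_int_minus minus_zero)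
  \<comment> \<open>Only the first coordinate of a mark enters \<open>cbend\<close>, so any height
    will do here.\<close>
  have "cbend [pt a 0] (p $ 1) (\<lambda>_. w) = (\<lambda>x. - \<delta> * (if a < p $ 1 then max 0 (a - x) else max 0 (x - a)))"
    by (simp add: cbend_def fun_eq_iff w)
  then show ?thesis
    using measure_bent_tri[OF assms(1,2), of "[pt a 0]" "p $ 1" "\<lambda>_. w" p] by (simp add: bent_tri_def)
qed

lemma Ints_pt: "x \<in> \<int> \<Longrightarrow> y \<in> \<int> \<Longrightarrow> pt x y $ i \<in> \<int>"
  using exhaust_2[of i] by auto

text \<open>A corner on the wall and above the mark is free of the cut only in the base chart, so
  \<delta> = 0 there and the chart does not bend at the corner.\<close>

lemma bent_tri_of_corner_packed:
  assumes B: "corner_packed (\<Delta>, [pt a h], [- 1]) p B" and "h < p $ 2 \<or> p $ 1 \<noteq> a"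
    and uv: "cross2 u v = 1" "\<And>i. u $ i \<in> \<int>" "\<And>i. v $ i \<in> \<int>"
    and V: "open V" "p \<in> V" "\<And>z. z \<in> V \<Longrightarrow> z \<in> \<Delta> \<longleftrightarrow> cross2 (z - p) v \<ge> 0 \<and> cross2 u (z - p) \<ge> 0"
  obtains \<delta> l where "\<delta> = 0 \<or> \<delta> = 1" "l > 0" "B = bent_tri a \<delta> p u v l" "B \<subseteq> \<Delta>" "pt a h \<notin> B"
    "p \<in> B" "B \<in> lmeasurable" "measure lebesgue B = l^2 / 2"
proof (rule corner_packed_one_mark[OF B])
  fix \<delta> :: real
  assume \<delta>: "\<delta> = 0 \<or> \<delta> = 1" "B \<subseteq> \<Delta>" "pt a h \<notin> B"
    and wall: "p $ 1 = a \<Longrightarrow> \<delta> = 0 \<and> h < p $ 2 \<or> \<delta> = 1 \<and> p $ 2 < h"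
    and tri: "\<And>u v V. cross2 u v = 1 \<Longrightarrow> (\<And>i. u $ i \<in> \<int>) \<Longrightarrow> (\<And>i. v $ i \<in> \<int>) \<Longrightarrow> open V \<Longrightarrow> p \<in> V \<Longrightarrow>
      (\<And>z. z \<in> V \<Longrightarrow> z \<in> \<Delta> \<longleftrightarrow> cross2 (z - p) v \<ge> 0 \<and> cross2 u (z - p) \<ge> 0) \<Longrightarrow>
      (p $ 1 = a \<Longrightarrow> \<delta> = 0) \<Longrightarrow> \<exists>l>0. B = bent_tri a \<delta> p u v l"
  have "\<exists>l>0. B = bent_tri a \<delta> p u v l"
    by (rule tri[OF uv V]) (use wall assms(2) in auto)
  then obtain l where l: "l > 0" "B = bent_tri a \<delta> p u v l" by blast
  have "vsh (\<lambda>x. - \<delta> * (if a < p $ 1 then max 0 (a - x) else max 0 (x - a))) p = p"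
    by (cases "a < p $ 1") (auto simp: vec2_eq_iff)
  then have "p \<in> B"
    unfolding l(2) bent_tri_def using l(1) by (auto intro!: tri_memI[of 0 0])
  then show thesis
    using that[OF \<delta>(1) l \<delta>(2,3)] measure_bent_tri_one_mark[OF uv(1) l(1) \<delta>(1)] l(2) by simp
qed

section \<open>Type (1)\<close>

text \<open>The half shear at \<open>a\<close> straightens the apex of the displayed triangle. The
  result is the triangle with vertices (0,0), (a,0), (2a,a), whose vertex (a,0) is the one on the
  downward cut.\<close>

definition base1 :: "real \<Rightarrow> (real^2) set" where
  "base1 a = {z. 0 \<le> z $ 2 \<and> z $ 1 - a \<le> z $ 2 \<and> 2 * z $ 2 \<le> z $ 1}"

lemma convex_base1: "convex (base1 a)"
proof -
  have "base1 a = {z. pt 0 (- 1) \<bullet> z \<le> 0} \<inter> {z. pt 1 (- 1) \<bullet> z \<le> a} \<inter> {z. pt (- 1) 2 \<bullet> z \<le> 0}"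
    by (auto simp: base1_def inner_vec_def sum_2)
  then show ?thesis by (simp add: convex_Int convex_halfspace_le)
qed

lemma chart_one_mark: "chart [pt a h] [- 1] [1] 0 0 = vsh (\<lambda>x. - max 0 (x - a))"
  by (simp add: chart_def bend_def)

lemma base1_chart:
  assumes "a > 0"
  defines "H \<equiv> convex hull {pt 0 0, pt a (a/2), pt (2*a) 0}"
  shows "chart [pt a h] [- 1] [1] 0 0 ` base1 a = H"
    and "base1 a \<in> lmeasurable" "measure lebesgue (base1 a) = a^2 / 2"
proof -
  let ?A = "pt 0 0" and ?B = "pt (2*a) 0" and ?C = "pt a (a/2)"
  have set: "H = convex hull {?A, ?B, ?C, ?C}"
    unfolding H_def by (rule arg_cong[of _ _ "\<lambda>S. convex hull S"]) auto
  have o: "orient ?A ?B ?C = a * a"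
    by (simp add: orient_simps)
  have pos: "a * a > 0" using assms by simp
  note Q = mem_quadrilateral_iff[of ?A ?B ?C ?C]
    lmeasurable_quadrilateral[of ?A ?B ?C ?C]
    measure_quadrilateral[of ?A ?B ?C ?C]
  have X: "z \<in> H \<longleftrightarrow> 0 \<le> z $ 2 \<and> 2 * z $ 2 \<le> z $ 1 \<and> 2 * z $ 2 \<le> 2 * a - z $ 1" for z
  proof -
    have "0 \<le> orient ?A ?B z \<longleftrightarrow> 0 \<le> z $ 2"
      by (rule orient_nonneg_iff[of "2 * a"]) (use assms in \<open>auto simp: orient_simps field_simps\<close>)
    moreover have "0 \<le> orient ?B ?C z \<longleftrightarrow> 0 \<le> 2 * a - z $ 1 - 2 * z $ 2"
      by (rule orient_nonneg_iff[of "a / 2"]) (use assms in \<open>auto simp: orient_simps field_simps\<close>)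
    moreover have "0 \<le> orient ?C ?A z \<longleftrightarrow> 0 \<le> z $ 1 - 2 * z $ 2"
      by (rule orient_nonneg_iff[of "a / 2"]) (use assms in \<open>auto simp: orient_simps field_simps\<close>)
    moreover have "orient ?C ?C z = 0"
      by (simp add: orient_simps)
    moreover have "0 \<le> orient ?B ?C ?C"
      by (simp add: orient_simps)
    ultimately show ?thesis
      unfolding set using assms o pos by (subst Q(1)) (auto simp: orient_simps[of ?A ?B ?C])
  qed
  show im: "chart [pt a h] [- 1] [1] 0 0 ` base1 a = H" for h
    unfolding chart_one_mark vsh_image by (rule set_eqI) (auto simp: X base1_def max_def)
  have lm: "H \<in> lmeasurable"
    unfolding set using o pos by (intro Q(2)) (auto simp: orient_simps)
  have m: "measure lebesgue H = a^2 / 2"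
    unfolding set using o pos by (subst Q(3)) (auto simp: orient_simps power2_eq_square)
  have "base1 a = vsh (\<lambda>x. 1 * max 0 (x - a)) ` chart [pt a h] [- 1] [1] 0 0 ` base1 a"
    by (simp add: chart_one_mark image_image)
  then show "base1 a \<in> lmeasurable" "measure lebesgue (base1 a) = a^2 / 2"
    using measure_vsh_hinge[OF lm, of 1 a] m unfolding im by simp_all
qed

lemma tri1_left: "z \<in> tri (pt 0 0) (pt 1 0) (pt 2 1) l \<longleftrightarrow> 0 \<le> z $ 2 \<and> 2 * z $ 2 \<le> z $ 1 \<and> z $ 1 - z $ 2 < l"
  by (subst mem_tri_iff) (auto simp: cross2_def)

lemma tri1_right: "z \<in> tri (pt (2*a) a) (pt (- 2) (- 1)) (pt (- 1) (- 1)) l \<longleftrightarrow>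
    z $ 1 - a \<le> z $ 2 \<and> 2 * z $ 2 \<le> z $ 1 \<and> a - z $ 2 < l"
  by (subst mem_tri_iff) (auto simp: cross2_def)

text \<open>Any other point is the midpoint of a short segment that stays straight in the chart. On
  the wall a bent chart requires the point to lie below the mark, which excludes the upper edge and
  leaves (a,0), where the bending itself straightens the boundary.\<close>

lemma base1_candidates:
  assumes a: "a > 0" and h: "0 < h" "h < a / 2" and B: "corner_packed (base1 a, [pt a h], [- 1]) p B"
  shows "p = pt 0 0 \<or> p = pt (2*a) a"
proof (rule corner_packed_one_mark[OF B], rule ccontr)
  fix \<delta> :: real
  assume wall: "p $ 1 = a \<Longrightarrow> \<delta> = 0 \<and> h < p $ 2 \<or> \<delta> = 1 \<and> p $ 2 < h" and p: "p \<in> base1 a"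
    and mid: "\<And>q1 q2. q1 \<in> base1 a \<Longrightarrow> q2 \<in> base1 a \<Longrightarrow> q1 \<noteq> q2 \<Longrightarrow> q1 $ 1 + q2 $ 1 = 2 * p $ 1 \<Longrightarrow>
      q1 $ 2 - \<delta> * max 0 (q1 $ 1 - a) + (q2 $ 2 - \<delta> * max 0 (q2 $ 1 - a)) \<noteq> 2 * (p $ 2 - \<delta> * max 0 (p $ 1 - a))"
    and off: "\<And>w. convex (base1 a) \<Longrightarrow> p + w \<in> base1 a \<Longrightarrow> p - w \<in> base1 a \<Longrightarrow> w \<noteq> 0 \<Longrightarrow> p $ 1 = a \<and> w $ 1 \<noteq> 0 \<and> \<delta> \<noteq> 0"
    and n: "\<not> (p = pt 0 0 \<or> p = pt (2*a) a)"
  define x y where "x = p $ 1" and "y = p $ 2"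
  have xy: "0 \<le> y" "x - a \<le> y" "2 * y \<le> x" and n': "\<not> (x = 0 \<and> y = 0)" "\<not> (x = 2 * a \<and> y = a)"
    using p n by (auto simp: base1_def x_def y_def vec2_eq_iff)
  have move: "x = a \<and> d1 \<noteq> 0 \<and> \<delta> \<noteq> 0"
    if "pt (x + d1) (y + d2) \<in> base1 a" "pt (x - d1) (y - d2) \<in> base1 a" "d1 \<noteq> 0 \<or> d2 \<noteq> 0" for d1 d2
    using off[OF convex_base1, of "pt d1 d2"] that by (auto simp: base1_def x_def y_def vec2_eq_iff)
  consider "2 * y = x" | "2 * y < x" "0 < y" "x - a < y" | "y = 0" "0 < x" "x \<le> a" | "y = x - a" "0 < y" "x < 2 * a"
    using xy n' by linarith
  then show False
  proof cases
    case 1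
    define e where "e = min y (a - y)"
    have e: "0 < e" "e \<le> y" "e \<le> a - y" using 1 xy n' by (auto simp: e_def)
    then show False using move[of "2 * e" e] 1 wall h xy by (auto simp: base1_def x_def y_def)
  next
    case 2
    define e where "e = min (min y (y - (x - a))) (x / 2 - y)"
    have e: "0 < e" "e \<le> y" "e \<le> y - (x - a)" "e \<le> x / 2 - y" using 2 by (auto simp: e_def)
    then show False using move[of 0 e] by (auto simp: base1_def)
  next
    case 3
    show False
    proof (cases "x = a")
      case True
      then have "\<delta> = 1" using wall h 3 by (auto simp: x_def y_def)
      \<comment> \<open>In the chart with sign 1 the point (3a/2, a/2) drops to (3a/2, 0), so (a,0)
        becomes an inner point of the bottom edge.\<close>
      then show False
        using mid[of "pt (a/2) 0" "pt (3*a/2) (a/2)"] True 3 a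
        by (auto simp: base1_def x_def y_def)
    next
      case False
      define e where "e = min x (a - x)"
      have e: "0 < e" "e \<le> x" "e \<le> a - x" using 3 False by (auto simp: e_def)
      then show False using move[of e 0] 3 False by (auto simp: base1_def)
    qed
  next
    case 4
    define e where "e = min y (2 * a - x)"
    have e: "0 < e" "e \<le> y" "e \<le> 2 * a - x" using 4 by (auto simp: e_def)
    then show False using move[of e e] 4 by (auto simp: base1_def)
  qed
qed

lemma bent_tri1_left:
  assumes "a > 0"
  shows "z \<in> bent_tri a \<delta> (pt 0 0) (pt 1 0) (pt 2 1) l \<longleftrightarrow>
    (let y = z $ 2 - \<delta> * max 0 (z $ 1 - a) in 0 \<le> y \<and> 2 * y \<le> z $ 1 \<and> z $ 1 - y < l)"
  using assms by (simp add: bent_tri_def tri1_left Let_def)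

lemma bent_tri1_right:
  assumes "a > 0"
  shows "z \<in> bent_tri a \<delta> (pt (2*a) a) (pt (- 2) (- 1)) (pt (- 1) (- 1)) l \<longleftrightarrow>
    (let y = z $ 2 - \<delta> * max 0 (a - z $ 1) in z $ 1 - a \<le> y \<and> 2 * y \<le> z $ 1 \<and> a - y < l)"
  using assms by (simp add: bent_tri_def tri1_right Let_def)

definition packed1 :: "real \<Rightarrow> real \<Rightarrow> real^2 \<Rightarrow> real \<Rightarrow> (real^2) set \<Rightarrow> bool" where
  "packed1 a h p l B \<longleftrightarrow> B \<subseteq> base1 a \<and> pt a h \<notin> B \<and> (\<exists>\<delta>. (\<delta> = 0 \<or> \<delta> = 1) \<and>
     (p = pt 0 0 \<longrightarrow> B = bent_tri a \<delta> (pt 0 0) (pt 1 0) (pt 2 1) l) \<and>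
     (p = pt (2*a) a \<longrightarrow> B = bent_tri a \<delta> (pt (2*a) a) (pt (- 2) (- 1)) (pt (- 1) (- 1)) l))"

text \<open>No chart moves points of the line x = a in \<open>bent_tri\<close>, and the triangles at
  either corner reach the mark exactly at size a - h.\<close>

lemma packed1_bound:
  assumes "a > 0" "0 < h" "h < a / 2" "packed1 a h p l B" "p = pt 0 0 \<or> p = pt (2*a) a"
  shows "l \<le> a - h"
proof (rule ccontr)
  assume "\<not> l \<le> a - h"
  then have "pt a h \<in> B"
    using assms unfolding packed1_def
    by (auto simp: bent_tri1_left[OF assms(1)] bent_tri1_right[OF assms(1)] Let_def)
  then show False using assms(4) unfolding packed1_def by blast
qed

text \<open>If the side along 2 y = x were bent at the wall, it would rise above that line and leave
  the polygon. So the side follows the polygon edge in whichever chart the triangle is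
  straight.\<close>

lemma packed1_edge:
  assumes "a > 0" "packed1 a h (pt 0 0) l B" "0 \<le> t" "t < l"
  shows "pt (2*t) t \<in> B"
proof -
  obtain \<delta> where \<delta>: "\<delta> = 0 \<or> \<delta> = 1" "B = bent_tri a \<delta> (pt 0 0) (pt 1 0) (pt 2 1) l" "B \<subseteq> base1 a"
    using assms(2) unfolding packed1_def by blast
  have "pt (2*t) (t + \<delta> * max 0 (2*t - a)) \<in> B"
    unfolding \<delta>(2) using assms by (simp add: bent_tri1_left Let_def)
  moreover from this have "\<delta> * max 0 (2*t - a) = 0"
    using \<delta>(1,3) by (auto simp: base1_def subset_iff max_def split: if_splits)
  ultimately show ?thesis by simp
qed

lemma packed1_edge':
  assumes "a > 0" "packed1 a h (pt (2*a) a) l B" "0 \<le> t" "t < l"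
  shows "pt (2*(a - t)) (a - t) \<in> B"
proof -
  obtain \<delta> where \<delta>: "\<delta> = 0 \<or> \<delta> = 1" "B = bent_tri a \<delta> (pt (2*a) a) (pt (- 2) (- 1)) (pt (- 1) (- 1)) l" "B \<subseteq> base1 a"
    using assms(1,2) unfolding packed1_def by blast
  have "pt (2*(a - t)) (a - t + \<delta> * max 0 (a - 2*(a - t))) \<in> B"
    unfolding \<delta>(2) using assms by (simp add: bent_tri1_right Let_def)
  moreover from this have "\<delta> * max 0 (a - 2*(a - t)) = 0"
    using \<delta>(1,3) by (auto simp: base1_def subset_iff max_def split: if_splits)
  ultimately show ?thesis by (metis add.right_neutral)
qed

lemma real_vec_vector: "real_vec (vector [a, b]) = pt (of_int a) (of_int b)"
  by (simp add: vec2_eq_iff real_vec_def)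

text \<open>A sum of squares is convex, so on the segment x + y = a it is largest at the ends x = h
  and x = a - h; the product of the distances to the ends encodes this.\<close>

lemma sum_squares_le:
  fixes x y a h :: real
  assumes "0 \<le> x" "x \<le> a - h" "0 \<le> y" "y \<le> a - h" "x + y \<le> a"
  shows "x^2 + y^2 \<le> (a - h)^2 + h^2"
proof (cases "x \<le> h")
  case True
  then show ?thesis
    using assms by (simp add: add_mono power_mono add.commute)
next
  case False
  have "(x - h) * (a - h - x) \<ge> 0"
    using False assms by (intro mult_nonneg_nonneg) auto
  moreover have "y^2 \<le> (a - x)^2"
    using assms by (intro power_mono) auto
  ultimately show ?thesis
    by (simp add: power2_eq_square algebra_simps)
qed

lemma base1_upper:
  assumes a: "a > 0" and h: "0 < h" "h < a / 2" and "disjoint \<B>"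
    and "\<And>B. B \<in> \<B> \<Longrightarrow> \<exists>p. corner_packed (base1 a, [pt a h], [- 1]) p B"
  shows "\<Union>\<B> \<in> lmeasurable \<and> measure lebesgue (\<Union>\<B>) \<le> ((a - h)^2 + h^2) / 2"
proof -
  define A D where "A = pt 0 0" and "D = pt (2*a) a"
  have AD: "A \<noteq> D" using a by (simp add: A_def D_def)
  have *: "\<exists>p\<in>{A, D}. p \<in> B \<and> (\<exists>l>0. B \<in> lmeasurable \<and> measure lebesgue B = l^2 / 2 \<and> packed1 a h p l B)"
    if "B \<in> \<B>" for B
  proof -
    obtain p where p: "corner_packed (base1 a, [pt a h], [- 1]) p B"
      using assms(5) \<open>B \<in> \<B>\<close> by blast
    from base1_candidates[OF a h p] show ?thesis
    proof
      assume p0: "p = pt 0 0"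
      show ?thesis
      proof (rule bent_tri_of_corner_packed[OF p, of "pt 1 0" "pt 2 1" "{z. z $ 1 - a < z $ 2}"])
        fix \<delta> l
        assume B: "\<delta> = 0 \<or> \<delta> = 1" "l > 0" "B = bent_tri a \<delta> p (pt 1 0) (pt 2 1) l" "B \<subseteq> base1 a" "pt a h \<notin> B"
          "p \<in> B" "B \<in> lmeasurable" "measure lebesgue B = l^2 / 2"
        then have "packed1 a h p l B"
          unfolding packed1_def p0 using AD A_def D_def by auto
        then show ?thesis
          using B p0 by (auto simp: A_def D_def)
      next
        show "open {z::real^2. z $ 1 - a < z $ 2}"
          by (intro open_Collect_less continuous_intros)
      qed (use p0 a in \<open>auto simp: cross2_def base1_def intro!: Ints_pt\<close>)
    next
      assume p0: "p = pt (2*a) a"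
      show ?thesis
      proof (rule bent_tri_of_corner_packed[OF p, of "pt (- 2) (- 1)" "pt (- 1) (- 1)" "{z. 0 < z $ 2}"])
        fix \<delta> l
        assume B: "\<delta> = 0 \<or> \<delta> = 1" "l > 0" "B = bent_tri a \<delta> p (pt (- 2) (- 1)) (pt (- 1) (- 1)) l" "B \<subseteq> base1 a" "pt a h \<notin> B"
          "p \<in> B" "B \<in> lmeasurable" "measure lebesgue B = l^2 / 2"
        then have "packed1 a h p l B"
          unfolding packed1_def p0 using AD A_def D_def by auto
        then show ?thesis
          using B p0 by (auto simp: A_def D_def)
      next
        show "open {z::real^2. 0 < z $ 2}"
          by (intro open_Collect_less continuous_intros)
      qed (use p0 a in \<open>auto simp: cross2_def base1_def intro!: Ints_pt\<close>)
    qed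
  qed
  show ?thesis
  proof (rule disjoint_packing_measure[OF _ assms(4) *])
    fix L F
    assume L: "\<And>p. p \<in> {A, D} \<Longrightarrow> 0 \<le> L p" "\<And>p. p \<in> {A, D} \<Longrightarrow> 0 < L p \<Longrightarrow> packed1 a h p (L p) (F p)"
      and F: "\<And>p q. p \<in> {A, D} \<Longrightarrow> q \<in> {A, D} \<Longrightarrow> p \<noteq> q \<Longrightarrow> 0 < L p \<Longrightarrow> 0 < L q \<Longrightarrow> F p \<inter> F q = {}"
      and U: "\<Union>\<B> \<in> lmeasurable" "measure lebesgue (\<Union>\<B>) = (\<Sum>p\<in>{A, D}. (L p)^2 / 2)"
    have le: "L p \<le> a - h" if "p \<in> {A, D}" for p
      using packed1_bound[OF a h L(2)[OF that]] L(1)[OF that] that h a unfolding A_def D_def by force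
    have "L A + L D \<le> a"
    proof (rule ccontr)
      assume n: "\<not> L A + L D \<le> a"
      have "L A \<le> a - h" "L D \<le> a - h" using le by auto
      then have pos: "0 < L A" "0 < L D" using n h by linarith+
      \<comment> \<open>The common edge has lattice length \<open>a\<close>. Its point at distance
        \<open>t\<close> from \<open>A\<close> and \<open>a - t\<close> from \<open>D\<close> would
        lie in both triangles.\<close>
      obtain t where t: "max 0 (a - L D) < t" "t < min (L A) a"
        using dense[of "max 0 (a - L D)" "min (L A) a"] n pos a by auto
      have "pt (2*t) t \<in> F A"
        using packed1_edge[OF a] L(2)[of A] pos t by (auto simp: A_def)
      moreover have "pt (2*t) t \<in> F D"
        using packed1_edge'[OF a, of h "L D" "F D" "a - t"] L(2)[of D] pos t by (auto simp: D_def)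
      ultimately show False using F[of A D] AD pos by blast
    qed
    then have "(L A)^2 + (L D)^2 \<le> (a - h)^2 + h^2"
      using le L(1) by (intro sum_squares_le) auto
    then show ?thesis using U AD by simp
  qed simp
qed

lemma rho_ST_type1:
  assumes a: "a > 0" and h: "0 < h" "h < a / 2"
  shows "rho_ST (semitoric_orbit (convex hull {pt 0 0, pt a (a/2), pt (2*a) 0}, [pt a h], [1]))
    = (a^2 + 2 * h^2 - 2 * a * h) / a^2"
proof -
  define A D where "A = pt 0 0" and "D = pt (2*a) a"
  \<comment> \<open>The equality case of \<open>sum_squares_le\<close>: one triangle grows until it
    reaches the mark, the other takes the rest of the common edge.\<close>
  define TA TD where "TA = tri A (pt 1 0) (pt 2 1) (a - h)" and "TD = tri D (pt (- 2) (- 1)) (pt (- 1) (- 1)) h"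
  have TA: "z \<in> TA \<longleftrightarrow> 0 \<le> z $ 2 \<and> 2 * z $ 2 \<le> z $ 1 \<and> z $ 1 - z $ 2 < a - h"
    and TD: "z \<in> TD \<longleftrightarrow> z $ 1 - a \<le> z $ 2 \<and> 2 * z $ 2 \<le> z $ 1 \<and> a - z $ 2 < h" for z
    by (simp_all add: TA_def TD_def A_def D_def tri1_left tri1_right)
  have cA: "corner_packed (base1 a, [pt a h], [- 1]) A TA"
    unfolding TA_def
  proof (rule corner_packed_tri[of _ _ _ _ _ "vector [1, 0]" _ "vector [2, 1]"])
    show "A extreme_point_of base1 a" "delzant_condition (base1 a) A"
      by (rule delzant_corner_at[OF convex_base1, of "pt 1 0" "vector [1, 0]" "pt 2 1" "vector [2, 1]" a a];
        use a in \<open>auto simp: real_vec_vector cross2_def base1_def A_def\<close>)+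
    show "tri A (pt 1 0) (pt 2 1) (a - h) \<subseteq> base1 a" "set [pt a h] \<inter> tri A (pt 1 0) (pt 2 1) (a - h) = {}"
      using h unfolding TA_def[symmetric] by (auto simp: TA base1_def)
  qed (use a h in \<open>auto simp: real_vec_vector cross2_def base1_def A_def sign_lists_def\<close>)
  have cD: "corner_packed (base1 a, [pt a h], [- 1]) D TD"
    unfolding TD_def
  proof (rule corner_packed_tri[of _ _ _ _ _ "vector [- 2, - 1]" _ "vector [- 1, - 1]"])
    show "D extreme_point_of base1 a" "delzant_condition (base1 a) D"
      by (rule delzant_corner_at[OF convex_base1, of "pt (- 2) (- 1)" "vector [- 2, - 1]" "pt (- 1) (- 1)" "vector [- 1, - 1]" a a];
        use a in \<open>auto simp: real_vec_vector cross2_def base1_def D_def\<close>)+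
    show "tri D (pt (- 2) (- 1)) (pt (- 1) (- 1)) h \<subseteq> base1 a"
      "set [pt a h] \<inter> tri D (pt (- 2) (- 1)) (pt (- 1) (- 1)) h = {}"
      using h unfolding TD_def[symmetric] by (auto simp: TD base1_def)
  qed (use a h in \<open>auto simp: real_vec_vector cross2_def base1_def D_def sign_lists_def\<close>)
  have AD: "TA \<inter> TD = {}"
    using h by (auto simp: TA TD)
  have mT: "TA \<in> lmeasurable \<and> measure lebesgue TA = (a - h)^2 / 2" "TD \<in> lmeasurable \<and> measure lebesgue TD = h^2 / 2"
    unfolding TA_def TD_def using a h by (intro measure_tri; simp add: cross2_def)+
  have "rho_ST (semitoric_orbit (chart_triple (base1 a, [pt a h], [- 1]) [1] 0 0)) = ((a - h)^2 + h^2) / 2 / measure lebesgue (base1 a)"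
  proof (rule rho_ST_eq[where ?\<B>0.0 = "{TA, TD}"])
    show "base1 a \<in> lmeasurable" by (rule base1_chart[OF a])
    show "\<Union>\<B> \<in> lmeasurable \<and> measure lebesgue (\<Union>\<B>) \<le> ((a - h)^2 + h^2) / 2"
      if "disjoint \<B>" "\<And>B. B \<in> \<B> \<Longrightarrow> \<exists>p. corner_packed (base1 a, [pt a h], [- 1]) p B" for \<B>
      using base1_upper[OF a h that] .
    show "disjoint {TA, TD}"
      using AD by (auto simp: pairwise_insert disjnt_def)
    show "measure lebesgue (\<Union>{TA, TD}) = ((a - h)^2 + h^2) / 2"
      using measure_Un3[of TA lebesgue TD] mT AD by simp
    have "chart_vertex [pt a h] [- 1] s k r (base1 a) A" for s k r
      by (rule chart_extreme_sideways[of _ _ 1]) (use a in \<open>auto simp: base1_def A_def vec2_eq_iff\<close>)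
    moreover have "chart_vertex [pt a h] [- 1] s k r (base1 a) D" for s k r
      by (rule chart_extreme_sideways[of _ _ "- 1"]) (use a in \<open>auto simp: base1_def D_def vec2_eq_iff\<close>)
    ultimately show "\<exists>p. corner_packed (base1 a, [pt a h], [- 1]) p B \<and>
        (\<forall>s\<in>sign_lists (length [pt a h]). \<forall>k r. chart_vertex [pt a h] [- 1] s k r (base1 a) p)"
      if "B \<in> {TA, TD}" for B
      using cA cD that by blast
  qed (auto simp: sign_lists_def)
  moreover have "chart_triple (base1 a, [pt a h], [- 1]) [1] 0 0 = (convex hull {pt 0 0, pt a (a/2), pt (2*a) 0}, [pt a h], [1])"
    using base1_chart(1)[OF a, of h] by (simp add: chart_triple_def chart_one_mark vec2_eq_iff)
  moreover have "r / 2 / (a^2 / 2) = r / a^2" for r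
    by simp
  moreover have "(a - h)^2 + h^2 = a^2 + 2 * h^2 - 2 * a * h"
    by (simp add: power2_diff)
  ultimately show ?thesis
    unfolding base1_chart(3)[OF a] by (simp only:)
qed

section \<open>Type (3)\<close>

text \<open>
  The base chart is the polygon with the cut pointing downwards. For all of (3a), (3b), (3c) it has
  the corners \<open>PA\<close>, \<open>PC\<close>, \<open>PD\<close> and the point \<open>(a, 0)\<close> on the cut; in (3b) the corner \<open>PC\<close>
  lies above the marked point.
\<close>

locale type3 =
  fixes a b h :: real and n :: nat
  assumes a: "0 < a" and ab: "0 < a + b" and n: "1 \<le> n" and h: "0 < h" "h < a"
    and hn: "(real n - 1) * h < (real n - 1) * a + b"
begin

abbreviation N :: real where "N \<equiv> real n"

text \<open>Vanishes on the line through \<open>PC\<close> and \<open>PD\<close>, scaled to be a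
  lattice coordinate at both corners. The hypothesis \<open>hn\<close> says that K is positive at
  the mark.\<close>

definition K :: "real^2 \<Rightarrow> real" where
  "K z = (N - 2) * z $ 1 + a + b - (N - 1) * z $ 2"

definition Q :: "(real^2) set" where
  "Q = {z. 0 \<le> z $ 2 \<and> z $ 1 - a \<le> z $ 2 \<and> z $ 2 \<le> z $ 1 \<and> 0 \<le> K z}"

definition "PA = pt 0 0"
definition "PC = pt (a + b) (a + b)"
definition "PD = pt (N * a + b) ((N - 1) * a + b)"

abbreviation "uA \<equiv> pt 1 0"
abbreviation "vA \<equiv> pt 1 1"
text \<open>The edge from \<open>PC\<close> to \<open>PA\<close> is parallel to the one from
  \<open>PD\<close> to (a,0), so \<open>uC\<close> serves at both corners; the edge from
  \<open>PC\<close> to \<open>PD\<close> has direction \<open>vC\<close> and lattice length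
  \<open>a\<close>.\<close>

definition "uC = pt (- 1) (- 1)"
definition "vC = pt (N - 1) (N - 2)"
definition "uD = pt (1 - N) (2 - N)"

abbreviation packed :: "real^2 \<Rightarrow> (real^2) set \<Rightarrow> bool" where
  "packed \<equiv> corner_packed (Q, [pt a h], [- 1])"

lemma nab: "0 < (N - 1) * a + b"
proof -
  have "0 \<le> (N - 1) * h" using n h by simp
  then show ?thesis using hn by simp
qed

lemma n1: "n = 1 \<Longrightarrow> 0 < b"
  using nab by simp

lemma convex_Q: "convex Q"
proof -
  have "Q = {z. pt 0 (- 1) \<bullet> z \<le> 0} \<inter> {z. pt 1 (- 1) \<bullet> z \<le> a} \<inter> {z. pt (- 1) 1 \<bullet> z \<le> 0}
      \<inter> {z. pt (2 - N) (N - 1) \<bullet> z \<le> a + b}"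
    by (auto simp: Q_def K_def inner_vec_def sum_2 algebra_simps)
  then show ?thesis by (simp add: convex_Int convex_halfspace_le)
qed

lemma triA: "z \<in> tri PA uA vA l \<longleftrightarrow> 0 \<le> z $ 2 \<and> z $ 2 \<le> z $ 1 \<and> z $ 1 < l"
  by (subst mem_tri_iff) (auto simp: cross2_def PA_def)

lemma triC: "z \<in> tri PC uC vC l \<longleftrightarrow> 0 \<le> K z \<and> z $ 2 \<le> z $ 1 \<and> K z + z $ 1 - z $ 2 < l"
  by (subst mem_tri_iff) (auto simp: cross2_def PC_def uC_def vC_def K_def algebra_simps)

lemma triD: "z \<in> tri PD uD uC l \<longleftrightarrow> z $ 1 - a \<le> z $ 2 \<and> 0 \<le> K z \<and> z $ 2 - z $ 1 + a + K z < l"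
  by (subst mem_tri_iff) (auto simp: cross2_def PD_def uC_def uD_def K_def algebra_simps)

text \<open>As for type (1), every other point is the midpoint of a segment. The cases are the
  relative interiors of the four edges, the vertex (a,0), and the interior of
  \<open>Q\<close>.\<close>

lemma candidates:
  assumes B: "packed p B"
  shows "p = PA \<or> p = PC \<or> p = PD"
proof (rule corner_packed_one_mark[OF B], rule ccontr)
  fix \<delta> :: real
  assume wall: "p $ 1 = a \<Longrightarrow> \<delta> = 0 \<and> h < p $ 2 \<or> \<delta> = 1 \<and> p $ 2 < h" and p: "p \<in> Q"
    and mid: "\<And>q1 q2. q1 \<in> Q \<Longrightarrow> q2 \<in> Q \<Longrightarrow> q1 \<noteq> q2 \<Longrightarrow> q1 $ 1 + q2 $ 1 = 2 * p $ 1 \<Longrightarrow>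
      q1 $ 2 - \<delta> * max 0 (q1 $ 1 - a) + (q2 $ 2 - \<delta> * max 0 (q2 $ 1 - a)) \<noteq> 2 * (p $ 2 - \<delta> * max 0 (p $ 1 - a))"
    and off: "\<And>w. convex Q \<Longrightarrow> p + w \<in> Q \<Longrightarrow> p - w \<in> Q \<Longrightarrow> w \<noteq> 0 \<Longrightarrow> p $ 1 = a \<and> w $ 1 \<noteq> 0 \<and> \<delta> \<noteq> 0"
    and nv: "\<not> (p = PA \<or> p = PC \<or> p = PD)"
  define x y where "x = p $ 1" and "y = p $ 2"
  define k where "k = (N - 2) * x + a + b - (N - 1) * y"
  have xy: "0 \<le> y" "x - a \<le> y" "y \<le> x" "0 \<le> k"
    using p by (auto simp: Q_def K_def x_def y_def k_def)
  have nv': "\<not> (x = 0 \<and> y = 0)" "\<not> (x = a + b \<and> y = a + b)" "\<not> (x = N * a + b \<and> y = (N - 1) * a + b)"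
    using nv by (auto simp: PA_def PC_def PD_def x_def y_def vec2_eq_iff)
  \<comment> \<open>On the right edge \<open>k\<close> is the horizontal distance to
    \<open>PD\<close>, on the diagonal it is the horizontal distance to \<open>PC\<close>.\<close>
  have kx: "k = N * a + b - x - (N - 1) * (y - x + a)" "k = a + b - x + (N - 1) * (x - y)"
    by (simp_all add: k_def algebra_simps)
  have K: "K (pt (x + d1) (y + d2)) = k + (N - 2) * d1 - (N - 1) * d2"
    "K (pt (x - d1) (y - d2)) = k - (N - 2) * d1 + (N - 1) * d2" for d1 d2
    by (simp_all add: K_def k_def algebra_simps)
  have move: "x = a \<and> d1 \<noteq> 0 \<and> \<delta> \<noteq> 0"
    if "d1 \<noteq> 0 \<or> d2 \<noteq> 0" "\<bar>(N - 2) * d1 - (N - 1) * d2\<bar> \<le> k" "\<bar>d2\<bar> \<le> y" "\<bar>d2 - d1\<bar> \<le> y - x + a" "\<bar>d1 - d2\<bar> \<le> x - y" for d1 d2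
  proof -
    have "p + pt d1 d2 = pt (x + d1) (y + d2)" "p - pt d1 d2 = pt (x - d1) (y - d2)"
      by (simp_all add: vec2_eq_iff x_def y_def)
    moreover have "pt (x + d1) (y + d2) \<in> Q" "pt (x - d1) (y - d2) \<in> Q"
      unfolding Q_def mem_Collect_eq K using that by auto
    ultimately have "p + pt d1 d2 \<in> Q" "p - pt d1 d2 \<in> Q"
      by simp_all
    then show ?thesis
      using off[OF convex_Q, of "pt d1 d2"] that(1) by (auto simp: vec2_eq_iff x_def)
  qed
  consider "k = 0" "0 < y" "x - a < y" "y < x" | "y = x" "0 < y" "0 < k"
    | "y = 0" "0 < x" "x < a" | "y = 0" "x = a" | "y = x - a" "0 < y" "x < N * a + b"
    | "0 < k" "0 < y" "x - a < y" "y < x"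
  proof -
    have 1: "y = x \<Longrightarrow> 0 < k \<and> 0 < y"
      using kx(2) xy nv' by auto
    have 2: "y = x - a \<Longrightarrow> x < N * a + b"
      using kx(1) xy nv' by (auto simp: algebra_simps)
    consider (i) "y = x" | (ii) "y < x" "y = x - a" | (iii) "y < x" "x - a < y"
      using xy by linarith
    then show ?thesis
    proof cases
      case i
      then show ?thesis using that(2) 1 by blast
    next
      case ii
      then show ?thesis using that(4,5) 2 xy(1) by (cases "y = 0") auto
    next
      case iii
      show ?thesis
      proof (cases "y = 0")
        case True
        then show ?thesis using that(3) iii by simp
      next
        case False
        then show ?thesis using that(1,6) iii xy(1,4) by (cases "k = 0") auto
      qed
    qed
  qed
  then show False
  proof cases
    case 1
    \<comment> \<open>The step goes along the edge from \<open>PC\<close> to \<open>PD\<close>;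
      dividing by N + 1 compensates for the size of its direction vector.\<close>
    define e where "e = min y (min (y - x + a) (x - y)) / (N + 1)"
    have e: "0 < e" "e * (N + 1) \<le> y" "e * (N + 1) \<le> y - x + a" "e * (N + 1) \<le> x - y"
      using 1 by (auto simp: e_def)
    have le: "e * \<bar>N - 2\<bar> \<le> e * (N + 1)" "e * 1 \<le> e * (N + 1)"
      using e(1) n by (intro mult_left_mono; simp)+
    have "x = a \<and> e * (N - 1) \<noteq> 0 \<and> \<delta> \<noteq> 0"
    proof (rule move[of "e * (N - 1)" "e * (N - 2)"])
      show "e * (N - 1) \<noteq> 0 \<or> e * (N - 2) \<noteq> 0"
        using e(1) by auto
      have "(N - 2) * (e * (N - 1)) - (N - 1) * (e * (N - 2)) = 0"
        by simp
      then show "\<bar>(N - 2) * (e * (N - 1)) - (N - 1) * (e * (N - 2))\<bar> \<le> k"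
        using 1 by simp
      show "\<bar>e * (N - 2)\<bar> \<le> y"
        unfolding abs_mult abs_of_pos[OF e(1)] using e(2) le(1) by linarith
      have ee: "e \<le> y - x + a" "e \<le> x - y"
        using e le(2) by linarith+
      have "e * (N - 2) - e * (N - 1) = - e"
        by (simp add: algebra_simps)
      then show "\<bar>e * (N - 2) - e * (N - 1)\<bar> \<le> y - x + a" "\<bar>e * (N - 1) - e * (N - 2)\<bar> \<le> x - y"
        using e(1) ee by (simp_all add: abs_minus_commute)
    qed
    then have x: "x = a" and \<delta>: "\<delta> \<noteq> 0" and N1: "N - 1 > 0"
      using n by auto
    \<comment> \<open>Where the edge crosses the wall it lies above the mark, by \<open>hn\<close>,
      so a bent chart has its cut there.\<close>
    have "(N - 1) * y = (N - 1) * a + b"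
      using 1(1) x by (simp add: k_def algebra_simps)
    then have "h < y"
      using hn N1 by (metis mult_less_cancel_left_pos)
    then show False
      using wall x \<delta> by (auto simp: x_def y_def)
  next
    case 2
    define e where "e = min y k"
    have e: "0 < e" "e \<le> y" "e \<le> k" using 2 by (auto simp: e_def)
    moreover have "(N - 2) * e - (N - 1) * e = - e"
      by (simp add: algebra_simps)
    ultimately have "x = a" "\<delta> \<noteq> 0"
      using move[of e e] 2 a by auto
    then show False
      using wall 2 h by (auto simp: x_def y_def)
  next
    case 3
    have "0 < k"
    proof (cases "n = 1")
      case True
      then show ?thesis using 3 n1 by (simp add: k_def)
    next
      case False
      then have "0 \<le> (N - 2) * x" using 3 n by simp
      then show ?thesis using 3 ab by (simp add: k_def)
    qed
    define e where "e = min (k / (N + 1)) (min x (a - x))"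
    have e: "0 < e" "e \<le> k / (N + 1)" "e \<le> x" "e \<le> a - x"
      using \<open>0 < k\<close> 3 unfolding e_def by simp_all
    have ek: "e * (N + 1) \<le> k"
      using e(2) by (subst (asm) pos_le_divide_eq) simp_all
    have "\<bar>N - 2\<bar> * e \<le> (N + 1) * e"
      using e(1) n by (intro mult_right_mono) auto
    then have "\<bar>(N - 2) * e\<bar> \<le> k"
      unfolding abs_mult abs_of_pos[OF e(1)] using ek by (simp add: mult.commute)
    then show False
      using move[of e 0] e 3 by auto
  next
    case 4
    then have "\<delta> = 1" using wall h by (auto simp: x_def y_def)
    \<comment> \<open>In the chart with sign 1 the point (a + e, e) drops to (a + e, 0), so (a,0)
      lies inside the bottom edge. The second bound keeps both end points on the right side of K =
      0.\<close>
    define e where "e = min a (((N - 1) * a + b) / N)"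
    have e: "0 < e" "e \<le> a" "e \<le> ((N - 1) * a + b) / N"
      using nab a n unfolding e_def by simp_all
    have eN: "e * N \<le> (N - 1) * a + b"
      using e(3) n by (subst (asm) pos_le_divide_eq) simp_all
    have "e * 1 \<le> e * N" "(N - 2) * e \<le> N * e"
      using e(1) n by (intro mult_left_mono mult_right_mono; simp)+
    then have le: "e \<le> (N - 1) * a + b" "(N - 2) * e \<le> (N - 1) * a + b"
      using eN by (simp_all only: mult.commute[of N e] mult_1_right)
    have "K (pt (a - e) 0) = (N - 1) * a + b - (N - 2) * e" "K (pt (a + e) e) = (N - 1) * a + b - e"
      by (simp_all add: K_def algebra_simps)
    then have "pt (a - e) 0 \<in> Q" "pt (a + e) e \<in> Q"
      using e le by (auto simp: Q_def)
    then show False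
      using mid[of "pt (a - e) 0" "pt (a + e) e"] e 4 \<open>\<delta> = 1\<close> by (auto simp: x_def y_def)
  next
    case 5
    define e where "e = min y k"
    have "k = N * a + b - x" using 5 kx(1) by simp
    then have e: "0 < e" "e \<le> y" "e \<le> k" using 5 by (auto simp: e_def)
    moreover have "(N - 2) * e - (N - 1) * e = - e"
      by (simp add: algebra_simps)
    ultimately show False
      using move[of e e] 5 a by auto
  next
    case 6
    define e where "e = min (k / N) (min y (min (y - x + a) (x - y)))"
    have e: "0 < e" "e \<le> k / N" "e \<le> y" "e \<le> y - x + a" "e \<le> x - y"
      using 6 n by (auto simp: e_def)
    have "(N - 1) * e \<le> N * e" using e(1) by (intro mult_right_mono) auto
    also have "\<dots> \<le> k" using e(2) n by (simp add: field_simps)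
    finally have "\<bar>(N - 1) * e\<bar> \<le> k" using e(1) n by simp
    then show False
      using move[of 0 e] e by auto
  qed
qed

section \<open>Linear constraints on the sizes of disjoint packed triangles\<close>

definition packedA :: "real \<Rightarrow> (real^2) set \<Rightarrow> bool" where
  "packedA l B \<longleftrightarrow> (\<exists>\<delta>. (\<delta> = 0 \<or> \<delta> = 1) \<and> B = bent_tri a \<delta> PA uA vA l)"

definition packedC :: "real \<Rightarrow> (real^2) set \<Rightarrow> bool" where
  "packedC l B \<longleftrightarrow> (\<exists>\<delta>. (\<delta> = 0 \<or> \<delta> = 1) \<and> B = bent_tri a \<delta> PC uC vC l)"

definition packedD :: "real \<Rightarrow> (real^2) set \<Rightarrow> bool" where
  "packedD l B \<longleftrightarrow> (\<exists>\<delta>. (\<delta> = 0 \<or> \<delta> = 1) \<and> B = bent_tri a \<delta> PD uD uC l)"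

lemma cross2_dirs: "cross2 uA vA = 1" "cross2 uC vC = 1" "cross2 uD uC = 1"
  by (simp_all add: cross2_def uC_def vC_def uD_def)

text \<open>Neighbourhoods of \<open>PA\<close>, \<open>PC\<close> and \<open>PD\<close>: the two
  edges not incident to the corner are kept strictly away, so only the cone at the corner
  remains.\<close>

lemma open_K: "open {z. 0 < K z \<and> z $ 1 - a < z $ 2}" "open {z::real^2. 0 < z $ 2 \<and> z $ 1 - a < z $ 2}"
    "open {z::real^2. 0 < z $ 2 \<and> z $ 2 < z $ 1}"
  unfolding K_def by (intro open_Collect_conj open_Collect_less continuous_intros)+

definition packed3 :: "real^2 \<Rightarrow> real \<Rightarrow> (real^2) set \<Rightarrow> bool" where
  "packed3 p l B \<longleftrightarrow> B \<subseteq> Q \<and> pt a h \<notin> B \<and> (p = PA \<longrightarrow> packedA l B) \<and> (p = PC \<longrightarrow> packedC l B) \<and> (p = PD \<longrightarrow> packedD l B)"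

lemma distinct_corners: "PA \<noteq> PC" "PA \<noteq> PD" "PC \<noteq> PD"
proof -
  show "PA \<noteq> PC" using ab by (simp add: PA_def PC_def)
  show "PA \<noteq> PD" using nab by (simp add: PA_def PD_def)
  show "PC \<noteq> PD" using a by (auto simp: PC_def PD_def algebra_simps)
qed

lemma packed3_of_corner:
  assumes B: "packed p B"
  shows "\<exists>p\<in>{PA, PC, PD}. p \<in> B \<and> (\<exists>l>0. B \<in> lmeasurable \<and> measure lebesgue B = l^2 / 2 \<and> packed3 p l B)"
proof -
  from candidates[OF B] consider "p = PA" | "p = PC" | "p = PD" by blast
  then show ?thesis
  proof cases
    case 1
    show ?thesis
    proof (rule bent_tri_of_corner_packed[OF B _ cross2_dirs(1) _ _ open_K(1)])
      fix \<delta> l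
      assume l: "\<delta> = 0 \<or> \<delta> = 1" "l > 0" "B = bent_tri a \<delta> p uA vA l" "B \<subseteq> Q" "pt a h \<notin> B"
        "p \<in> B" "B \<in> lmeasurable" "measure lebesgue B = l^2 / 2"
      then have "packed3 p l B"
        unfolding packed3_def packedA_def 1 using distinct_corners by auto
      then show ?thesis using l 1 by blast
    next
    qed (use 1 a ab in \<open>auto simp: PA_def K_def Q_def cross2_def intro!: Ints_pt\<close>)
  next
    case 2
    show ?thesis
    proof (rule bent_tri_of_corner_packed[OF B _ cross2_dirs(2) _ _ open_K(2)])
      fix \<delta> l
      assume l: "\<delta> = 0 \<or> \<delta> = 1" "l > 0" "B = bent_tri a \<delta> p uC vC l" "B \<subseteq> Q" "pt a h \<notin> B"
        "p \<in> B" "B \<in> lmeasurable" "measure lebesgue B = l^2 / 2"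
      then have "packed3 p l B"
        unfolding packed3_def packedC_def 2 using distinct_corners by auto
      then show ?thesis using l 2 by blast
    next
      show "uC $ i \<in> \<int>" "vC $ i \<in> \<int>" for i
        by (auto simp: uC_def vC_def intro!: Ints_pt)
      show "z \<in> Q \<longleftrightarrow> cross2 (z - p) vC \<ge> 0 \<and> cross2 uC (z - p) \<ge> 0"
        if "z \<in> {z. 0 < z $ 2 \<and> z $ 1 - a < z $ 2}" for z
      proof -
        have "cross2 (z - p) vC = K z" "cross2 uC (z - p) = z $ 1 - z $ 2"
          by (simp_all add: 2 cross2_def PC_def vC_def uC_def uD_def K_def algebra_simps)
        then show ?thesis using that by (auto simp: Q_def)
      qed
    qed (use 2 a ab h in \<open>auto simp: PC_def\<close>)
  next
    case 3
    show ?thesis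
    proof (rule bent_tri_of_corner_packed[OF B _ cross2_dirs(3) _ _ open_K(3)])
      fix \<delta> l
      assume l: "\<delta> = 0 \<or> \<delta> = 1" "l > 0" "B = bent_tri a \<delta> p uD uC l" "B \<subseteq> Q" "pt a h \<notin> B"
        "p \<in> B" "B \<in> lmeasurable" "measure lebesgue B = l^2 / 2"
      then have "packed3 p l B"
        unfolding packed3_def packedD_def 3 using distinct_corners by auto
      then show ?thesis using l 3 by blast
    next
      show "uD $ i \<in> \<int>" "uC $ i \<in> \<int>" for i
        by (auto simp: uC_def uD_def intro!: Ints_pt)
      show "z \<in> Q \<longleftrightarrow> cross2 (z - p) uC \<ge> 0 \<and> cross2 uD (z - p) \<ge> 0"
        if "z \<in> {z. 0 < z $ 2 \<and> z $ 2 < z $ 1}" for z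
      proof -
        have "cross2 (z - p) uC = z $ 2 - z $ 1 + a" "cross2 uD (z - p) = K z"
          by (simp_all add: 3 cross2_def PD_def vC_def uC_def uD_def K_def algebra_simps)
        then show ?thesis using that by (auto simp: Q_def)
      qed
    qed (use 3 a nab in \<open>auto simp: PD_def algebra_simps\<close>)
  qed
qed

lemma mem_bentA: "pt x y \<in> bent_tri a \<delta> PA uA vA l \<longleftrightarrow>
    (let w = y - \<delta> * max 0 (x - a) in 0 \<le> w \<and> w \<le> x \<and> x < l)"
  using a unfolding bent_tri_def mem_Collect_eq triA by (simp add: PA_def Let_def)

lemma mem_bentC: "pt x y \<in> bent_tri a \<delta> PC uC vC l \<longleftrightarrow>
    (let w = y - \<delta> * (if 0 < b then max 0 (a - x) else max 0 (x - a))
     in 0 \<le> K (pt x w) \<and> w \<le> x \<and> K (pt x w) + x - w < l)"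
  unfolding bent_tri_def mem_Collect_eq triC by (simp add: PC_def Let_def vsh_def)

lemma mem_bentD: "pt x y \<in> bent_tri a \<delta> PD uD uC l \<longleftrightarrow>
    (let w = y - \<delta> * max 0 (a - x) in x - a \<le> w \<and> 0 \<le> K (pt x w) \<and> w - x + a + K (pt x w) < l)"
proof -
  have "a < N * a + b" using nab by (simp add: algebra_simps)
  then show ?thesis
    unfolding bent_tri_def mem_Collect_eq triD by (simp add: PD_def Let_def vsh_def)
qed

text \<open>Beyond the wall a bent triangle is raised, so its side along the diagonal would leave
  \<open>Q\<close>. The lemmas \<open>edgeC\<close>, \<open>edgeC'\<close> and \<open>edgeD\<close>
  use the same mechanism: the displacement is nonnegative, and the upper boundary of
  \<open>Q\<close> forces it to be 0.\<close>

lemma edgeA: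
  assumes "packedA l B" "B \<subseteq> Q" "0 \<le> x" "x < l"
  shows "pt x x \<in> B"
proof -
  obtain \<delta> where \<delta>: "\<delta> = 0 \<or> \<delta> = 1" "B = bent_tri a \<delta> PA uA vA l"
    using assms(1) unfolding packedA_def by blast
  have "pt x (x + \<delta> * max 0 (x - a)) \<in> B"
    unfolding \<delta>(2) mem_bentA using assms by simp
  moreover from this have "\<delta> * max 0 (x - a) = 0"
    using \<delta>(1) assms(2) by (auto simp: Q_def)
  ultimately show ?thesis by (metis add.right_neutral)
qed

text \<open>Beyond the wall the vertical slice of \<open>Q\<close> is contained in the strip between
  y = x - a and y = x, of length \<open>a\<close>. A longer slice of the triangle leaves it at the
  bottom for \<delta> = 0 and at the top for \<delta> = 1. The second bound is the lattice length of
  the edge to \<open>PC\<close>.\<close>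

lemma boundA:
  assumes "packedA l B" "B \<subseteq> Q"
  shows "l \<le> a" "l \<le> a + b"
proof -
  obtain \<delta> where \<delta>: "\<delta> = 0 \<or> \<delta> = 1" "B = bent_tri a \<delta> PA uA vA l"
    using assms(1) unfolding packedA_def by blast
  show "l \<le> a"
  proof (rule ccontr)
    assume "\<not> l \<le> a"
    then obtain x where x: "a < x" "x < l" by (meson dense not_le)
    have "pt x (x + \<delta> * max 0 (x - a)) \<in> B" "pt x (\<delta> * max 0 (x - a)) \<in> B"
      unfolding \<delta>(2) mem_bentA using x a by simp_all
    then show False
      using \<delta>(1) assms(2) x by (auto simp: Q_def)
  qed
  show "l \<le> a + b"
  proof (rule ccontr)
    assume "\<not> l \<le> a + b"
    then obtain x where x: "a + b < x" "x < l" by (meson dense not_le)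
    have "pt x x \<in> Q"
      using edgeA[OF assms, of x] x ab assms(2) by auto
    then show False
      using x by (simp add: Q_def K_def algebra_simps)
  qed
qed

lemma bottomA:
  assumes "packedA l B" "B \<subseteq> Q" "0 \<le> x" "x < l"
  shows "pt x 0 \<in> B"
proof -
  have "x \<le> a" using boundA(1)[OF assms(1,2)] assms(4) by simp
  then show ?thesis
    using assms unfolding packedA_def by (auto simp: mem_bentA)
qed

lemma edgeC:
  assumes "packedC l B" "B \<subseteq> Q" "0 \<le> t" "t < l"
  shows "pt (a + b - t) (a + b - t) \<in> B"
proof -
  obtain \<delta> where \<delta>: "\<delta> = 0 \<or> \<delta> = 1" "B = bent_tri a \<delta> PC uC vC l"
    using assms(1) unfolding packedC_def by blast
  define e where "e = \<delta> * (if 0 < b then max 0 (a - (a + b - t)) else max 0 (a + b - t - a))"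
  have "e \<ge> 0" using \<delta>(1) by (auto simp: e_def)
  have "K (pt (a + b - t) (a + b - t)) = t"
    by (simp add: K_def algebra_simps)
  then have "pt (a + b - t) (a + b - t + e) \<in> B"
    unfolding \<delta>(2) mem_bentC e_def using assms by (simp add: Let_def)
  moreover from this have "e = 0"
    using \<open>e \<ge> 0\<close> assms(2) by (auto simp: Q_def)
  ultimately show ?thesis by (metis add.right_neutral)
qed

lemma edgeC':
  assumes "packedC l B" "B \<subseteq> Q" "0 \<le> t" "t < l"
  shows "pt (a + b + t * (N - 1)) (a + b + t * (N - 2)) \<in> B"
proof -
  obtain \<delta> where \<delta>: "\<delta> = 0 \<or> \<delta> = 1" "B = bent_tri a \<delta> PC uC vC l"
    using assms(1) unfolding packedC_def by blast
  define x y where "x = a + b + t * (N - 1)" and "y = a + b + t * (N - 2)"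
  define e where "e = \<delta> * (if 0 < b then max 0 (a - x) else max 0 (x - a))"
  have "e \<ge> 0" using \<delta>(1) by (auto simp: e_def)
  have K: "K (pt x y) = 0" "K (pt x (y + e)) = - (N - 1) * e" and xy: "x - y = t"
    by (simp_all add: K_def x_def y_def algebra_simps)
  have B: "pt x (y + e) \<in> B"
    unfolding \<delta>(2) mem_bentC e_def using assms K(1) xy by (simp add: Let_def)
  \<comment> \<open>For \<open>n = 1\<close> the condition K >= 0 does not see vertical
    displacements, but then the edge is vertical at x = a + b, on the corner's side of the wall, and
    is not bent.\<close>
  have "e = 0"
  proof (cases "n = 1")
    case True
    then show ?thesis using n1 by (simp add: e_def x_def)
  next
    case False
    have "0 \<le> - (N - 1) * e"
      using B assms(2) K(2) by (auto simp: Q_def)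
    then show ?thesis
      using False n \<open>e \<ge> 0\<close> by (auto simp: zero_le_mult_iff)
  qed
  with B show ?thesis by (simp add: x_def y_def)
qed

text \<open>The edges of \<open>Q\<close> at \<open>PC\<close> have lattice lengths \<open>a\<close>
  and \<open>a + b\<close>, and the triangle runs along both.\<close>

lemma boundC:
  assumes "packedC l B" "B \<subseteq> Q"
  shows "l \<le> a" "l \<le> a + b"
proof -
  show "l \<le> a"
  proof (rule ccontr)
    assume "\<not> l \<le> a"
    then obtain t where t: "a < t" "t < l" by (meson dense not_le)
    have "pt (a + b + t * (N - 1)) (a + b + t * (N - 2)) \<in> Q"
      using edgeC'[OF assms, of t] t a assms(2) by auto
    then show False
      using t by (simp add: Q_def algebra_simps)
  qed
  show "l \<le> a + b"
  proof (rule ccontr)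
    assume "\<not> l \<le> a + b"
    then obtain t where t: "a + b < t" "t < l" by (meson dense not_le)
    have "pt (a + b - t) (a + b - t) \<in> Q"
      using edgeC[OF assms, of t] t ab assms(2) by auto
    then show False
      using t by (simp add: Q_def)
  qed
qed

lemma edgeD:
  assumes "packedD l B" "B \<subseteq> Q" "0 \<le> s" "s < l"
  shows "pt (N * a + b - s * (N - 1)) ((N - 1) * a + b - s * (N - 2)) \<in> B"
proof -
  obtain \<delta> where \<delta>: "\<delta> = 0 \<or> \<delta> = 1" "B = bent_tri a \<delta> PD uD uC l"
    using assms(1) unfolding packedD_def by blast
  define x y where "x = N * a + b - s * (N - 1)" and "y = (N - 1) * a + b - s * (N - 2)"
  define e where "e = \<delta> * max 0 (a - x)"
  have "e \<ge> 0" using \<delta>(1) by (auto simp: e_def)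
  have K: "K (pt x y) = 0" "K (pt x (y + e)) = - (N - 1) * e" and xy: "y - x + a = s"
    by (simp_all add: K_def x_def y_def algebra_simps)
  have B: "pt x (y + e) \<in> B"
    unfolding \<delta>(2) mem_bentD e_def using assms K(1) xy by (simp add: Let_def)
  have "e = 0"
  proof (cases "n = 1")
    case True
    then show ?thesis using n1 by (simp add: e_def x_def)
  next
    case False
    have "0 \<le> - (N - 1) * e"
      using B assms(2) K(2) by (auto simp: Q_def)
    then show ?thesis
      using False n \<open>e \<ge> 0\<close> by (auto simp: zero_le_mult_iff)
  qed
  with B show ?thesis by (simp add: x_def y_def)
qed

text \<open>Beyond the wall the straight side would go below y = 0, so a triangle larger than
  \<open>b\<close> must be the one with \<delta> = 1. In either case its lower side follows the
  lower boundary of \<open>Q\<close>.\<close>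

lemma bottomD:
  assumes "n = 1" "packedD l B" "B \<subseteq> Q" "0 \<le> t" "t < l"
  shows "pt (a + b - t) (max 0 (b - t)) \<in> B"
proof -
  obtain \<delta> where \<delta>: "\<delta> = 0 \<or> \<delta> = 1" "B = bent_tri a \<delta> PD uD uC l"
    using assms(2) unfolding packedD_def by blast
  have K1: "K z = a + b - z $ 1" for z
    unfolding K_def using assms(1) by simp
  have "pt (a + b - t) (b - t + \<delta> * max 0 (t - b)) \<in> B"
    unfolding \<delta>(2) mem_bentD K1 using assms(4,5) by (simp add: Let_def)
  moreover from this have "b - t + \<delta> * max 0 (t - b) = max 0 (b - t)"
    using \<delta>(1) assms(3) by (auto simp: Q_def max_def)
  ultimately show ?thesis by simp
qed

lemma boundD:
  assumes "packedD l B" "B \<subseteq> Q"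
  shows "l \<le> a" "n = 1 \<Longrightarrow> l \<le> a + b"
proof -
  show "l \<le> a"
  proof (rule ccontr)
    assume "\<not> l \<le> a"
    then obtain s where s: "a < s" "s < l" by (meson dense not_le)
    have "pt (N * a + b - s * (N - 1)) ((N - 1) * a + b - s * (N - 2)) \<in> Q"
      using edgeD[OF assms, of s] s a assms(2) by auto
    then show False
      using s by (simp add: Q_def algebra_simps)
  qed
  assume "n = 1"
  then show "l \<le> a + b"
    using \<open>l \<le> a\<close> n1 by simp
qed

text \<open>The bound is h + K (pt a h), the size at which the triangle reaches the mark; points of
  the wall itself are not displaced.\<close>

lemma markD:
  assumes "packedD l B" "pt a h \<notin> B"
  shows "l \<le> (N - 1) * a + b - (N - 2) * h"
proof (rule ccontr)
  assume l: "\<not> l \<le> (N - 1) * a + b - (N - 2) * h"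
  have "K (pt a h) = (N - 1) * a + b - (N - 1) * h"
    by (simp add: K_def algebra_simps)
  then have "pt a h \<in> B"
    using assms(1) l h hn unfolding packedD_def by (auto simp: mem_bentD Let_def algebra_simps)
  with assms(2) show False by simp
qed

text \<open>The sizes \<open>x\<close>, \<open>y\<close>, \<open>z\<close> of disjoint triangles at \<open>PA\<close>, \<open>PC\<close>, \<open>PD\<close>; a missing triangle has size 0.\<close>

definition sizes :: "real \<Rightarrow> real \<Rightarrow> real \<Rightarrow> bool" where
  "sizes x y z \<longleftrightarrow> 0 \<le> x \<and> 0 \<le> y \<and> 0 \<le> z \<and> x \<le> a \<and> x + y \<le> a + b \<and> y + z \<le> a \<and>
     z \<le> (N - 1) * a + b - (N - 2) * h \<and> (n = 1 \<longrightarrow> x + z \<le> a + b)"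

lemma mark_pos: "0 < (N - 1) * a + b - (N - 2) * h"
  using hn h by (simp add: algebra_simps)

lemma upper:
  assumes "disjoint \<B>" "\<And>B. B \<in> \<B> \<Longrightarrow> \<exists>p. packed p B"
  shows "\<exists>x y z. sizes x y z \<and> \<Union>\<B> \<in> lmeasurable \<and> measure lebesgue (\<Union>\<B>) = (x^2 + y^2 + z^2) / 2"
proof (rule disjoint_packing_measure[of "{PA, PC, PD}" \<B> packed3])
  show "\<exists>p\<in>{PA, PC, PD}. p \<in> B \<and> (\<exists>l>0. B \<in> lmeasurable \<and> measure lebesgue B = l^2 / 2 \<and> packed3 p l B)"
    if "B \<in> \<B>" for B
    using assms(2)[OF that] packed3_of_corner by blast
  fix L F
  assume L: "\<And>p. p \<in> {PA, PC, PD} \<Longrightarrow> 0 \<le> L p" "\<And>p. p \<in> {PA, PC, PD} \<Longrightarrow> 0 < L p \<Longrightarrow> packed3 p (L p) (F p)"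
    and F: "\<And>p q. p \<in> {PA, PC, PD} \<Longrightarrow> q \<in> {PA, PC, PD} \<Longrightarrow> p \<noteq> q \<Longrightarrow> 0 < L p \<Longrightarrow> 0 < L q \<Longrightarrow> F p \<inter> F q = {}"
    and U: "\<Union>\<B> \<in> lmeasurable" "measure lebesgue (\<Union>\<B>) = (\<Sum>p\<in>{PA, PC, PD}. (L p)^2 / 2)"
  define x y z where "x = L PA" and "y = L PC" and "z = L PD"
  have nonneg: "0 \<le> x" "0 \<le> y" "0 \<le> z"
    using L(1) by (simp_all add: x_def y_def z_def)
  have A: "packedA x (F PA)" "F PA \<subseteq> Q" if "0 < x"
    using L(2)[of PA] that by (simp_all add: packed3_def x_def)
  have C: "packedC y (F PC)" "F PC \<subseteq> Q" if "0 < y"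
    using L(2)[of PC] that by (simp_all add: packed3_def y_def)
  have D: "packedD z (F PD)" "F PD \<subseteq> Q" "pt a h \<notin> F PD" if "0 < z"
    using L(2)[of PD] that by (simp_all add: packed3_def z_def)
  have Ale: "x \<le> a" "x \<le> a + b"
    using boundA[OF A] nonneg a ab by (cases "0 < x"; force)+
  have Cle: "y \<le> a" "y \<le> a + b"
    using boundC[OF C] nonneg a ab by (cases "0 < y"; force)+
  have Dle: "z \<le> a" "n = 1 \<Longrightarrow> z \<le> a + b" "z \<le> (N - 1) * a + b - (N - 2) * h"
    using boundD[OF D(1,2)] markD[OF D(1,3)] nonneg a ab mark_pos by (cases "0 < z"; force)+
  have "x + y \<le> a + b"
  proof (rule ccontr)
    assume c: "\<not> x + y \<le> a + b"
    then have pos: "0 < x" "0 < y" using Ale Cle by linarith+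
    obtain t where t: "max 0 (a + b - y) < t" "t < min x (a + b)"
      using dense[of "max 0 (a + b - y)" "min x (a + b)"] c pos ab by auto
    have "pt t t \<in> F PA"
      using edgeA[OF A[OF pos(1)], of t] t by simp
    moreover have "pt t t \<in> F PC"
      using edgeC[OF C[OF pos(2)], of "a + b - t"] t by simp
    ultimately show False
      using F[of PA PC] distinct_corners pos x_def y_def by blast
  qed
  moreover have "y + z \<le> a"
  proof (rule ccontr)
    assume c: "\<not> y + z \<le> a"
    then have pos: "0 < y" "0 < z" using Dle Cle by linarith+
    obtain t where t: "max 0 (a - z) < t" "t < min y a"
      using dense[of "max 0 (a - z)" "min y a"] c pos a by auto
    define q where "q = pt (a + b + t * (N - 1)) (a + b + t * (N - 2))"
    have "q \<in> F PC"
      using edgeC'[OF C[OF pos(1)], of t] t by (simp add: q_def)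
    moreover have "q \<in> F PD"
      using edgeD[OF D(1)[OF pos(2)] D(2)[OF pos(2)], of "a - t"] t by (simp add: q_def algebra_simps)
    ultimately show False
      using F[of PC PD] distinct_corners pos y_def z_def by blast
  qed
  \<comment> \<open>The lower boundary from \<open>PA\<close> through (a,0) to \<open>PD\<close> is
    straight in the chart with sign 1 and has lattice length n a + b - (n - 1) a = a + b along the
    pieces covered when n = 1. For n >= 2 the bound n a + b on the horizontal extent already follows
    from x \<le> a + b and z \<le> a.\<close>
  moreover have "x + z \<le> a + b" if "n = 1"
  proof (rule ccontr)
    assume c: "\<not> x + z \<le> a + b"
    then have pos: "0 < x" "0 < z" using Ale Dle(2)[OF that] by linarith+
    obtain t where t: "max 0 (a + b - z) < t" "t < min x (a + b)"
      using dense[of "max 0 (a + b - z)" "min x (a + b)"] c pos ab by auto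
    have "pt t 0 \<in> F PA"
      using bottomA[OF A[OF pos(1)], of t] t by simp
    moreover have "pt t (max 0 (t - a)) \<in> F PD"
      using bottomD[OF that D(1)[OF pos(2)] D(2)[OF pos(2)], of "a + b - t"] t by simp
    ultimately show False
      using F[of PA PD] distinct_corners pos x_def z_def t Ale by (auto simp: max_def)
  qed
  ultimately have "sizes x y z"
    using nonneg Ale Dle by (simp add: sizes_def)
  moreover have "measure lebesgue (\<Union>\<B>) = (x^2 + y^2 + z^2) / 2"
    unfolding U(2) using distinct_corners by (simp add: x_def y_def z_def add_divide_distrib)
  ultimately show ?thesis
    using U(1) by blast
qed (use assms in auto)

section \<open>Straight triangles in the base chart and the packings they form\<close>

lemma Q_right: "z \<in> Q \<Longrightarrow> z $ 1 = N * a + b - K z - (N - 1) * (z $ 2 - z $ 1 + a)"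
  by (simp add: K_def algebra_simps)

lemma K_eq: "K z = a + b - z $ 1 + (N - 1) * (z $ 1 - z $ 2)"
  by (simp add: K_def algebra_simps)

lemma one_le_N: "0 \<le> N - 1"
  using n by simp

lemma K_one: "n = 1 \<Longrightarrow> K z = a + b - z $ 1"
  unfolding K_eq by simp

lemma extreme_A: "chart_vertex [pt a h] [- 1] s k r Q PA"
proof (rule chart_extreme_sideways[of _ _ 1])
  show "PA \<in> Q" using a ab by (simp add: PA_def Q_def K_def)
  show "1 * PA $ 1 < 1 * z $ 1" if "z \<in> Q" "z \<noteq> PA" for z
    using that by (auto simp: PA_def Q_def vec2_eq_iff)
qed

lemma PD_Q: "PD \<in> Q"
proof -
  have "K PD = 0" by (simp add: K_def PD_def algebra_simps)
  then show ?thesis using nab a by (simp add: Q_def PD_def algebra_simps)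
qed

lemma PC_Q: "PC \<in> Q"
proof -
  have "K PC = 0" by (simp add: K_def PC_def algebra_simps)
  then show ?thesis using ab a by (simp add: Q_def PC_def algebra_simps)
qed

abbreviation "one_bend s \<equiv> bend [pt a h] (\<lambda>i. ([- 1] ! i - s ! i) div 2)"

lemma bend_one_mark:
  assumes "s \<in> sign_lists 1"
  shows "one_bend s = (\<lambda>x. 0) \<or>
    one_bend s = (\<lambda>x. - max 0 (x - a))"
  using sign_lists_nth[OF assms, of 0] by (auto simp: bend_def fun_eq_iff)

text \<open>For n >= 2 the corner is the unique rightmost point. For n = 1 the right edge is
  vertical; a functional of slope 2 exposes its lower end, since the lower boundary has slopes at
  most 1 in both charts.\<close>

lemma extreme_D:
  assumes "s \<in> sign_lists 1"
  shows "chart_vertex [pt a h] [- 1] s k r Q PD"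
proof (cases "n = 1")
  case True
  show ?thesis
  proof (rule chart_extreme_slope[OF PD_Q, of 1 _ _ _ 2])
    fix z assume z: "z \<in> Q" "z \<noteq> PD"
    have PD: "PD = pt (a + b) b" unfolding PD_def using True by simp
    have "z $ 1 \<le> a + b" "0 \<le> z $ 2" "z $ 1 - a \<le> z $ 2" "z $ 1 \<noteq> a + b \<or> z $ 2 \<noteq> b"
      using z K_one[OF True] by (auto simp: Q_def PD vec2_eq_iff)
    then show "1 * (PD $ 2 + one_bend s (PD $ 1) - 2 * PD $ 1)
      < 1 * (z $ 2 + one_bend s (z $ 1) - 2 * z $ 1)"
      using bend_one_mark[OF assms] n1[OF True] by (auto simp: PD max_def)
  qed
next
  case False
  show ?thesis
  proof (rule chart_extreme_sideways[OF PD_Q, of "- 1"])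
    fix z assume z: "z \<in> Q" "z \<noteq> PD"
    have pos: "0 \<le> K z" "0 \<le> z $ 2 - z $ 1 + a"
      using z by (simp_all add: Q_def)
    have N: "0 < N - 1" using False n by simp
    then have mono: "0 \<le> (N - 1) * (z $ 2 - z $ 1 + a)"
      using pos by simp
    have "z $ 1 \<noteq> N * a + b"
    proof
      assume x: "z $ 1 = N * a + b"
      then have "(N - 1) * (z $ 2 - z $ 1 + a) = 0"
        using Q_right[OF z(1)] pos mono by linarith
      then have "z $ 2 = z $ 1 - a" using N by simp
      then show False using x z(2) by (simp add: PD_def vec2_eq_iff algebra_simps)
    qed
    then show "- 1 * PD $ 1 < - 1 * z $ 1"
      using Q_right[OF z(1)] pos mono by (simp add: PD_def)
  qed
qed

lemma extreme_C:
  assumes "s \<in> sign_lists 1" "n = 1"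
  shows "chart_vertex [pt a h] [- 1] s k r Q PC"
proof (rule chart_extreme_slope[OF PC_Q, of "- 1" _ _ _ "- 2"])
  fix z assume z: "z \<in> Q" "z \<noteq> PC"
  have "z $ 1 \<le> a + b" "z $ 2 \<le> z $ 1" "z $ 1 \<noteq> a + b \<or> z $ 2 \<noteq> a + b"
    using z K_one[OF assms(2)] by (auto simp: Q_def PC_def vec2_eq_iff)
  then show "- 1 * (PC $ 2 + one_bend s (PC $ 1) - - 2 * PC $ 1)
    < - 1 * (z $ 2 + one_bend s (z $ 1) - - 2 * z $ 1)"
    using bend_one_mark[OF assms(1)] n1[OF assms(2)] by (auto simp: PC_def max_def)
qed

lemma dirs_real_vec:
  "uC = real_vec (vector [- 1, - 1])" "vC = real_vec (vector [int n - 1, int n - 2])"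
  "uD = real_vec (vector [1 - int n, 2 - int n])"
  by (simp_all add: real_vec_vector uC_def vC_def uD_def)

lemma packed_A:
  assumes "0 < l" "l \<le> a" "l \<le> a + b"
  shows "packed PA (tri PA uA vA l)"
proof (rule corner_packed_tri[of _ _ _ _ _ "vector [1, 0]" _ "vector [1, 1]"])
  have cone: "0 \<le> cross2 (z - PA) vA \<and> 0 \<le> cross2 uA (z - PA)" if "z \<in> Q" for z
    using that by (simp add: Q_def cross2_def PA_def)
  then show "\<And>z. z \<in> Q \<Longrightarrow> 0 \<le> cross2 (z - PA) vA \<and> 0 \<le> cross2 uA (z - PA)" .
  have *: "PA \<in> Q" "PA + a *\<^sub>R pt 1 0 \<in> Q" "PA + (a + b) *\<^sub>R pt 1 1 \<in> Q"
    using a ab nab by (simp_all add: Q_def K_def PA_def algebra_simps)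
  have E1: "cross2 (z - PA) vA \<le> a" if "z \<in> Q" for z
    using that by (simp add: Q_def cross2_def PA_def)
  have E2: "cross2 uA (z - PA) \<le> a + b" if "z \<in> Q" "cross2 (z - PA) vA = 0" for z
    using that by (simp add: Q_def cross2_def PA_def K_eq)
  have r: "pt 1 0 = real_vec (vector [1, 0])" "pt 1 1 = real_vec (vector [1, 1])"
    by (simp_all add: real_vec_vector)
  show "PA extreme_point_of Q" "delzant_condition Q PA"
    using delzant_corner_at[OF convex_Q r cross2_dirs(1) a ab * cone E1 E2] by blast+
  show "tri PA uA vA l \<subseteq> Q"
  proof
    fix z assume "z \<in> tri PA uA vA l"
    then have z: "0 \<le> z $ 2" "z $ 2 \<le> z $ 1" "z $ 1 < l" by (auto simp: triA)
    then have "0 \<le> (N - 1) * (z $ 1 - z $ 2)" using one_le_N by simp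
    then show "z \<in> Q" using z assms by (simp add: Q_def K_eq)
  qed
  show "set [pt a h] \<inter> tri PA uA vA l = {}"
    using assms by (simp add: triA)
qed (use assms a in \<open>auto simp: real_vec_vector cross2_def sign_lists_def PA_def\<close>)

lemma packed_D:
  assumes "0 < l" "l \<le> a" "l \<le> (N - 1) * a + b - (N - 2) * h" "n = 1 \<Longrightarrow> l \<le> b"
  shows "packed PD (tri PD uD uC l)"
proof (rule corner_packed_tri[of _ _ _ _ _ "vector [1 - int n, 2 - int n]" _ "vector [- 1, - 1]"])
  have cr: "cross2 (z - PD) uC = z $ 2 - z $ 1 + a" "cross2 uD (z - PD) = K z" for z
    by (simp_all add: cross2_def PD_def uD_def uC_def K_def algebra_simps)
  have cone: "0 \<le> cross2 (z - PD) uC \<and> 0 \<le> cross2 uD (z - PD)" if "z \<in> Q" for z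
    using that unfolding cr by (simp add: Q_def)
  then show "\<And>z. z \<in> Q \<Longrightarrow> 0 \<le> cross2 (z - PD) uC \<and> 0 \<le> cross2 uD (z - PD)" .
  have "PD + a *\<^sub>R uD = PC" "PD + ((N - 1) * a + b) *\<^sub>R uC = pt a 0"
    by (simp_all add: vec2_eq_iff PD_def uD_def uC_def PC_def algebra_simps)
  moreover have "pt a 0 \<in> Q"
    using a ab nab by (simp_all add: Q_def K_def PA_def algebra_simps)
  ultimately have *: "PD \<in> Q" "PD + a *\<^sub>R uD \<in> Q" "PD + ((N - 1) * a + b) *\<^sub>R uC \<in> Q"
    using PD_Q PC_Q by simp_all
  have E1: "cross2 (z - PD) uC \<le> a" if "z \<in> Q" for z
    using that unfolding cr by (simp add: Q_def)
  have E2: "cross2 uD (z - PD) \<le> (N - 1) * a + b" if "z \<in> Q" "cross2 (z - PD) uC = 0" for z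
  proof -
    have "z $ 2 - z $ 1 + a = 0" using that(2) unfolding cr .
    moreover from this have "z $ 1 = N * a + b - K z" using Q_right[OF that(1)] by simp
    ultimately show ?thesis using that(1) unfolding cr by (simp add: Q_def algebra_simps)
  qed
  show "PD extreme_point_of Q" "delzant_condition Q PD"
    using delzant_corner_at[OF convex_Q dirs_real_vec(3,1) cross2_dirs(3) a nab * cone E1 E2] by blast+
  show "tri PD uD uC l \<subseteq> Q"
  proof
    fix z assume "z \<in> tri PD uD uC l"
    then have z: "z $ 1 - a \<le> z $ 2" "0 \<le> K z" "z $ 2 - z $ 1 + a + K z < l" by (auto simp: triD)
    \<comment> \<open>The height in the coordinates of the triangle. The sign of the coefficient N -
      2 decides where it is smallest, hence the three cases.\<close>
    have y: "z $ 2 = (N - 1) * a + b - (N - 2) * (z $ 2 - z $ 1 + a) - K z"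
      by (simp add: K_def algebra_simps)
    consider "n = 1" | "n = 2" | "n \<ge> 3" using n by linarith
    then have "0 \<le> z $ 2"
    proof cases
      case 1
      have "z $ 2 = b + (z $ 2 - z $ 1 + a) - K z" using y 1 by simp
      then show ?thesis using z assms(4)[OF 1] by linarith
    next
      case 2
      have "z $ 2 = a + b - K z" using y 2 by simp
      moreover have "l \<le> a + b" using assms(3) 2 by simp
      ultimately show ?thesis using z by linarith
    next
      case 3
      have "1 * K z \<le> (N - 2) * K z"
        using z(2) 3 by (intro mult_right_mono) auto
      moreover have "(N - 2) * (z $ 2 - z $ 1 + a + K z) \<le> (N - 2) * a"
        using z assms(2) 3 by (intro mult_left_mono) auto
      ultimately show ?thesis using y ab by (simp add: algebra_simps)
    qed
    then show "z \<in> Q" using z assms(2) by (simp add: Q_def)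
  qed
  have "K (pt a h) = (N - 1) * a + b - (N - 1) * h"
    by (simp add: K_def algebra_simps)
  then show "set [pt a h] \<inter> tri PD uD uC l = {}"
    using assms(3) by (simp add: triD algebra_simps)
  show "of_int ([- 1] ! i) * (PD $ 2 - [pt a h] ! i $ 2) < 0" if "i < length [pt a h]" "[pt a h] ! i $ 1 = PD $ 1" for i
    using that nab by (simp add: PD_def algebra_simps)
qed (use assms dirs_real_vec cross2_dirs in \<open>auto simp: sign_lists_def\<close>)

text \<open>With l \<le> b the triangle lies strictly to the right of the wall, so it avoids the
  mark; with l \<le> a it stays above the lower right edge.\<close>

lemma packed_C:
  assumes "n = 1" "0 < l" "l \<le> a" "l \<le> b"
  shows "packed PC (tri PC uC vC l)"
proof (rule corner_packed_tri[of _ _ _ _ _ "vector [- 1, - 1]" _ "vector [int n - 1, int n - 2]"])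
  have cr: "cross2 (z - PC) vC = K z" "cross2 uC (z - PC) = z $ 1 - z $ 2" for z
    by (simp_all add: cross2_def PC_def vC_def uC_def K_def algebra_simps)
  have cone: "0 \<le> cross2 (z - PC) vC \<and> 0 \<le> cross2 uC (z - PC)" if "z \<in> Q" for z
    using that unfolding cr by (simp add: Q_def)
  then show "\<And>z. z \<in> Q \<Longrightarrow> 0 \<le> cross2 (z - PC) vC \<and> 0 \<le> cross2 uC (z - PC)" .
  have "PC + a *\<^sub>R vC = PD" "PC + (a + b) *\<^sub>R uC = PA"
    by (simp_all add: vec2_eq_iff PD_def vC_def uC_def PC_def PA_def algebra_simps)
  moreover have "PA \<in> Q" using a ab by (simp add: PA_def Q_def K_def)
  ultimately have *: "PC \<in> Q" "PC + (a + b) *\<^sub>R uC \<in> Q" "PC + a *\<^sub>R vC \<in> Q"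
    using PD_Q PC_Q by simp_all
  have E1: "cross2 (z - PC) vC \<le> a + b" if "z \<in> Q" "cross2 uC (z - PC) = 0" for z
    using that unfolding cr by (simp add: Q_def K_eq)
  have E2: "cross2 uC (z - PC) \<le> a" if "z \<in> Q" for z
    using that unfolding cr by (simp add: Q_def)
  show "PC extreme_point_of Q" "delzant_condition Q PC"
    using delzant_corner_at[OF convex_Q dirs_real_vec(1,2) cross2_dirs(2) ab a * cone E1 E2] by blast+
  show "tri PC uC vC l \<subseteq> Q"
  proof
    fix z assume "z \<in> tri PC uC vC l"
    then have z: "0 \<le> K z" "z $ 2 \<le> z $ 1" "K z + z $ 1 - z $ 2 < l" by (auto simp: triC)
    then show "z \<in> Q"
      using K_one[OF assms(1), of z] assms(3,4) a unfolding Q_def by simp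
  qed
  show "set [pt a h] \<inter> tri PC uC vC l = {}"
    using assms(4) h by (simp add: triC K_one[OF assms(1)])
qed (use assms dirs_real_vec cross2_dirs n1 in \<open>auto simp: sign_lists_def PC_def\<close>)

text \<open>For n >= 2 a triangle of size at most \<open>a\<close> at \<open>PD\<close> lies in x >=
  a + b, to the right of the triangle at \<open>PA\<close>. For n = 1 the sizes measure horizontal
  distances from the two ends.\<close>

lemma disjoint_AD:
  assumes "x \<le> a + b" "z \<le> a" "n = 1 \<Longrightarrow> x + z \<le> a + b"
  shows "tri PA uA vA x \<inter> tri PD uD uC z = {}"
proof -
  have False if p: "0 \<le> p $ 2" "p $ 1 < x" "p $ 1 - a \<le> p $ 2" "0 \<le> K p" "p $ 2 - p $ 1 + a + K p < z" for p
  proof (cases "n = 1")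
    case True
    then show ?thesis using p K_one[OF True, of p] assms(3) by linarith
  next
    case False
    then have "1 * K p \<le> (N - 1) * K p" using p n by (intro mult_right_mono) auto
    moreover have "(N - 1) * (p $ 2 - p $ 1 + a + K p) \<le> (N - 1) * a"
      using p assms(2) n by (intro mult_left_mono) auto
    moreover have "p $ 1 = N * a + b - K p - (N - 1) * (p $ 2 - p $ 1 + a)"
      by (simp add: K_def algebra_simps)
    ultimately show False using p(2) assms(1) by (simp add: algebra_simps)
  qed
  then show ?thesis by (auto simp: triA triD)
qed

lemma measure_tris:
  "0 < l \<Longrightarrow> tri PA uA vA l \<in> lmeasurable \<and> measure lebesgue (tri PA uA vA l) = l^2 / 2"
  "0 < l \<Longrightarrow> tri PC uC vC l \<in> lmeasurable \<and> measure lebesgue (tri PC uC vC l) = l^2 / 2"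
  "0 < l \<Longrightarrow> tri PD uD uC l \<in> lmeasurable \<and> measure lebesgue (tri PD uD uC l) = l^2 / 2"
  by (intro measure_tri cross2_dirs; simp)+

lemma rho_ST_eq_of_packing:
  assumes H: "vsh (\<lambda>x. - max 0 (x - a)) ` Q = H" "H \<in> lmeasurable" "measure lebesgue H = m"
    and R: "\<And>x y z. sizes x y z \<Longrightarrow> x^2 + y^2 + z^2 \<le> R"
    and lower: "disjoint \<C>" "measure lebesgue (\<Union>\<C>) = R / 2"
      "\<And>B. B \<in> \<C> \<Longrightarrow> \<exists>p. packed p B \<and> (p = PA \<or> p = PD \<or> p = PC \<and> n = 1)"
  shows "rho_ST (semitoric_orbit (H, [pt a h], [1])) = R / 2 / m"
proof -
  have Q: "Q = vsh (\<lambda>x. 1 * max 0 (x - a)) ` H"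
    unfolding H(1)[symmetric] by (simp add: image_image)
  have mQ: "Q \<in> lmeasurable \<and> measure lebesgue Q = m"
    unfolding Q using measure_vsh_hinge[OF H(2), of 1 a] H(3) by simp
  have "rho_ST (semitoric_orbit (chart_triple (Q, [pt a h], [- 1]) [1] 0 0)) = R / 2 / measure lebesgue Q"
  proof (rule rho_ST_eq[where ?\<B>0.0 = \<C>])
    show "\<Union>\<B> \<in> lmeasurable \<and> measure lebesgue (\<Union>\<B>) \<le> R / 2"
      if \<B>: "disjoint \<B>" "\<And>B. B \<in> \<B> \<Longrightarrow> \<exists>p. packed p B" for \<B>
    proof -
      obtain x y z where "sizes x y z" "\<Union>\<B> \<in> lmeasurable" "measure lebesgue (\<Union>\<B>) = (x^2 + y^2 + z^2) / 2"
        using upper[OF \<B>] by blast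
      then show ?thesis using R by simp
    qed
    show "\<exists>p. packed p B \<and>
        (\<forall>s\<in>sign_lists (length [pt a h]). \<forall>k r. chart_vertex [pt a h] [- 1] s k r Q p)"
      if B: "B \<in> \<C>" for B
    proof -
      obtain p where p: "packed p B" "p = PA \<or> p = PD \<or> p = PC \<and> n = 1"
        using lower(3)[OF B] by blast
      then have "chart_vertex [pt a h] [- 1] s k r Q p" if "s \<in> sign_lists 1" for s k r
        using extreme_A extreme_D[OF that] extreme_C[OF that] by blast
      then show ?thesis using p(1) by auto
    qed
  qed (use mQ lower in \<open>auto simp: sign_lists_def\<close>)
  moreover have "chart_triple (Q, [pt a h], [- 1]) [1] 0 0 = (H, [pt a h], [1])"
    unfolding chart_triple_def prod.case chart_one_mark H(1) by (simp add: vec2_eq_iff)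
  ultimately show ?thesis using mQ by simp
qed

lemma rho_ST_two:
  assumes H: "vsh (\<lambda>x. - max 0 (x - a)) ` Q = H" "H \<in> lmeasurable" "measure lebesgue H = m"
    and R: "\<And>x' y' z'. sizes x' y' z' \<Longrightarrow> x'^2 + y'^2 + z'^2 \<le> x^2 + z^2"
    and "sizes x 0 z" "0 < x" "0 < z" "z \<le> a" "n = 1 \<Longrightarrow> z \<le> b"
  shows "rho_ST (semitoric_orbit (H, [pt a h], [1])) = (x^2 + z^2) / 2 / m"
proof (rule rho_ST_eq_of_packing[OF H R])
  have dis: "tri PA uA vA x \<inter> tri PD uD uC z = {}"
  proof (rule disjoint_AD[OF _ assms(8)])
    show "x \<le> a + b" "n = 1 \<Longrightarrow> x + z \<le> a + b"
      using assms(5) unfolding sizes_def by simp_all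
  qed
  then show "disjoint {tri PA uA vA x, tri PD uD uC z}"
    by (auto simp: pairwise_insert disjnt_def)
  show "measure lebesgue (\<Union>{tri PA uA vA x, tri PD uD uC z}) = (x^2 + z^2) / 2"
    using measure_Un3[of "tri PA uA vA x" lebesgue "tri PD uD uC z"]
      measure_tris(1)[OF assms(6)] measure_tris(3)[OF assms(7)] dis by (simp add: add_divide_distrib)
  show "\<exists>p. packed p B \<and> (p = PA \<or> p = PD \<or> p = PC \<and> n = 1)"
    if "B \<in> {tri PA uA vA x, tri PD uD uC z}" for B
    using packed_A[of x] packed_D[of z] assms(5-9) that by (auto simp: sizes_def)
qed

lemma rho_ST_three:
  assumes H: "vsh (\<lambda>x. - max 0 (x - a)) ` Q = H" "H \<in> lmeasurable" "measure lebesgue H = m"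
    and R: "\<And>x' y' z'. sizes x' y' z' \<Longrightarrow> x'^2 + y'^2 + z'^2 \<le> x^2 + y^2 + z^2"
    and "n = 1" "sizes x y z" "0 < x" "0 < y" "0 < z" "y \<le> b" "z \<le> b"
  shows "rho_ST (semitoric_orbit (H, [pt a h], [1])) = (x^2 + y^2 + z^2) / 2 / m"
proof (rule rho_ST_eq_of_packing[OF H R])
  let ?A = "tri PA uA vA x" and ?C = "tri PC uC vC y" and ?D = "tri PD uD uC z"
  have s: "x \<le> a" "x + y \<le> a + b" "y + z \<le> a" "x + z \<le> a + b" "z \<le> (N - 1) * a + b - (N - 2) * h"
    using assms(5) assms(6)[unfolded sizes_def] by blast+
  have AD: "?A \<inter> ?D = {}"
    using s assms(8) by (intro disjoint_AD) auto
  have AC: "?A \<inter> ?C = {}"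
    using s by (auto simp: triA triC K_one[OF assms(5)])
  have CD: "?C \<inter> ?D = {}"
    using s by (auto simp: triC triD)
  show "disjoint {?A, ?C, ?D}"
    using AD AC CD by (auto simp: pairwise_insert disjnt_def)
  have "measure lebesgue (?C \<union> ?D) = y^2 / 2 + z^2 / 2"
    using measure_Un3[of ?C lebesgue ?D] measure_tris(2)[OF assms(8)] measure_tris(3)[OF assms(9)] CD by simp
  moreover have "measure lebesgue (?A \<union> (?C \<union> ?D)) = x^2 / 2 + measure lebesgue (?C \<union> ?D)"
  proof -
    have "?A \<inter> (?C \<union> ?D) = {}" using AC AD by blast
    moreover have "?C \<union> ?D \<in> lmeasurable"
      using measure_tris(2)[OF assms(8)] measure_tris(3)[OF assms(9)] by blast
    ultimately show ?thesis
      using measure_Un3[of ?A lebesgue "?C \<union> ?D"] measure_tris(1)[OF assms(7)] by simp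
  qed
  ultimately show "measure lebesgue (\<Union>{?A, ?C, ?D}) = (x^2 + y^2 + z^2) / 2"
    by (simp add: add_divide_distrib)
  show "\<exists>p. packed p B \<and> (p = PA \<or> p = PD \<or> p = PC \<and> n = 1)"
    if "B \<in> {?A, ?C, ?D}" for B
    using packed_A[of x] packed_C[of y] packed_D[of z] assms(5-11) s that by auto
qed

section \<open>The displayed polygons as images of the base polygon\<close>

lemma image_Q: "z \<in> vsh (\<lambda>x. - max 0 (x - a)) ` Q \<longleftrightarrow>
    (if z $ 1 \<le> a then 0 \<le> z $ 2 \<and> z $ 2 \<le> z $ 1 \<and> 0 \<le> K z
     else 0 \<le> z $ 2 \<and> z $ 2 \<le> a \<and> z $ 1 + (N - 1) * z $ 2 \<le> N * a + b)"
proof -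
  have "K (vsh (\<lambda>x. max 0 (x - a)) z) = K z" if "z $ 1 \<le> a"
    using that by (simp add: K_def max_def)
  moreover have "K (vsh (\<lambda>x. max 0 (x - a)) z) = N * a + b - z $ 1 - (N - 1) * z $ 2" if "\<not> z $ 1 \<le> a"
    using that by (simp add: K_def max_def algebra_simps)
  ultimately show ?thesis
    unfolding vsh_image by (auto simp: Q_def max_def)
qed

text \<open>For b >= 0 the corner \<open>PC\<close> does not lie to the left of the wall. Left of
  the wall K >= 0 then follows from y \<le> x, and the bending turns the diagonal beyond the wall
  into the top edge y = a.\<close>

lemma hull_ab:
  assumes b: "0 \<le> b"
  defines "H \<equiv> convex hull {pt 0 0, pt a a, pt (a + b) a, pt (N * a + b) 0}"
  shows "vsh (\<lambda>x. - max 0 (x - a)) ` Q = H" "H \<in> lmeasurable" "measure lebesgue H = (N * a + 2 * b) * a / 2"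
proof -
  have N: "1 \<le> N" using n by simp
  have "z \<in> vsh (\<lambda>x. - max 0 (x - a)) ` Q \<longleftrightarrow> z \<in> H" for z
  proof -
    have mono: "(N - 1) * z $ 2 \<le> (N - 1) * z $ 1" if "z $ 2 \<le> z $ 1"
      using that one_le_N by (rule mult_left_mono)
    have mono': "(N - 1) * z $ 1 \<le> (N - 1) * a" if "z $ 1 \<le> a"
      using that one_le_N by (rule mult_left_mono)
    have K: "K z = a + b - z $ 1 + ((N - 1) * z $ 1 - (N - 1) * z $ 2)"
      by (simp add: K_def algebra_simps)
    have "(N - 1) * a = N * a - a" by (simp add: algebra_simps)
    then show ?thesis
      unfolding image_Q H_def mem_trapezoid_iff[OF a b N] using b mono mono' K by auto
  qed
  then show "vsh (\<lambda>x. - max 0 (x - a)) ` Q = H" by blast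
  show "H \<in> lmeasurable" "measure lebesgue H = (N * a + 2 * b) * a / 2"
    unfolding H_def using lmeasurable_trapezoid[OF a b N] measure_trapezoid[OF a b N] by blast+
qed

text \<open>For b < 0 the corner \<open>PC\<close> lies to the left of the wall, and it is the edge
  from \<open>PC\<close> to \<open>PD\<close> that gets bent, at the point (a, g) with K (pt a g) =
  0.\<close>

lemma hull_c:
  assumes b: "b < 0" and n2: "2 \<le> n"
  defines "H \<equiv> convex hull {pt 0 0, pt (a + b) (a + b), pt a (a + b / (N - 1)), pt (N * a + b) 0}"
  shows "vsh (\<lambda>x. - max 0 (x - a)) ` Q = H" "H \<in> lmeasurable" "measure lebesgue H = (N * a + 2 * b) * a / 2"
proof -
  define g where "g = a + b / (N - 1)"
  let ?A = "pt 0 0" and ?B = "pt (N * a + b) 0" and ?C = "pt a g" and ?D = "pt (a + b) (a + b)"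
  have H: "H = convex hull {?A, ?B, ?C, ?D}"
    unfolding H_def g_def by (rule arg_cong[of _ _ "\<lambda>S. convex hull S"]) auto
  have N1: "0 < N - 1" using n2 by simp
  \<comment> \<open>From here on \<open>g\<close> is used through its multiple by N - 1, which keeps
    the arithmetic free of division.\<close>
  have g: "(N - 1) * g = (N - 1) * a + b" using N1 by (simp add: g_def distrib_left)
  then have Ng: "N * g = g + N * a - a + b" by (simp add: algebra_simps)
  have g0: "0 < g" using g nab N1 by (metis zero_less_mult_pos)
  have "b / (N - 1) < 0" using b N1 by (simp add: divide_neg_pos)
  then have ga: "0 < a - g" by (simp add: g_def)
  have pos: "0 < N * a + b" using nab a by (simp add: algebra_simps)
  have ABC: "orient ?A ?B ?C = (N * a + b) * g" and ACD: "orient ?A ?C ?D = (a + b) * (a - g)"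
    and ABD: "orient ?A ?B ?D = (N * a + b) * (a + b)"
    by (simp_all add: orient_simps algebra_simps)
  have "orient ?B ?C ?D = (a - N * a - b) * (a + b) + a * ((N - 1) * g)"
    by (simp add: orient_simps algebra_simps)
  also have "a - N * a - b = - ((N - 1) * g)"
    unfolding g by (simp add: algebra_simps)
  finally have BCD: "orient ?B ?C ?D = (N - 1) * g * (- b)"
    by (simp add: algebra_simps)
  have 1: "orient ?A ?B ?C > 0" using ABC pos g0 by simp
  have 2: "orient ?A ?C ?D > 0 \<or> ?C = ?D" using ACD ab ga by simp
  have 3: "0 \<le> orient ?A ?B ?D" "0 \<le> orient ?B ?C ?D" unfolding ABD BCD using pos ab g0 b N1 by (simp_all add: mult_nonneg_nonpos)
  note quad = mem_quadrilateral_iff[OF 1 2 3] lmeasurable_quadrilateral[OF 1 2 3] measure_quadrilateral[OF 1 2 3]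
  show "H \<in> lmeasurable"
    unfolding H by (rule quad(2))
  have "(N * a + b) * g + (a + b) * (a - g) = a * ((N - 1) * g) + (a + b) * a"
    by (simp add: algebra_simps)
  then have area: "(N * a + b) * g + (a + b) * (a - g) = (N * a + 2 * b) * a"
    unfolding g by (simp add: algebra_simps)
  show "measure lebesgue H = (N * a + 2 * b) * a / 2"
    unfolding H quad(3) ABC ACD area ..
  have "z \<in> vsh (\<lambda>x. - max 0 (x - a)) ` Q \<longleftrightarrow> z \<in> H" for z
  proof -
    have AB: "0 \<le> orient ?A ?B z \<longleftrightarrow> 0 \<le> z $ 2"
      by (rule orient_nonneg_iff[OF pos]) (simp add: orient_simps)
    have "orient ?B ?C z = g * (N * a + b - z $ 1) - (N * a + b - a) * z $ 2"
      by (simp add: orient_simps algebra_simps)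
    also have "N * a + b - a = (N - 1) * g"
      unfolding g by (simp add: algebra_simps)
    finally have BC: "0 \<le> orient ?B ?C z \<longleftrightarrow> 0 \<le> N * a + b - z $ 1 - (N - 1) * z $ 2"
      by (intro orient_nonneg_iff[OF g0]) (simp add: algebra_simps)
    have DA: "0 \<le> orient ?D ?A z \<longleftrightarrow> 0 \<le> z $ 1 - z $ 2"
      by (rule orient_nonneg_iff[OF ab]) (simp add: orient_simps algebra_simps)
    have CD: "0 \<le> orient ?C ?D z \<longleftrightarrow> 0 \<le> K z"
    proof -
      have "(N - 1) * orient ?C ?D z = (- b) * K z"
      proof -
        have "(N - 1) * orient ?C ?D z = b * ((N - 1) * z $ 2) - b * ((N - 1) * g)
            - ((N - 1) * a + (N - 1) * b - (N - 1) * g) * (z $ 1 - a)"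
          by (simp add: orient_simps algebra_simps)
        then show ?thesis
          unfolding g by (simp add: K_def algebra_simps)
      qed
      then have "0 \<le> (N - 1) * orient ?C ?D z \<longleftrightarrow> 0 \<le> - b * K z" by simp
      then show ?thesis
        using N1 b by (simp add: zero_le_mult_iff mult_le_0_iff)
    qed
    have mono: "(N - 1) * z $ 1 \<le> (N - 1) * a" if "z $ 1 \<le> a"
      using that one_le_N by (rule mult_left_mono)
    have mono': "(N - 1) * a \<le> (N - 1) * z $ 1" if "a \<le> z $ 1"
      using that one_le_N by (rule mult_left_mono)
    have K: "K z = (N - 1) * z $ 1 - z $ 1 + a + b - (N - 1) * z $ 2"
      by (simp add: K_def algebra_simps)
    have Na: "N * a = (N - 1) * a + a" by (simp add: algebra_simps)
    have top: "z $ 2 \<le> a" if "a < z $ 1" "z $ 1 + (N - 1) * z $ 2 \<le> N * a + b"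
    proof -
      have "(N - 1) * z $ 2 \<le> (N - 1) * a" using that b Na by linarith
      then show ?thesis using N1 by simp
    qed
    show ?thesis
    proof (cases "z $ 1 \<le> a")
      case True
      then show ?thesis
        unfolding image_Q H quad(1) AB BC CD DA using mono K Na by auto
    next
      case False
      then show ?thesis
        unfolding image_Q H quad(1) AB BC CD DA using mono' K Na top by auto
    qed
  qed
  then show "vsh (\<lambda>x. - max 0 (x - a)) ` Q = H" by blast
qed

section \<open>Maximising the sum of squares under the size constraints\<close>

text \<open>The triangles at \<open>PC\<close> and \<open>PD\<close> share an edge of lattice length
  \<open>a\<close>, so together they are no larger than one triangle of that size.\<close>

lemma sizes_le:
  assumes "sizes x y z" shows "x^2 + y^2 + z^2 \<le> a^2 + a^2"
proof -
  have x: "x^2 \<le> a^2"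
    using assms by (intro power_mono) (auto simp: sizes_def)
  have "y^2 + z^2 \<le> (y + z)^2"
    using assms by (simp add: sizes_def power2_sum)
  also have "\<dots> \<le> a^2"
    using assms by (intro power_mono) (auto simp: sizes_def)
  finally show ?thesis
    using x by linarith
qed

lemma rho_ST_ab:
  assumes b: "0 \<le> b" and n2: "2 \<le> n"
  shows "rho_ST (semitoric_orbit (convex hull {pt 0 0, pt a a, pt (a + b) a, pt (N * a + b) 0}, [pt a h], [1]))
    = 2 * a / (N * a + 2 * b)" (is "?\<rho> = _")
proof -
  \<comment> \<open>For b >= 0 the mark bound on \<open>z\<close> is at least \<open>a\<close>,
    which is why \<open>h\<close> does not enter the density.\<close>
  have "0 \<le> (N - 2) * (a - h)" using n2 h by simp
  then have M: "a \<le> (N - 1) * a + b - (N - 2) * h"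
    using b by (simp add: algebra_simps)
  have "?\<rho> = (a^2 + a^2) / 2 / ((N * a + 2 * b) * a / 2)"
  proof (rule rho_ST_two[OF hull_ab[OF b] sizes_le])
  qed (use a b M n2 in \<open>auto simp: sizes_def\<close>)
  also have "\<dots> = 2 * a / (N * a + 2 * b)"
    using a by (simp add: power2_eq_square)
  finally show ?thesis .
qed

text \<open>Here the pairing is different: \<open>PA\<close> and \<open>PC\<close> share the
  diagonal of lattice length \<open>a + b\<close> and are bounded together, while the triangle at
  \<open>PD\<close> grows until it reaches the mark or size \<open>a\<close>.\<close>

lemma rho_ST_c:
  assumes b: "b < 0" and n2: "2 \<le> n"
  shows "rho_ST (semitoric_orbit (convex hull {pt 0 0, pt (a + b) (a + b), pt a (a + b / (N - 1)), pt (N * a + b) 0}, [pt a h], [1]))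
    = ((a + b)^2 + min (((N - 1) * a + b - (N - 2) * h)^2) (a^2)) / ((N * a + 2 * b) * a)"
    (is "?\<rho> = _")
proof -
  define M where "M = (N - 1) * a + b - (N - 2) * h"
  define l where "l = min M a"
  have M: "0 < M" unfolding M_def by (rule mark_pos)
  have l: "0 < l" "l \<le> a" "l \<le> M" using M a by (auto simp: l_def)
  have l2: "l^2 = min (M^2) (a^2)"
    using M a by (auto simp: l_def min_def power2_le_iff_abs_le)
  have "?\<rho> = ((a + b)^2 + l^2) / 2 / ((N * a + 2 * b) * a / 2)"
  proof (rule rho_ST_two[OF hull_c[OF b n2]])
    fix x y z assume s: "sizes x y z"
    have z: "z^2 \<le> l^2"
      using s by (intro power_mono) (auto simp: sizes_def l_def M_def)
    have "x^2 + y^2 \<le> (x + y)^2"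
      using s by (simp add: sizes_def power2_sum)
    also have "\<dots> \<le> (a + b)^2"
      using s by (intro power_mono) (auto simp: sizes_def)
    finally show "x^2 + y^2 + z^2 \<le> (a + b)^2 + l^2"
      using z by linarith
  qed (use a b ab l n2 in \<open>auto simp: sizes_def M_def\<close>)
  also have "r / 2 / (q / 2) = r / q" for r q :: real
    by simp
  finally show ?thesis
    unfolding l2 M_def .
qed

lemma sum_squares_A:
  assumes "0 \<le> x" "x \<le> a + b - y" "b \<le> y" "y \<le> a"
  shows "x^2 + y^2 \<le> a^2 + b^2"
proof -
  have "x^2 \<le> (a + b - y)^2" using assms by (intro power_mono) auto
  moreover have "0 \<le> (y - b) * (a - y)" using assms by simp
  ultimately show ?thesis by (simp add: power2_eq_square algebra_simps)
qed

text \<open>The constraints collected in \<open>szD\<close> are symmetric in \<open>y\<close> and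
  \<open>z\<close>. With x = a they leave y, z \<le> b and y + z \<le> a, so the optimal (x, y, z)
  are (a, 0, a), (a, b, a - b) and (a, b, b) in the three regimes.\<close>

lemma rho_ST_one:
  assumes n1': "n = 1"
  defines "\<rho> \<equiv> rho_ST (semitoric_orbit (convex hull {pt 0 0, pt a a, pt (a + b) a, pt (N * a + b) 0}, [pt a h], [1]))"
  shows "a \<le> b \<Longrightarrow> \<rho> = 2 * a / (a + 2 * b)"
    and "b < a \<Longrightarrow> a < 2 * b \<Longrightarrow> \<rho> = (a^2 + b^2 + (a - b)^2) / ((a + 2 * b) * a)"
    and "2 * b \<le> a \<Longrightarrow> \<rho> = (a^2 + 2 * b^2) / ((a + 2 * b) * a)"
proof -
  have b: "0 < b" by (rule n1[OF n1'])
  have N: "N = 1" using n1' by simp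
  note H = hull_ab[OF less_imp_le[OF b]]
  have szD: "0 \<le> x" "0 \<le> y" "0 \<le> z" "x \<le> a" "x + y \<le> a + b" "y + z \<le> a" "x + z \<le> a + b"
    if "sizes x y z" for x y z
    using that n1' unfolding sizes_def by blast+
  have szI: "sizes x y z" if "0 \<le> x" "0 \<le> y" "0 \<le> z" "x \<le> a" "x + y \<le> a + b" "y + z \<le> a" "x + z \<le> a + b" "z \<le> b" for x y z
    unfolding sizes_def using that h N by auto
  have area: "r / 2 / ((N * a + 2 * b) * a / 2) = r / ((a + 2 * b) * a)" for r
    by (simp add: N)
  {
    assume ab': "a \<le> b"
    have "\<rho> = (a^2 + a^2) / 2 / ((N * a + 2 * b) * a / 2)"
      unfolding \<rho>_def
    proof (rule rho_ST_two[OF H sizes_le])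
    qed (use a b ab' in \<open>auto intro!: szI\<close>)
    also have "\<dots> = 2 * a / (a + 2 * b)"
      unfolding area using a by (simp add: power2_eq_square)
    finally show "\<rho> = 2 * a / (a + 2 * b)" .
  }
  {
    assume ab': "b < a" "a < 2 * b"
    have "\<rho> = (a^2 + b^2 + (a - b)^2) / 2 / ((N * a + 2 * b) * a / 2)"
      unfolding \<rho>_def
    proof (rule rho_ST_three[OF H _ n1'])
      fix x y z assume s: "sizes x y z"
      note sz = szD[OF s]
      \<comment> \<open>If a size exceeds \<open>b\<close>, it costs as much in \<open>x\<close>,
        and the remaining one is below a - b. By symmetry this covers both \<open>y\<close> and
        \<open>z\<close>.\<close>
      have *: "x^2 + y^2 + z^2 \<le> a^2 + b^2 + (a - b)^2"
        if that: "b < y" "0 \<le> x" "0 \<le> z" "x + y \<le> a + b" "y + z \<le> a" for x y z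
      proof -
        have "z^2 \<le> (a - b)^2" using that by (intro power_mono) auto
        moreover have "x^2 + y^2 \<le> a^2 + b^2" using that by (intro sum_squares_A) auto
        ultimately show ?thesis by linarith
      qed
      consider "b < y" | "b < z" | "y \<le> b" "z \<le> b" by linarith
      then show "x^2 + y^2 + z^2 \<le> a^2 + b^2 + (a - b)^2"
      proof cases
        case 1 then show ?thesis using *[of y x z] sz by simp
      next
        case 2 then show ?thesis using *[of z x y] sz by (simp add: add.commute)
      next
        case 3
        \<comment> \<open>\<open>sum_squares_le\<close> is used with \<open>a - b\<close> in place
          of \<open>h\<close>, which turns its cap a - h into \<open>b\<close>.\<close>
        then have "y^2 + z^2 \<le> b^2 + (a - b)^2"
          using sum_squares_le[of y a "a - b" z] sz by simp
        moreover have "x^2 \<le> a^2" using sz by (intro power_mono) auto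
        ultimately show ?thesis by linarith
      qed
    qed (use a b ab' in \<open>auto intro!: szI\<close>)
    then show "\<rho> = (a^2 + b^2 + (a - b)^2) / ((a + 2 * b) * a)"
      unfolding area .
  }
  {
    assume ab': "2 * b \<le> a"
    have "\<rho> = (a^2 + b^2 + b^2) / 2 / ((N * a + 2 * b) * a / 2)"
      unfolding \<rho>_def
    proof (rule rho_ST_three[OF H _ n1'])
      fix x y z assume s: "sizes x y z"
      have *: "x^2 + y^2 + z^2 \<le> a^2 + b^2 + b^2"
        if p: "z \<le> y" "0 \<le> x" "0 \<le> y" "0 \<le> z" "x \<le> a" "x + y \<le> a + b" "y + z \<le> a" for x y z
      proof -
        have xle: "x^2 \<le> (a + b - y)^2" using p by (intro power_mono) auto
        consider "y \<le> b" | "z \<le> b" "b \<le> y" | "b \<le> z" "2 * y \<le> a" | "b \<le> z" "a \<le> 2 * y" by linarith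
        \<comment> \<open>For fixed \<open>y\<close> the bounds on \<open>x\<close> and \<open>z\<close> leave a convex function of \<open>y\<close>, whose bound at the two ends of
          the interval for \<open>y\<close> is encoded by products of the distances to these ends.\<close>
        then show ?thesis
        proof cases
          case 1
          then have "x^2 \<le> a^2" "y^2 \<le> b^2" "z^2 \<le> b^2"
            using p by (intro power_mono; simp)+
          then show ?thesis by linarith
        next
          case 2
          then have "x^2 + y^2 \<le> a^2 + b^2" "z^2 \<le> b^2"
            using p by (intro sum_squares_A power_mono; simp)+
          then show ?thesis by linarith
        next
          case 3
          have "z^2 \<le> y^2" using p by (intro power_mono) auto
          \<comment> \<open>The factors come from (a + b - y)^2 + 2 y^2 - (a^2 + 2 b^2) = (y - b)(3
            y - 2 a + b).\<close>
          moreover have "0 \<le> (y - b) * (2 * a - b - 3 * y)" using 3 p ab' b by (intro mult_nonneg_nonneg) auto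
          ultimately show ?thesis using xle by (simp add: power2_eq_square algebra_simps)
        next
          case 4
          have "z^2 \<le> (a - y)^2" using p by (intro power_mono) auto
          \<comment> \<open>At the ends y = a/2 and y = a - b the bounding function falls short of
            a^2 + 2 b^2 by (a/2 - b)^2 and 2 b (a - 2 b).\<close>
          moreover have "0 \<le> (2 * y - a) * (a - b - y)" using 4 p by (intro mult_nonneg_nonneg) auto
          moreover have "0 \<le> (a - b - y) * (a - 2 * b)" "0 \<le> (2 * y - a) * b"
            using 4 p ab' b by (intro mult_nonneg_nonneg; simp)+
          ultimately show ?thesis using xle by (simp add: power2_eq_square algebra_simps)
        qed
      qed
      note sz = szD[OF s]
      show "x^2 + y^2 + z^2 \<le> a^2 + b^2 + b^2"
        using *[of z y x] *[of y z x] sz by (cases "z \<le> y") (auto simp: add.commute)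
    qed (use a b ab' in \<open>auto intro!: szI\<close>)
    then show "\<rho> = (a^2 + 2 * b^2) / ((a + 2 * b) * a)"
      unfolding area by simp
  }
qed

end

section \<open>Type (2)\<close>

text \<open>The displayed polygon itself serves as base: the two corners that can be packed, at the
  ends of the bottom edge, lie on no wall.\<close>

definition base2 :: "real \<Rightarrow> real \<Rightarrow> (real^2) set" where
  "base2 a b = {z. 0 \<le> z $ 2 \<and> z $ 2 \<le> a \<and> z $ 2 \<le> z $ 1 \<and> z $ 2 \<le> 2 * a + b - z $ 1}"

lemma convex_base2: "convex (base2 a b)"
proof -
  have "base2 a b = {z. pt 0 (- 1) \<bullet> z \<le> 0} \<inter> {z. pt 0 1 \<bullet> z \<le> a} \<inter> {z. pt (- 1) 1 \<bullet> z \<le> 0}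
      \<inter> {z. pt 1 1 \<bullet> z \<le> 2 * a + b}"
    by (auto simp: base2_def inner_vec_def sum_2)
  then show ?thesis by (simp add: convex_Int convex_halfspace_le)
qed

lemma base2_hull:
  assumes a: "a > 0" and b: "b \<ge> 0"
  shows "base2 a b = convex hull {pt 0 0, pt a a, pt (a + b) a, pt (2 * a + b) 0}"
    and "base2 a b \<in> lmeasurable" "measure lebesgue (base2 a b) = a * (a + b)"
proof -
  let ?H = "convex hull {pt 0 0, pt a a, pt (a + b) a, pt (2 * a + b) 0}"
  have N: "(1::real) \<le> 2" by simp
  show eq: "base2 a b = ?H"
    by (rule set_eqI) (auto simp: mem_trapezoid_iff[OF a b N] base2_def)
  show "base2 a b \<in> lmeasurable" "measure lebesgue (base2 a b) = a * (a + b)"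
    unfolding eq using lmeasurable_trapezoid[OF a b N] measure_trapezoid[OF a b N] by (simp_all add: algebra_simps)
qed

locale type2 =
  fixes a b h1 h2 :: real
  assumes a: "0 < a" and b: "0 \<le> b" and h1: "0 < h1" "h1 < a" and h2: "0 < h2" "h2 < a"
begin

abbreviation "Q \<equiv> base2 a b"
abbreviation "c \<equiv> [pt a h1, pt (a + b) h2]"

lemma tri_left: "z \<in> tri (pt 0 0) (pt 1 0) (pt 1 1) l \<longleftrightarrow> 0 \<le> z $ 2 \<and> z $ 2 \<le> z $ 1 \<and> z $ 1 < l"
  by (subst mem_tri_iff) (auto simp: cross2_def)

lemma tri_right: "z \<in> tri (pt (2 * a + b) 0) (pt (- 1) 1) (pt (- 1) 0) l \<longleftrightarrow>
    0 \<le> z $ 2 \<and> z $ 2 \<le> 2 * a + b - z $ 1 \<and> 2 * a + b - z $ 1 < l"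
  by (subst mem_tri_iff) (auto simp: cross2_def)

text \<open>A top corner avoids the cuts only if the signs on its wall are -1, and then the chart
  straightens the boundary there. All other points are midpoints as before.\<close>

lemma candidates2:
  assumes P: "packed_in_chart Q c p B s (chart c [1, 1] s k r)" and s: "s \<in> sign_lists 2"
  shows "p = pt 0 0 \<or> p = pt (2 * a + b) 0"
proof (rule ccontr)
  assume n: "\<not> (p = pt 0 0 \<or> p = pt (2 * a + b) 0)"
  define x y where "x = p $ 1" and "y = p $ 2"
  have E: "chart_vertex c [1, 1] s k r Q p"
    and cuts: "\<And>i. i < 2 \<Longrightarrow> c ! i $ 1 = x \<Longrightarrow> of_int (s ! i) * (y - c ! i $ 2) < 0"
    using P unfolding packed_in_chart_def x_def y_def by auto
  have s01: "s ! 0 = 1 \<or> s ! 0 = - 1" "s ! 1 = 1 \<or> s ! 1 = - 1"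
    using sign_lists_nth[OF s] by auto
  have cut0: "x = a \<Longrightarrow> s ! 0 = 1 \<and> y < h1 \<or> s ! 0 = - 1 \<and> h1 < y"
    using cuts[of 0] s01 by auto
  have cut1: "x = a + b \<Longrightarrow> s ! 1 = 1 \<and> y < h2 \<or> s ! 1 = - 1 \<and> h2 < y"
    using cuts[of 1] s01 by auto
  have "p \<in> Q"
    using E by (auto simp: extreme_point_of_def)
  then have xy: "0 \<le> y" "y \<le> a" "y \<le> x" "y \<le> 2 * a + b - x"
    by (auto simp: base2_def x_def y_def)
  have n': "\<not> (x = 0 \<and> y = 0)" "\<not> (x = 2 * a + b \<and> y = 0)"
    using n by (auto simp: x_def y_def vec2_eq_iff)
  have move: False
    if "pt (x + d1) (y + d2) \<in> Q" "pt (x - d1) (y - d2) \<in> Q" "d1 \<noteq> 0 \<or> d2 \<noteq> 0"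
      "d1 = 0 \<or> (x = a \<longrightarrow> s ! 0 = 1) \<and> (x = a + b \<longrightarrow> s ! 1 = 1)" for d1 d2
  proof -
    have eq: "p + pt d1 d2 = pt (x + d1) (y + d2)" "p - pt d1 d2 = pt (x - d1) (y - d2)"
      by (simp_all add: vec2_eq_iff x_def y_def)
    have "p + pt d1 d2 \<in> Q" "p - pt d1 d2 \<in> Q"
      using that(1,2) unfolding eq by blast+
    moreover have "pt d1 d2 \<noteq> 0" using that(3) by (auto simp: vec2_eq_iff)
    moreover have "pt d1 d2 $ 1 = 0 \<or> s ! i = [1, 1] ! i" if "i < length c" "c ! i $ 1 = p $ 1" for i
    proof -
      have "i = 0 \<or> i = 1" using \<open>i < length c\<close> by auto
      then show ?thesis using that \<open>d1 = 0 \<or> _\<close> unfolding x_def by auto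
    qed
    ultimately have "\<not> chart_vertex c [1, 1] s k r Q p"
      by (intro chart_not_extreme_off_wall[OF convex_base2, of p "pt d1 d2"])
    then show False using E by blast
  qed
  have bend: "bend c (\<lambda>i. ([1, 1] ! i - s ! i) div 2) t =
      of_int ((1 - s ! 0) div 2) * max 0 (t - a) + of_int ((1 - s ! 1) div 2) * max 0 (t - (a + b))" for t
    by (simp add: bend_def numeral_2_eq_2)
  have mid: False
    if "pt (x - d) y1 \<in> Q" "pt (x + d) y2 \<in> Q" "d \<noteq> 0"
      "y1 + bend c (\<lambda>i. ([1, 1] ! i - s ! i) div 2) (x - d) + (y2 + bend c (\<lambda>i. ([1, 1] ! i - s ! i) div 2) (x + d))
        = 2 * (y + bend c (\<lambda>i. ([1, 1] ! i - s ! i) div 2) x)" for d y1 y2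
    using chart_not_extreme[OF that(1,2) _ _ _ refl, of p c "[1, 1]" s k r] that E by (auto simp: x_def y_def)
  consider "y = 0" "0 < x" "x < 2 * a + b" | "0 < y" "y < a" "y < x" "y < 2 * a + b - x"
    | "0 < y" "y < a" "y = x" | "0 < y" "y < a" "y = 2 * a + b - x"
    | "y = a" "a < x" "x < a + b" | "y = a" "x = a" | "y = a" "x = a + b"
  proof -
    consider (i) "y = 0" | (ii) "y = a" | (iii) "0 < y" "y < a"
      using xy by linarith
    then show ?thesis
    proof cases
      case i
      then show ?thesis using that(1) n' xy by auto
    next
      case ii
      then show ?thesis using that(5-7) xy by fastforce
    next
      case iii
      consider "y = x" | "y = 2 * a + b - x" | "y < x" "y < 2 * a + b - x"
        using xy by linarith
      then show ?thesis using that(2-4) iii by cases auto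
    qed
  qed
  then show False
  proof cases
    case 1
    define e where "e = min x (2 * a + b - x)"
    have e: "0 < e" "e \<le> x" "e \<le> 2 * a + b - x" using 1 by (auto simp: e_def)
    have "x = a \<longrightarrow> s ! 0 = 1" "x = a + b \<longrightarrow> s ! 1 = 1"
      using cut0 cut1 1 h1 h2 by auto
    then show False
      using e 1(1) a by (intro move[of e 0]) (simp_all add: base2_def)
  next
    case 2
    define e where "e = min (min y (a - y)) (min (x - y) (2 * a + b - x - y))"
    have e: "0 < e" "e \<le> y" "e \<le> a - y" "e \<le> x - y" "e \<le> 2 * a + b - x - y" using 2 by (auto simp: e_def)
    then show False using move[of 0 e] by (auto simp: base2_def)
  next
    case 3
    define e where "e = min y (a - y)"
    have e: "0 < e" "e \<le> y" "e \<le> a - y" using 3 by (auto simp: e_def)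
    then show False using move[of e e] 3 b by (auto simp: base2_def)
  next
    case 4
    define e where "e = min y (a - y)"
    have e: "0 < e" "e \<le> y" "e \<le> a - y" using 4 by (auto simp: e_def)
    then show False using move[of e "- e"] 4 b by (auto simp: base2_def)
  next
    case 5
    define e where "e = min (x - a) (a + b - x)"
    have e: "0 < e" "e \<le> x - a" "e \<le> a + b - x" using 5 by (auto simp: e_def)
    then show False using move[of e 0] 5 a by (auto simp: base2_def)
  next
    case 6
    then have s0: "s ! 0 = - 1" using cut0 h1 by auto
    show False
    proof (cases "b = 0")
      case True
      then have "s ! 1 = - 1" using cut1 h2 6 by auto
      \<comment> \<open>For b = 0 both walls coincide and both signs are -1, so the slope changes by
        2, from -1 to 1, and the two upper sides become one edge from (0,0) to (2a,2a).\<close>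
      then show False
        using mid[of a 0 0] s0 6 a True unfolding bend by (auto simp: base2_def)
    next
      case False
      \<comment> \<open>The bound by \<open>b\<close> keeps the segment from crossing the other
        wall.\<close>
      define e where "e = min a b"
      have "0 < e" "e \<le> a" "e \<le> b" using False a b by (auto simp: e_def)
      then show False
        using mid[of e "a - e" a] s0 6 a unfolding bend by (auto simp: base2_def)
    qed
  next
    case 7
    then have s1: "s ! 1 = - 1" using cut1 h2 by auto
    show False
    proof (cases "b = 0")
      case True
      then have "s ! 0 = - 1" using cut0 h1 7 by auto
      then show False
        using mid[of a 0 0] s1 7 a True unfolding bend by (auto simp: base2_def)
    next
      case False
      define e where "e = min a b"
      have e: "0 < e" "e \<le> a" "e \<le> b" using False a b by (auto simp: e_def)
      then show False
        using mid[of e a "a - e"] s1 s01(1) 7 a unfolding bend by (auto simp: base2_def algebra_simps)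
    qed
  qed
qed

text \<open>
  Charts preserve the lengths of vertical slices. These are at most \<open>a\<close> in the polygon, whereas a
  triangle of size \<open>l\<close> has slices of all lengths below \<open>l\<close>.
\<close>

lemma packed_size:
  assumes P: "packed_in_chart Q c p B s (chart c [1, 1] s k r)" and s: "s \<in> sign_lists 2"
    and B: "B \<subseteq> Q"
  shows "p \<in> {pt 0 0, pt (2 * a + b) 0}" "p \<in> B"
    "\<exists>l>0. B \<in> lmeasurable \<and> measure lebesgue B = l^2 / 2 \<and> l \<le> a"
proof -
  show p: "p \<in> {pt 0 0, pt (2 * a + b) 0}"
    using candidates2[OF P s] by blast
  define \<beta> where "\<beta> = cbend c (p $ 1) (\<lambda>i. ([1, 1] ! i - s ! i) div 2)"
  have slice: "y2 - y1 \<le> a" if "vsh (\<lambda>x. - \<beta> x) (pt x y1) \<in> B" "vsh (\<lambda>x. - \<beta> x) (pt x y2) \<in> B" for x y1 y2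
    using subsetD[OF B that(1)] subsetD[OF B that(2)] by (simp add: base2_def)
  have *: "p \<in> B \<and> (\<exists>l>0. B \<in> lmeasurable \<and> measure lebesgue B = l^2 / 2 \<and> l \<le> a)"
    if "l > 0" and BT: "B = {z. vsh \<beta> z \<in> tri p u v l}" and "cross2 u v = 1"
      and le: "\<And>x. a < x \<Longrightarrow> x < l \<Longrightarrow> \<exists>x' y1 y2. pt x' y1 \<in> tri p u v l \<and> pt x' y2 \<in> tri p u v l \<and> y2 - y1 = x" for l u v
  proof -
    have "l \<le> a"
    proof (rule ccontr)
      assume "\<not> l \<le> a"
      then obtain x where x: "a < x" "x < l" by (meson dense not_le)
      then obtain x' y1 y2 where "pt x' y1 \<in> tri p u v l" "pt x' y2 \<in> tri p u v l" "y2 - y1 = x"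
        using le by blast
      then show False using slice[of x' y1 y2] x unfolding BT by simp
    qed
    moreover have "B \<in> lmeasurable \<and> measure lebesgue B = l^2 / 2"
      unfolding BT \<beta>_def by (rule measure_bent_tri[OF that(3,1)])
    moreover have "p \<in> B"
    proof -
      have "\<beta> (p $ 1) = 0"
        unfolding \<beta>_def cbend_def by (intro sum.neutral) (auto simp: max_def)
      then have "vsh \<beta> p = p" by (simp add: vec2_eq_iff)
      then show ?thesis unfolding BT using that(1) by (auto intro!: tri_memI[of 0 0])
    qed
    ultimately show ?thesis using that(1) by blast
  qed
  have wall: "s ! i = [1, 1] ! i" if "i < length c" "c ! i $ 1 = p $ 1" for i
  proof -
    have "c ! i $ 1 = a \<or> c ! i $ 1 = a + b"
      using that(1) by (cases i) auto
    moreover have "p $ 1 = 0 \<or> p $ 1 = 2 * a + b"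
      using p by auto
    ultimately have False
      using that(2) a b by linarith
    then show ?thesis ..
  qed
  have "p \<in> B \<and> (\<exists>l>0. B \<in> lmeasurable \<and> measure lebesgue B = l^2 / 2 \<and> l \<le> a)"
  proof (cases "p = pt 0 0")
    case True
    obtain l where l: "l > 0" "B = {z. vsh \<beta> z \<in> tri p (pt 1 0) (pt 1 1) l}"
      unfolding \<beta>_def
    proof (rule packed_in_chart_tri[OF P wall, of "pt 1 0" "pt 1 1"])
      show "open {z::real^2. z $ 2 < a \<and> z $ 2 < 2 * a + b - z $ 1}"
        by (intro open_Collect_conj open_Collect_less continuous_intros)
      show "pt 1 0 $ i \<in> \<int>" "pt 1 1 $ i \<in> \<int>" for i
        using exhaust_2[of i] by auto
    qed (use True a b in \<open>auto simp: cross2_def base2_def\<close>)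
    show ?thesis
    proof (rule *[OF l])
      fix x assume "a < x" "x < l"
      then show "\<exists>x' y1 y2. pt x' y1 \<in> tri p (pt 1 0) (pt 1 1) l \<and> pt x' y2 \<in> tri p (pt 1 0) (pt 1 1) l \<and> y2 - y1 = x"
        unfolding True using a by (intro exI[of _ x] exI[of _ 0] exI[of _ x]) (simp add: tri_left)
    qed (simp add: cross2_def)
  next
    case False
    then have p: "p = pt (2 * a + b) 0" using p by simp
    obtain l where l: "l > 0" "B = {z. vsh \<beta> z \<in> tri p (pt (- 1) 1) (pt (- 1) 0) l}"
      unfolding \<beta>_def
    proof (rule packed_in_chart_tri[OF P wall, of "pt (- 1) 1" "pt (- 1) 0"])
      show "open {z::real^2. z $ 2 < a \<and> z $ 2 < z $ 1}"
        by (intro open_Collect_conj open_Collect_less continuous_intros)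
      show "pt (- 1) 1 $ i \<in> \<int>" "pt (- 1) 0 $ i \<in> \<int>" for i
        using exhaust_2[of i] by auto
    qed (use p a b in \<open>auto simp: cross2_def base2_def\<close>)
    show ?thesis
    proof (rule *[OF l])
      fix x assume "a < x" "x < l"
      then show "\<exists>x' y1 y2. pt x' y1 \<in> tri p (pt (- 1) 1) (pt (- 1) 0) l \<and> pt x' y2 \<in> tri p (pt (- 1) 1) (pt (- 1) 0) l \<and> y2 - y1 = x"
        unfolding p using a by (intro exI[of _ "2 * a + b - x"] exI[of _ 0] exI[of _ x]) (simp add: tri_right)
    qed (simp add: cross2_def)
  qed
  then show "p \<in> B" "\<exists>l>0. B \<in> lmeasurable \<and> measure lebesgue B = l^2 / 2 \<and> l \<le> a"
    by blast+
qed

lemma upper2: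
  assumes "disjoint \<B>" "\<And>B. B \<in> \<B> \<Longrightarrow> \<exists>p. corner_packed (Q, c, [1, 1]) p B"
  shows "\<Union>\<B> \<in> lmeasurable \<and> measure lebesgue (\<Union>\<B>) \<le> a^2"
proof (rule disjoint_packing_measure[of "{pt 0 0, pt (2 * a + b) 0}" \<B> "\<lambda>p l B. l \<le> a"])
  show "\<exists>p\<in>{pt 0 0, pt (2 * a + b) 0}. p \<in> B \<and> (\<exists>l>0. B \<in> lmeasurable \<and> measure lebesgue B = l^2 / 2 \<and> l \<le> a)"
    if B: "B \<in> \<B>" for B
  proof -
    obtain p s k r where "s \<in> sign_lists 2" "B \<subseteq> Q" "packed_in_chart Q c p B s (chart c [1, 1] s k r)"
      using assms(2)[OF B] unfolding corner_packed_def by (auto simp: numeral_2_eq_2)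
    then show ?thesis using packed_size by blast
  qed
  fix L F
  assume L: "\<And>p. p \<in> {pt 0 0, pt (2 * a + b) 0} \<Longrightarrow> 0 \<le> L p" "\<And>p. p \<in> {pt 0 0, pt (2 * a + b) 0} \<Longrightarrow> 0 < L p \<Longrightarrow> L p \<le> a"
    and U: "\<Union>\<B> \<in> lmeasurable" "measure lebesgue (\<Union>\<B>) = (\<Sum>p\<in>{pt 0 0, pt (2 * a + b) 0}. (L p)^2 / 2)"
  have le: "(L p)^2 \<le> a^2" if "p \<in> {pt 0 0, pt (2 * a + b) 0}" for p
    using L[OF that] a by (intro power_mono) (cases "0 < L p"; simp)+
  have "pt 0 0 \<noteq> pt (2 * a + b) 0" using a b by simp
  then have "measure lebesgue (\<Union>\<B>) = (L (pt 0 0))^2 / 2 + (L (pt (2 * a + b) 0))^2 / 2"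
    unfolding U(2) by simp
  then have "measure lebesgue (\<Union>\<B>) \<le> a^2"
    using le[OF insertI1] le[OF insertI2[OF insertI1]] by linarith
  then show ?thesis using U(1) by simp
qed (use assms in auto)

lemma rho_ST_type2:
  "rho_ST (semitoric_orbit (convex hull {pt 0 0, pt a a, pt (a + b) a, pt (2 * a + b) 0}, c, [1, 1])) = a / (a + b)"
proof -
  define A D where "A = pt 0 0" and "D = pt (2 * a + b) 0"
  define TA TD where "TA = tri A (pt 1 0) (pt 1 1) a" and "TD = tri D (pt (- 1) 1) (pt (- 1) 0) a"
  have TA: "z \<in> TA \<longleftrightarrow> 0 \<le> z $ 2 \<and> z $ 2 \<le> z $ 1 \<and> z $ 1 < a"
    and TD: "z \<in> TD \<longleftrightarrow> 0 \<le> z $ 2 \<and> z $ 2 \<le> 2 * a + b - z $ 1 \<and> 2 * a + b - z $ 1 < a" for z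
    by (simp_all add: TA_def TD_def A_def D_def tri_left tri_right)
  have sl: "[1, 1] \<in> sign_lists (length c)" by (simp add: sign_lists_def)
  have cA: "corner_packed (Q, c, [1, 1]) A TA"
    unfolding TA_def
  proof (rule corner_packed_tri[of _ _ _ _ _ "vector [1, 0]" _ "vector [1, 1]"])
    show "A extreme_point_of Q" "delzant_condition Q A"
      by (rule delzant_corner_at[OF convex_base2, of "pt 1 0" "vector [1, 0]" "pt 1 1" "vector [1, 1]" "2 * a + b" a];
        use a b in \<open>auto simp: real_vec_vector cross2_def base2_def A_def\<close>)+
    show "tri A (pt 1 0) (pt 1 1) a \<subseteq> Q" "set c \<inter> tri A (pt 1 0) (pt 1 1) a = {}"
      using a b unfolding TA_def[symmetric] by (auto simp: TA base2_def)
    show "of_int ([1, 1] ! i) * (A $ 2 - c ! i $ 2) < 0" if "i < length c" "c ! i $ 1 = A $ 1" for i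
      using that a b by (cases i) (auto simp: A_def)
  qed (use a b sl in \<open>auto simp: real_vec_vector cross2_def base2_def A_def\<close>)
  have cD: "corner_packed (Q, c, [1, 1]) D TD"
    unfolding TD_def
  proof (rule corner_packed_tri[of _ _ _ _ _ "vector [- 1, 1]" _ "vector [- 1, 0]"])
    show "D extreme_point_of Q" "delzant_condition Q D"
      by (rule delzant_corner_at[OF convex_base2, of "pt (- 1) 1" "vector [- 1, 1]" "pt (- 1) 0" "vector [- 1, 0]" a "2 * a + b"];
        use a b in \<open>auto simp: real_vec_vector cross2_def base2_def D_def\<close>)+
    show "tri D (pt (- 1) 1) (pt (- 1) 0) a \<subseteq> Q" "set c \<inter> tri D (pt (- 1) 1) (pt (- 1) 0) a = {}"
      using a b unfolding TD_def[symmetric] by (auto simp: TD base2_def)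
    show "of_int ([1, 1] ! i) * (D $ 2 - c ! i $ 2) < 0" if "i < length c" "c ! i $ 1 = D $ 1" for i
      using that a b by (cases i) (auto simp: D_def)
  qed (use a b sl in \<open>auto simp: real_vec_vector cross2_def base2_def D_def\<close>)
  \<comment> \<open>One triangle lies in x < a and the other in x > a + b, so both corners can have
    the maximal size at once.\<close>
  have AD: "TA \<inter> TD = {}"
    using b by (auto simp: TA TD)
  have mT: "TA \<in> lmeasurable \<and> measure lebesgue TA = a^2 / 2" "TD \<in> lmeasurable \<and> measure lebesgue TD = a^2 / 2"
    unfolding TA_def TD_def using a by (intro measure_tri; simp add: cross2_def)+
  have "rho_ST (semitoric_orbit (chart_triple (Q, c, [1, 1]) [1, 1] 0 0)) = a^2 / measure lebesgue Q"
  proof (rule rho_ST_eq[where ?\<B>0.0 = "{TA, TD}", OF sl base2_hull(2)[OF a b] upper2 _ _ _ sl])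
    show "disjoint {TA, TD}"
      using AD by (auto simp: pairwise_insert disjnt_def)
    show "measure lebesgue (\<Union>{TA, TD}) = a^2"
      using measure_Un3[of TA lebesgue TD] mT AD by simp
    have "chart_vertex c [1, 1] s k r Q A" for s k r
      by (rule chart_extreme_sideways[of _ _ 1]) (use a b in \<open>auto simp: base2_def A_def vec2_eq_iff\<close>)
    moreover have "chart_vertex c [1, 1] s k r Q D" for s k r
      by (rule chart_extreme_sideways[of _ _ "- 1"]) (use a b in \<open>auto simp: base2_def D_def vec2_eq_iff\<close>)
    ultimately show "\<exists>p. corner_packed (Q, c, [1, 1]) p B \<and>
        (\<forall>s\<in>sign_lists (length c). \<forall>k r. chart_vertex c [1, 1] s k r Q p)"
      if "B \<in> {TA, TD}" for B
      using cA cD that by blast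
  qed
  moreover have "chart_triple (Q, c, [1, 1]) [1, 1] 0 0
      = (convex hull {pt 0 0, pt a a, pt (a + b) a, pt (2 * a + b) 0}, c, [1, 1])"
    using base2_hull(1)[OF a b] by (simp add: chart_triple_def chart_self)
  moreover have "a^2 / measure lebesgue Q = a / (a + b)"
    unfolding base2_hull(3)[OF a b] using a by (simp add: power2_eq_square)
  ultimately show ?thesis by (simp only:)
qed

end

theorem theorem1p7:
  shows
   "(\<forall>a h S. minimal_1 a h S \<longrightarrow>
        rho_ST S = (a^2 + 2 * h^2 - 2 * a * h) / a^2) \<and>
    (\<forall>a b h1 h2 S. minimal_2 a b h1 h2 S \<longrightarrow>
        rho_ST S = a / (a + b)) \<and>
    (\<forall>a b h n S. minimal_3a a b h n S \<longrightarrow>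
        (n > 1 \<longrightarrow> rho_ST S = 2 * a / (real n * a + 2 * b)) \<and>
        (n = 1 \<and> a \<le> b \<longrightarrow> rho_ST S = 2 * a / (a + 2 * b)) \<and>
        (n = 1 \<and> b < a \<and> a < 2 * b \<longrightarrow>
           rho_ST S = (a^2 + b^2 + (a - b)^2) / ((a + 2 * b) * a)) \<and>
        (n = 1 \<and> a \<ge> 2 * b \<longrightarrow> rho_ST S = (a^2 + 2 * b^2) / ((a + 2 * b) * a))) \<and>
    (\<forall>a h n S. minimal_3b a h n S \<longrightarrow>
        rho_ST S = 2 / real n) \<and>
    (\<forall>a b h n S. minimal_3c a b h n S \<longrightarrow>
        rho_ST S = ((a + b)^2 + min (((real n - 1) * a + b - (real n - 2) * h)^2) (a^2))
                     / ((real n * a + 2 * b) * a))"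
proof (intro conjI allI impI)
  fix a h :: real and S
  assume "minimal_1 a h S"
  then show "rho_ST S = (a^2 + 2 * h^2 - 2 * a * h) / a^2"
    unfolding minimal_1_def using rho_ST_type1[of a h] by auto
next
  fix a b h1 h2 :: real and S
  assume "minimal_2 a b h1 h2 S"
  then have "type2 a b h1 h2"
    and "S = semitoric_orbit (convex hull {pt 0 0, pt a a, pt (a + b) a, pt (2*a + b) 0}, [pt a h1, pt (a + b) h2], [1, 1])"
    unfolding minimal_2_def type2_def by auto
  then show "rho_ST S = a / (a + b)"
    using type2.rho_ST_type2 by blast
next
  fix a b h :: real and n :: nat and S
  assume "minimal_3a a b h n S"
  then have hyps: "0 < a" "0 < b" "0 < h" "h < a" "1 \<le> n"
    and S: "S = semitoric_orbit (convex hull {pt 0 0, pt a a, pt (a + b) a, pt (real n * a + b) 0}, [pt a h], [1])"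
    unfolding minimal_3a_def by auto
  have "(real n - 1) * h \<le> (real n - 1) * a"
    using hyps by (intro mult_left_mono) auto
  then interpret type3 a b h n
    using hyps by unfold_locales auto
  show "rho_ST S = 2 * a / (real n * a + 2 * b)" if "1 < n"
    unfolding S using rho_ST_ab hyps that by simp
  show "rho_ST S = 2 * a / (a + 2 * b)" if "n = 1 \<and> a \<le> b"
    unfolding S using rho_ST_one(1) that by blast
  show "rho_ST S = (a^2 + b^2 + (a - b)^2) / ((a + 2 * b) * a)" if "n = 1 \<and> b < a \<and> a < 2 * b"
    unfolding S using rho_ST_one(2) that by blast
  show "rho_ST S = (a^2 + 2 * b^2) / ((a + 2 * b) * a)" if "n = 1 \<and> 2 * b \<le> a"
    unfolding S using rho_ST_one(3) that by blast
next
  fix a h :: real and n :: nat and S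
  assume "minimal_3b a h n S"
  then have hyps: "0 < a" "0 < h" "h < a" "2 \<le> n"
    and S: "S = semitoric_orbit (convex hull {pt 0 0, pt a a, pt (real n * a) 0}, [pt a h], [1])"
    unfolding minimal_3b_def by auto
  \<comment> \<open>Type (3b) is the case b = 0, in which the vertices (a,a) and (a + b,a)
    coincide.\<close>
  interpret type3 a 0 h n
    using hyps by unfold_locales auto
  show "rho_ST S = 2 / real n"
    unfolding S using rho_ST_ab hyps by simp
next
  fix a b h :: real and n :: nat and S
  assume "minimal_3c a b h n S"
  then have hyps: "0 < a" "b < 0" "0 < a + b" "0 < h" "h < a + b / (real n - 1)" "2 \<le> n"
    and S: "S = semitoric_orbit (convex hull {pt 0 0, pt (a + b) (a + b), pt a (a + b / (real n - 1)),
      pt (real n * a + b) 0}, [pt a h], [1])"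
    unfolding minimal_3c_def by auto
  have "b / (real n - 1) < 0"
    using hyps by (intro divide_neg_pos) auto
  moreover have "(real n - 1) * h < (real n - 1) * (a + b / (real n - 1))"
    using hyps by (intro mult_strict_left_mono) auto
  \<comment> \<open>The bound on \<open>h\<close>, multiplied by n - 1, is the locale assumption
    that the mark lies below the edge from \<open>PC\<close> to \<open>PD\<close>.\<close>
  then have "(real n - 1) * h < (real n - 1) * a + b"
    using hyps by (simp add: distrib_left)
  ultimately interpret type3 a b h n
    using hyps by unfold_locales auto
  show "rho_ST S = ((a + b)^2 + min (((real n - 1) * a + b - (real n - 2) * h)^2) (a^2))
      / ((real n * a + 2 * b) * a)"
    unfolding S using rho_ST_c hyps by blast
qed

end
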